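(* Let $\alpha>0$ and $k\ge0$. Let $\mu$ be a probability measure on $[a,b]$ with Lebesgue density $m\in C^{k+1}([a,b])$, $m>0$ on $[a,b]$, and let $u_0\in C^{k+2}([a,b])$ with $u_0(a)=u_0(b)=0$. For every $t\ge0$ let $\Phi_t$ be the minimizer of $F_\alpha^{f_\alpha^{tu_0},\mu}$ in $\mathscr{H}$. Define $u(x,t)=\dot\Phi_t(\Phi_t^{-1}(x))$ and $\rho(x,t)=\big(\tfrac{m}{\partial_x\Phi_t}\big)(\Phi_t^{-1}(x))$. Then $t\mapsto u(\cdot,t)$ is in $C^0([0,\infty);C^{k+2}([a,b]))\cap C^1([0,\infty);C^{k+1}([a,b]))$, $t\mapsto\rho(\cdot,t)$ is in $C^0([0,\infty);C^{k+1}([a,b]))\cap C^1([0,\infty);C^{k}([a,b]))$, and together (with $\Sigma$ determined by the second line and the boundary conditions below) they solve the Eulerian pressureless information geometric regularization (IGR) equation $$\begin{cases}\partial_t(\rho u)+\partial_x(\rho u^2+\Sigma)=0,\quad \partial_t\rho+\partial_x(\rho u)=0, & x\in(a,b),\ t\in\mathbb{R}_+,\\ \rho^{-1}\Sigma-\alpha\,\partial_x(\rho^{-1}\partial_x\Sigma)=2\alpha(\partial_xu)^2, & x\in(a,b),\ t\in\mathbb{R}_+,\\ u(a,t)=u(b,t)=\partial_x\Sigma(a,t)=\partial_x\Sigma(b,t)=0,& t\in\mathbb{R}_+,\\ u(x,0)=u_0(x),\quad\rho(x,0)=m(x),&x\in[a,b].\end{cases}$$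
   Context: Fix reals $a<b$; $\mathscr{L}$ is Lebesgue measure, dots denote derivatives in $t$. The Helly space is $\mathscr{H}=\{\Phi:[a,b]\to[a,b]\ :\ \Phi \text{ monotone (non-decreasing)},\ \Phi(a)=a,\ \Phi(b)=b\}$. $\mathsf{Ent}(\nu)=\int \frac{d\nu}{d\mathscr{L}}\log\frac{d\nu}{d\mathscr{L}}\,d\mathscr{L}$ if $\nu\ll\mathscr{L}$ and $+\infty$ otherwise. For a linear functional $f$ and $\Phi\in\mathscr{H}$, $F_\alpha^{f,\mu}(\Phi)=\int_a^b\frac{(\Phi(x)-x)^2}{2}\,d\mu(x)+\alpha\,\mathsf{Ent}(\Phi_\#\mu)-f(\Phi)$. For a velocity $w$, $f_\alpha^{w}(\Phi)=\int_a^b \Phi\, w+\alpha\,\partial_x\Phi\,\partial_x w\,d\mu-\int_a^b\alpha\,\partial_x\Phi\,d\mu$; for $\Phi\in\mathscr{H}$ not weakly differentiable this is understood via integration by parts: $f_\alpha^w(\Phi)=\int_a^b\Phi\,[\,w m-\alpha\partial_x(m\,\partial_x w)+\alpha\,\partial_x m\,]\,dx+\alpha[m\,(\partial_x w)\Phi]_a^b-\alpha[m\Phi]_a^b$. *)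

theory Defs
  imports "HOL-Probability.Probability"
begin

section \<open>Spaces of continuously differentiable functions\<close>

text \<open>
  Functions on an interval \<open>S\<close> are total functions of which only the values on \<open>S\<close> matter.
  Derivatives are taken within \<open>S\<close>, hence are one-sided at the end points belonging to \<open>S\<close>.
\<close>

definition pd :: "real set \<Rightarrow> (real \<Rightarrow> real) \<Rightarrow> real \<Rightarrow> real" where
  "pd S f x = vector_derivative f (at x within S)"

definition Ck_on :: "real set \<Rightarrow> nat \<Rightarrow> (real \<Rightarrow> real) \<Rightarrow> bool" where
  "Ck_on S n f \<longleftrightarrow>
     (\<forall>j<n. (pd S ^^ j) f differentiable_on S) \<and> continuous_on S ((pd S ^^ n) f)"

definition Ck_norm :: "real set \<Rightarrow> nat \<Rightarrow> (real \<Rightarrow> real) \<Rightarrow> real" where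
  "Ck_norm S n f = (\<Sum>j\<le>n. SUP x\<in>S. \<bar>(pd S ^^ j) f x\<bar>)"

text \<open>Curves \<open>U : [0,\<infinity>) \<rightarrow> C\<^sup>n(S)\<close> (for compact \<open>S\<close>), continuous respectively
  continuously differentiable for the \<open>C\<^sup>n\<close> norm.\<close>

definition C0_curve :: "real set \<Rightarrow> nat \<Rightarrow> (real \<Rightarrow> real \<Rightarrow> real) \<Rightarrow> bool" where
  "C0_curve S n U \<longleftrightarrow>
     (\<forall>t\<ge>0. Ck_on S n (U t)) \<and>
     (\<forall>t\<ge>0. ((\<lambda>s. Ck_norm S n (\<lambda>x. U s x - U t x)) \<longlongrightarrow> 0) (at t within {0..}))"

definition C1_curve :: "real set \<Rightarrow> nat \<Rightarrow> (real \<Rightarrow> real \<Rightarrow> real) \<Rightarrow> bool" where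
  "C1_curve S n U \<longleftrightarrow>
     (\<forall>t\<ge>0. Ck_on S n (U t)) \<and>
     (\<exists>U'. C0_curve S n U' \<and>
       (\<forall>t\<ge>0. ((\<lambda>s. Ck_norm S n (\<lambda>x. (U s x - U t x) / (s - t) - U' t x)) \<longlongrightarrow> 0)
                (at t within {0..})))"

section \<open>Helly space, entropy and the variational problem\<close>

definition helly_space :: "real \<Rightarrow> real \<Rightarrow> (real \<Rightarrow> real) set" where
  "helly_space a b =
     {\<Phi>. \<Phi> \<in> {a..b} \<rightarrow> {a..b} \<and> mono_on {a..b} \<Phi> \<and> \<Phi> a = a \<and> \<Phi> b = b}"

text \<open>The integral of \<open>r log r\<close> is extended-valued: positive part minus negative part.
  For \<open>\<nu>\<close> carried by a bounded interval the negative part is finite.  At \<open>r = 0\<close> the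
  integrand is \<open>0\<close>, as it should be, because \<open>0 * ln 0 = 0\<close>.\<close>

definition Ent :: "real measure \<Rightarrow> ereal" where
  "Ent \<nu> =
     (if absolutely_continuous lborel \<nu> then
        let r = (\<lambda>x. enn2real (RN_deriv lborel \<nu> x)) in
          enn2ereal (\<integral>\<^sup>+x. ennreal (r x * ln (r x)) \<partial>lborel)
          - enn2ereal (\<integral>\<^sup>+x. ennreal (- (r x * ln (r x))) \<partial>lborel)
      else \<infinity>)"

text \<open>The measure \<open>\<mu>\<close> lives on the measurable space \<open>{a..b}\<close>; the push-forward is regarded
  as a measure on the whole line.\<close>

definition F_functional ::
  "real \<Rightarrow> ((real \<Rightarrow> real) \<Rightarrow> real) \<Rightarrow> real measure \<Rightarrow> (real \<Rightarrow> real) \<Rightarrow> ereal" where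
  "F_functional \<alpha> f \<mu> \<Phi> =
     ereal (\<integral>x. (\<Phi> x - x)\<^sup>2 / 2 \<partial>\<mu>) + ereal \<alpha> * Ent (distr \<mu> lborel \<Phi>) - ereal (f \<Phi>)"

definition is_minimizer_in :: "'a set \<Rightarrow> ('a \<Rightarrow> ereal) \<Rightarrow> 'a \<Rightarrow> bool" where
  "is_minimizer_in A F x \<longleftrightarrow> x \<in> A \<and> (\<forall>y\<in>A. F x \<le> F y)"

text \<open>\<open>f_functional a b \<alpha> m w\<close> is the functional
  \<open>\<Phi> \<mapsto> \<integral> \<Phi> w + \<alpha> \<Phi>' w' d\<mu> - \<integral> \<alpha> \<Phi>' d\<mu>\<close>, \<open>\<mu> = m dx\<close>, written in the integrated-by-parts form that
  makes sense on the whole Helly space.  The lemma \<open>f_functional_weak_derivative\<close> below shows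
  that it is the original expression whenever \<open>\<Phi>\<close> has a weak derivative.\<close>

definition f_functional ::
  "real \<Rightarrow> real \<Rightarrow> real \<Rightarrow> (real \<Rightarrow> real) \<Rightarrow> (real \<Rightarrow> real) \<Rightarrow> (real \<Rightarrow> real) \<Rightarrow> real" where
  "f_functional a b \<alpha> m w \<Phi> =
     (let D = pd {a..b} in
       (LINT x:{a..b}|lborel.
          \<Phi> x * (w x * m x - \<alpha> * D (\<lambda>y. m y * D w y) x + \<alpha> * D m x))
       + \<alpha> * (m b * D w b * \<Phi> b - m a * D w a * \<Phi> a)
       - \<alpha> * (m b * \<Phi> b - m a * \<Phi> a))"

lemma has_field_derivative_pd:
  assumes "a < b" "f differentiable_on {a..b}" "x \<in> {a..b}"
  shows "(f has_real_derivative pd {a..b} f x) (at x within {a..b})"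
proof -
  have "f differentiable (at x within {a..b})"
    using assms(2,3) by (auto simp: differentiable_on_def)
  then have "(f has_vector_derivative pd {a..b} f x) (at x within {a..b})"
    unfolding pd_def by (simp add: vector_derivative_works)
  then show ?thesis
    by (simp add: has_real_derivative_iff_has_vector_derivative)
qed

lemma set_integrable_mult_continuous:
  fixes g h :: "real \<Rightarrow> real"
  assumes g: "set_integrable lborel {a..b} g" and h: "continuous_on {a..b} h"
  shows "set_integrable lborel {a..b} (\<lambda>x. g x * h x)"
proof -
  define g0 where "g0 x = indicator {a..b} x * g x" for x
  have g0_int: "integrable lborel g0"
    using g by (simp add: set_integrable_def g0_def[abs_def])
  note [measurable] = borel_measurable_integrable[OF g0_int]
  have "compact (h ` {a..b})"
    using h by (rule compact_continuous_image) simp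
  then obtain C where C: "\<And>x. x \<in> {a..b} \<Longrightarrow> \<bar>h x\<bar> \<le> C"
    by (metis bounded_iff compact_imp_bounded imageI real_norm_def)
  have hm [measurable]: "(\<lambda>x. indicator {a..b} x * h x) \<in> borel_measurable lborel"
    using borel_measurable_continuous_on_indicator[OF _ h] by simp
  have "integrable lborel (\<lambda>x. g0 x * (indicator {a..b} x * h x))"
  proof (rule Bochner_Integration.integrable_bound)
    show "integrable lborel (\<lambda>x. C * g0 x)" using g0_int by simp
    show "AE x in lborel. norm (g0 x * (indicator {a..b} x * h x)) \<le> norm (C * g0 x)"
    proof (intro AE_I2)
      fix x
      show "norm (g0 x * (indicator {a..b} x * h x)) \<le> norm (C * g0 x)"
      proof (cases "x \<in> {a..b}")
        case True
        have "\<bar>h x\<bar> * \<bar>g0 x\<bar> \<le> \<bar>C\<bar> * \<bar>g0 x\<bar>"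
          using C[OF True] by (intro mult_right_mono) auto
        then show ?thesis using True by (simp add: abs_mult mult.commute)
      qed (simp add: g0_def)
    qed
  qed measurable
  moreover have "(\<lambda>x. g0 x * (indicator {a..b} x * h x)) = (\<lambda>x. indicator {a..b} x * (g x * h x))"
    by (auto simp: g0_def indicator_def)
  ultimately show ?thesis by (simp add: set_integrable_def)
qed

lemma integral_by_parts_weak_derivative:
  fixes g h h' \<Phi> :: "real \<Rightarrow> real"
  assumes ab: "a < b"
    and h: "\<And>x. x \<in> {a..b} \<Longrightarrow> (h has_real_derivative h' x) (at x within {a..b})"
    and h': "continuous_on {a..b} h'"
    and g: "set_integrable lborel {a..b} g"
    and \<Phi>: "\<And>x. x \<in> {a..b} \<Longrightarrow> \<Phi> x = \<Phi> a + (LINT y:{a..x}|lborel. g y)"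
  shows "(LINT x:{a..b}|lborel. g x * h x)
           = h b * \<Phi> b - h a * \<Phi> a - (LINT x:{a..b}|lborel. \<Phi> x * h' x)"
proof -
  define g0 where "g0 x = indicator {a..b} x * g x" for x
  define k0 where "k0 x = indicator {a..b} x * h' x" for x
  have g0_int: "integrable lborel g0"
    using g by (simp add: set_integrable_def g0_def[abs_def])
  have k_set: "set_integrable lborel {a..b} h'"
    using borel_integrable_atLeastAtMost'[OF h'] .
  have k0_int: "integrable lborel k0"
    using k_set by (simp add: set_integrable_def k0_def[abs_def])
  note [measurable] = borel_measurable_integrable[OF g0_int] borel_measurable_integrable[OF k0_int]
  define K where "K x y = (if x \<le> y then g0 x * k0 y else 0)" for x y
  have K_meas [measurable]: "case_prod K \<in> borel_measurable (lborel \<Otimes>\<^sub>M lborel)"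
    unfolding K_def by measurable
  have G_int: "integrable (lborel \<Otimes>\<^sub>M lborel) (\<lambda>(x,y). g0 x * k0 y)"
  proof (rule lborel_pair.Fubini_integrable)
    show "(\<lambda>(x, y). g0 x * k0 y) \<in> borel_measurable (lborel \<Otimes>\<^sub>M lborel)"
      by measurable
    have "integrable lborel (\<lambda>x. \<bar>g0 x\<bar> * (\<integral>y. \<bar>k0 y\<bar> \<partial>lborel))"
      using g0_int by (intro integrable_mult_left integrable_abs) auto
    then show "integrable lborel (\<lambda>x. \<integral>y. norm (case (x, y) of (x, y) \<Rightarrow> g0 x * k0 y) \<partial>lborel)"
      by (simp add: abs_mult)
    show "AE x in lborel. integrable lborel (\<lambda>y. case (x, y) of (x, y) \<Rightarrow> g0 x * k0 y)"
      using k0_int by simp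
  qed
  have K_int: "integrable (lborel \<Otimes>\<^sub>M lborel) (case_prod K)"
    by (rule Bochner_Integration.integrable_bound[OF G_int K_meas]) (auto simp: K_def)
  have Fub: "(\<integral>y. (\<integral>x. K x y \<partial>lborel) \<partial>lborel) = (\<integral>x. (\<integral>y. K x y \<partial>lborel) \<partial>lborel)"
    by (rule lborel_pair.Fubini_integral[OF K_int])
  have inner_x: "(\<integral>x. K x y \<partial>lborel) = indicator {a..b} y * ((\<Phi> y - \<Phi> a) * h' y)" for y
  proof (cases "y \<in> {a..b}")
    case True
    have "(\<integral>x. K x y \<partial>lborel) = (\<integral>x. (indicator {a..y} x * g x) * h' y \<partial>lborel)"
      using True by (intro Bochner_Integration.integral_cong)
        (auto simp: K_def g0_def k0_def indicator_def)
    also have "\<dots> = (LINT x:{a..y}|lborel. g x) * h' y"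
      by (simp add: set_lebesgue_integral_def)
    also have "\<dots> = (\<Phi> y - \<Phi> a) * h' y"
      using \<Phi>[OF True] by simp
    finally show ?thesis using True by simp
  next
    case False
    then have "k0 y = 0" "indicator {a..b} y = (0::real)" by (simp_all add: k0_def)
    moreover from this have "K x y = 0" for x by (simp add: K_def)
    ultimately show ?thesis by simp
  qed
  have FTC: "(LINT y:{x..b}|lborel. h' y) = h b - h x" if x: "x \<in> {a..b}" for x
  proof -
    have "(\<integral>y. indicator {x..b} y *\<^sub>R h' y \<partial>lborel) = h b - h x"
    proof (rule integral_FTC_Icc)
      show "x \<le> b" using x by simp
      fix y assume "x \<le> y" "y \<le> b"
      then have "(h has_real_derivative h' y) (at y within {x..b})"
        using x by (intro DERIV_subset[OF h]) auto
      then show "(h has_vector_derivative h' y) (at y within {x..b})"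
        by (simp add: has_real_derivative_iff_has_vector_derivative)
    next
      show "continuous_on {x..b} h'"
        using x by (intro continuous_on_subset[OF h']) auto
    qed
    then show ?thesis by (simp add: set_lebesgue_integral_def)
  qed
  have inner_y: "(\<integral>y. K x y \<partial>lborel) = indicator {a..b} x * (g x * (h b - h x))" for x
  proof (cases "x \<in> {a..b}")
    case True
    have "(\<integral>y. K x y \<partial>lborel) = (\<integral>y. g x * (indicator {x..b} y * h' y) \<partial>lborel)"
      using True by (intro Bochner_Integration.integral_cong)
        (auto simp: K_def g0_def k0_def indicator_def)
    also have "\<dots> = g x * (LINT y:{x..b}|lborel. h' y)"
      by (simp add: set_lebesgue_integral_def)
    finally show ?thesis using True FTC[OF True] by simp
  next
    case False
    then have "g0 x = 0" "indicator {a..b} x = (0::real)" by (simp_all add: g0_def)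
    moreover from this have "K x y = 0" for y by (simp add: K_def)
    ultimately show ?thesis by simp
  qed
  have h_cont: "continuous_on {a..b} h"
    by (rule DERIV_continuous_on) (rule h)
  have gh_int: "integrable lborel (\<lambda>x. indicator {a..b} x * (g x * h x))"
    using set_integrable_mult_continuous[OF g h_cont] by (simp add: set_integrable_def)
  have yk_int: "integrable lborel (\<lambda>y. indicator {a..b} y * ((\<Phi> y - \<Phi> a) * h' y))"
    using lborel_pair.integrable_snd[OF K_int] by (simp add: inner_x)
  have ik_int: "integrable lborel (\<lambda>y. indicator {a..b} y * h' y)"
    using k0_int by (simp add: k0_def[abs_def])
  have "(\<integral>x. indicator {a..b} x * (g x * (h b - h x)) \<partial>lborel)
      = (\<integral>x. h b * g0 x - indicator {a..b} x * (g x * h x) \<partial>lborel)"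
    by (intro Bochner_Integration.integral_cong) (auto simp: g0_def algebra_simps)
  also have "\<dots> = h b * (\<integral>x. g0 x \<partial>lborel) - (\<integral>x. indicator {a..b} x * (g x * h x) \<partial>lborel)"
    using g0_int gh_int by simp
  also have "(\<integral>x. g0 x \<partial>lborel) = \<Phi> b - \<Phi> a"
    using \<Phi>[of b] ab by (simp add: g0_def set_lebesgue_integral_def)
  finally have R: "(\<integral>x. indicator {a..b} x * (g x * (h b - h x)) \<partial>lborel)
      = h b * (\<Phi> b - \<Phi> a) - (LINT x:{a..b}|lborel. g x * h x)"
    by (simp add: set_lebesgue_integral_def)
  have "(LINT x:{a..b}|lborel. \<Phi> x * h' x)
      = (\<integral>y. indicator {a..b} y * ((\<Phi> y - \<Phi> a) * h' y) + \<Phi> a * (indicator {a..b} y * h' y) \<partial>lborel)"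
    unfolding set_lebesgue_integral_def
    by (intro Bochner_Integration.integral_cong) (auto simp: algebra_simps)
  also have "\<dots> = (\<integral>y. indicator {a..b} y * ((\<Phi> y - \<Phi> a) * h' y) \<partial>lborel)
      + \<Phi> a * (\<integral>y. indicator {a..b} y * h' y \<partial>lborel)"
    using yk_int ik_int by simp
  also have "(\<integral>y. indicator {a..b} y * h' y \<partial>lborel) = h b - h a"
    using FTC[of a] ab by (simp add: set_lebesgue_integral_def)
  finally show ?thesis
    using Fub R by (simp add: inner_x inner_y algebra_simps)
qed

lemma f_functional_weak_derivative:
  assumes ab: "a < b"
    and \<mu>: "\<mu> = density (restrict_space lborel {a..b}) (\<lambda>x. ennreal (m x))"
    and m_pos: "\<And>x. x \<in> {a..b} \<Longrightarrow> m x > 0"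
    and m: "Ck_on {a..b} 1 m" and w: "Ck_on {a..b} 2 w"
    and g: "set_integrable lborel {a..b} \<Phi>'"
    and \<Phi>: "\<And>x. x \<in> {a..b} \<Longrightarrow> \<Phi> x = \<Phi> a + (LINT y:{a..x}|lborel. \<Phi>' y)"
  shows "f_functional a b \<alpha> m w \<Phi> =
     (\<integral>x. \<Phi> x * w x + \<alpha> * \<Phi>' x * pd {a..b} w x \<partial>\<mu>) - (\<integral>x. \<alpha> * \<Phi>' x \<partial>\<mu>)"
proof -
  define w' where "w' = pd {a..b} w"
  define p where "p x = m x * w' x" for x
  define h where "h x = \<alpha> * p x - \<alpha> * m x" for x
  define h' where "h' x = \<alpha> * pd {a..b} p x - \<alpha> * pd {a..b} m x" for x
  have m_diff: "m differentiable_on {a..b}" and m'_cont: "continuous_on {a..b} (pd {a..b} m)"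
    using m by (auto simp: Ck_on_def)
  have w_diff: "w differentiable_on {a..b}" and w'_diff: "w' differentiable_on {a..b}"
    and w''_cont: "continuous_on {a..b} (pd {a..b} w')"
    using w by (auto simp: Ck_on_def w'_def numeral_2_eq_2 less_Suc_eq)
  have p_diff: "p differentiable_on {a..b}"
    unfolding p_def[abs_def] using m_diff w'_diff by (intro differentiable_on_mult)
  have m_cont: "continuous_on {a..b} m" and w_cont: "continuous_on {a..b} w"
    and w'_cont: "continuous_on {a..b} w'"
    using m_diff w_diff w'_diff by (auto intro: differentiable_imp_continuous_on)
  have pd_p: "pd {a..b} p x = m x * pd {a..b} w' x + pd {a..b} m x * w' x" if "x \<in> {a..b}" for x
  proof -
    have "(p has_real_derivative m x * pd {a..b} w' x + pd {a..b} m x * w' x) (at x within {a..b})"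
      unfolding p_def[abs_def]
      using DERIV_mult[OF has_field_derivative_pd[OF ab m_diff that]
          has_field_derivative_pd[OF ab w'_diff that]]
      by (simp add: algebra_simps)
    then show ?thesis
      unfolding pd_def using vector_derivative_within_cbox[of a b x p] that ab
      by (auto simp: has_real_derivative_iff_has_vector_derivative)
  qed
  have "continuous_on {a..b} (\<lambda>x. m x * pd {a..b} w' x + pd {a..b} m x * w' x)"
    by (intro continuous_intros m_cont w''_cont m'_cont w'_cont)
  then have p'_cont: "continuous_on {a..b} (pd {a..b} p)"
    by (rule continuous_on_eq) (simp add: pd_p)
  have h'_cont: "continuous_on {a..b} h'"
    unfolding h'_def[abs_def] by (intro continuous_intros p'_cont m'_cont)
  have h_deriv: "(h has_real_derivative h' x) (at x within {a..b})" if "x \<in> {a..b}" for x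
    unfolding h_def[abs_def] h'_def
    by (intro DERIV_diff DERIV_cmult has_field_derivative_pd[OF ab p_diff that]
        has_field_derivative_pd[OF ab m_diff that])
  have IBP: "(LINT x:{a..b}|lborel. \<Phi>' x * h x)
      = h b * \<Phi> b - h a * \<Phi> a - (LINT x:{a..b}|lborel. \<Phi> x * h' x)"
    by (rule integral_by_parts_weak_derivative[OF ab h_deriv h'_cont g \<Phi>])
  have \<Phi>_eq: "\<Phi> x = \<Phi> a + integral {a..x} \<Phi>'" if "x \<in> {a..b}" for x
    using \<Phi>[OF that] set_borel_integral_eq_integral(2)[of "{a..x}" \<Phi>']
      set_integrable_subset[OF g, of "{a..x}"] that by simp
  have "continuous_on {a..b} (\<lambda>x. \<Phi> a + integral {a..x} \<Phi>')"
    using set_borel_integral_eq_integral(1)[OF g]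
    by (intro continuous_intros indefinite_integral_continuous_1)
  then have \<Phi>_cont: "continuous_on {a..b} \<Phi>"
    by (rule continuous_on_eq) (rule \<Phi>_eq[symmetric])
  have \<mu>_int: "(\<integral>x. F x \<partial>\<mu>) = (LINT x:{a..b}|lborel. m x * F x)"
    if F: "set_integrable lborel {a..b} F" for F
  proof -
    have [measurable]: "F \<in> borel_measurable (restrict_space lborel {a..b})"
      using borel_measurable_integrable[OF F[unfolded set_integrable_def]]
      by (subst borel_measurable_restrict_space_iff) auto
    have [measurable]: "m \<in> borel_measurable (restrict_space lborel {a..b})"
      using borel_measurable_continuous_on_indicator[OF _ m_cont]
      by (subst borel_measurable_restrict_space_iff) auto
    have "(\<integral>x. F x \<partial>\<mu>) = (\<integral>x. m x * F x \<partial>restrict_space lborel {a..b})"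
      unfolding \<mu> using m_pos
      by (subst integral_density) (auto intro!: AE_I2 simp: space_restrict_space less_imp_le)
    then show ?thesis
      by (simp add: integral_restrict_space set_lebesgue_integral_def)
  qed
  have i1: "set_integrable lborel {a..b} (\<lambda>x. \<Phi> x * w x)"
    by (intro borel_integrable_atLeastAtMost' continuous_intros \<Phi>_cont w_cont)
  have i2: "set_integrable lborel {a..b} (\<lambda>x. \<alpha> * \<Phi>' x * w' x)"
    using set_integrable_mult_continuous[OF g w'_cont] by (simp add: mult.assoc)
  have i3: "set_integrable lborel {a..b} (\<lambda>x. \<alpha> * \<Phi>' x)"
    using g by simp
  have i12: "set_integrable lborel {a..b} (\<lambda>x. \<Phi> x * w x + \<alpha> * \<Phi>' x * w' x)"
    by (rule set_integral_add(1)[OF i1 i2])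
  have j1: "set_integrable lborel {a..b} (\<lambda>x. m x * (\<Phi> x * w x + \<alpha> * \<Phi>' x * w' x))"
    using set_integrable_mult_continuous[OF i12 m_cont] by (simp add: mult.commute)
  have j2: "set_integrable lborel {a..b} (\<lambda>x. m x * (\<alpha> * \<Phi>' x))"
    using set_integrable_mult_continuous[OF i3 m_cont] by (simp add: mult.commute)
  have j3: "set_integrable lborel {a..b} (\<lambda>x. \<Phi> x * w x * m x)"
    by (rule set_integrable_mult_continuous[OF i1 m_cont])
  have j4: "set_integrable lborel {a..b} (\<lambda>x. \<Phi>' x * h x)"
    unfolding h_def[abs_def] p_def[abs_def]
    by (intro set_integrable_mult_continuous[OF g] continuous_intros m_cont w'_cont)
  have j5: "set_integrable lborel {a..b} (\<lambda>x. \<Phi> x * h' x)"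
    by (intro borel_integrable_atLeastAtMost' continuous_intros \<Phi>_cont h'_cont)
  have "(\<integral>x. \<Phi> x * w x + \<alpha> * \<Phi>' x * w' x \<partial>\<mu>) - (\<integral>x. \<alpha> * \<Phi>' x \<partial>\<mu>)
     = (LINT x:{a..b}|lborel. m x * (\<Phi> x * w x + \<alpha> * \<Phi>' x * w' x) - m x * (\<alpha> * \<Phi>' x))"
    by (simp only: \<mu>_int[OF i12] \<mu>_int[OF i3] set_integral_diff(2)[OF j1 j2])
  also have "(\<lambda>x. m x * (\<Phi> x * w x + \<alpha> * \<Phi>' x * w' x) - m x * (\<alpha> * \<Phi>' x))
     = (\<lambda>x. \<Phi> x * w x * m x + \<Phi>' x * h x)"
    by (auto simp: h_def p_def algebra_simps)
  also have "(LINT x:{a..b}|lborel. \<Phi> x * w x * m x + \<Phi>' x * h x)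
     = (LINT x:{a..b}|lborel. \<Phi> x * w x * m x) + (LINT x:{a..b}|lborel. \<Phi>' x * h x)"
    by (rule set_integral_add(2)[OF j3 j4])
  also have "\<dots> = ((LINT x:{a..b}|lborel. \<Phi> x * w x * m x) - (LINT x:{a..b}|lborel. \<Phi> x * h' x))
      + (h b * \<Phi> b - h a * \<Phi> a)"
    using IBP by simp
  also have "(LINT x:{a..b}|lborel. \<Phi> x * w x * m x) - (LINT x:{a..b}|lborel. \<Phi> x * h' x)
     = (LINT x:{a..b}|lborel. \<Phi> x * w x * m x - \<Phi> x * h' x)"
    by (rule set_integral_diff(2)[OF j3 j5, symmetric])
  also have "(\<lambda>x. \<Phi> x * w x * m x - \<Phi> x * h' x) = (\<lambda>x. \<Phi> x *
      (w x * m x - \<alpha> * pd {a..b} (\<lambda>y. m y * pd {a..b} w y) x + \<alpha> * pd {a..b} m x))"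
    by (auto simp: h'_def p_def[abs_def] w'_def algebra_simps)
  finally show ?thesis
    by (simp add: f_functional_def Let_def h_def p_def w'_def algebra_simps)
qed

section \<open>The pressureless information geometric regularization equation\<close>

text \<open>Second line and boundary condition for \<open>\<Sigma>\<close> at a fixed time:
  \<open>r\<close>, \<open>v\<close>, \<open>S\<close> stand for \<open>\<rho>(\<cdot>,t)\<close>, \<open>u(\<cdot>,t)\<close>, \<open>\<Sigma>(\<cdot>,t)\<close>.\<close>

definition IGR_pressure ::
  "real \<Rightarrow> real \<Rightarrow> real \<Rightarrow> (real \<Rightarrow> real) \<Rightarrow> (real \<Rightarrow> real) \<Rightarrow> (real \<Rightarrow> real) \<Rightarrow> bool" where
  "IGR_pressure a b \<alpha> r v S \<longleftrightarrow>
     Ck_on {a..b} 2 S \<and>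
     (\<forall>x\<in>{a<..<b}. \<exists>v' q.
        (v has_real_derivative v') (at x) \<and>
        ((\<lambda>y. inverse (r y) * pd {a..b} S y) has_real_derivative q) (at x) \<and>
        inverse (r x) * S x - \<alpha> * q = 2 * \<alpha> * v'\<^sup>2) \<and>
     pd {a..b} S a = 0 \<and> pd {a..b} S b = 0"

definition IGR_solution ::
  "real \<Rightarrow> real \<Rightarrow> real \<Rightarrow> (real \<Rightarrow> real) \<Rightarrow> (real \<Rightarrow> real) \<Rightarrow>
   (real \<Rightarrow> real \<Rightarrow> real) \<Rightarrow> (real \<Rightarrow> real \<Rightarrow> real) \<Rightarrow> (real \<Rightarrow> real \<Rightarrow> real) \<Rightarrow> bool" where
  "IGR_solution a b \<alpha> u0 m u \<rho> \<Sigma> \<longleftrightarrow>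
     (\<forall>t\<ge>0. \<forall>x\<in>{a<..<b}.
        (\<exists>p q. ((\<lambda>s. \<rho> s x * u s x) has_real_derivative p) (at t within {0..}) \<and>
               ((\<lambda>y. \<rho> t y * (u t y)\<^sup>2 + \<Sigma> t y) has_real_derivative q) (at x) \<and>
               p + q = 0) \<and>
        (\<exists>p q. ((\<lambda>s. \<rho> s x) has_real_derivative p) (at t within {0..}) \<and>
               ((\<lambda>y. \<rho> t y * u t y) has_real_derivative q) (at x) \<and>
               p + q = 0)) \<and>
     (\<forall>t\<ge>0. IGR_pressure a b \<alpha> (\<rho> t) (u t) (\<Sigma> t)) \<and>
     (\<forall>t\<ge>0. u t a = 0 \<and> u t b = 0) \<and>
     (\<forall>x\<in>{a..b}. u 0 x = u0 x \<and> \<rho> 0 x = m x)"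

end

theory Submission
  imports Defs
begin

text \<open>
  Everything rests on one structural fact: the Euler--Lagrange equation of the variational problem is
  affine in \<open>t\<close>.  With the Lagrangian density \<open>q = m / \<partial>\<^sub>x\<Phi>\<close> it reads
  \<open>\<alpha> \<partial>\<^sub>xq = \<alpha> \<partial>\<^sub>xm - m (\<Phi> - x) + t (m u\<^sub>0 - \<alpha> \<partial>\<^sub>x(m \<partial>\<^sub>xu\<^sub>0))\<close>.  Two time derivatives leave
  \<open>\<alpha> \<partial>\<^sub>x\<partial>\<^sub>t\<^sub>tq = - m \<partial>\<^sub>t\<^sub>t\<Phi>\<close>.  In Eulerian coordinates this is the momentum equation for the pressure
  \<open>\<Sigma> = \<alpha> (\<partial>\<^sub>t\<^sub>tq) \<circ> \<Phi>\<^sup>-\<^sup>1\<close>, while the relation \<open>q \<partial>\<^sub>x\<Phi> = m\<close>, differentiated twice in time, is the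
  elliptic equation for \<open>\<Sigma>\<close>, and differentiated once it is the continuity equation
  (theorem \<open>eulerian\<close>).  It remains to derive the Euler--Lagrange equation and to justify the
  derivatives.

  \<^emph>\<open>Euler--Lagrange equation\<close> (theorem \<open>minimizer_euler_lagrange\<close>).  A minimizer is a mere monotone
  function, but competitors \<open>g \<circ> \<Phi>\<close> with a diffeomorphism \<open>g\<close> of \<open>[a,b]\<close> change the entropy by
  \<open>- \<integral> ln g'(\<Phi>) d\<mu>\<close>, so the first variation exists.  Exchanging integrals in it identifies the
  density \<open>R\<close> of the push-forward as a Lipschitz function of the generalized inverse \<open>T\<close> of \<open>\<Phi>\<close>.
  Since the derivative of \<open>T\<close> is \<open>R / m(T)\<close>, a zero of \<open>R\<close> would by Gronwall make \<open>T\<close> constant.  So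
  \<open>R > 0\<close>, \<open>\<Phi> = T\<^sup>-\<^sup>1\<close> is a diffeomorphism with \<open>q = R \<circ> \<Phi>\<close>, and the equation holds classically.

  \<^emph>\<open>Regularity in time\<close> (lemma \<open>flow_time_derivatives\<close>).  Difference quotients in time of \<open>(\<Phi>, q)\<close>
  solve the linear boundary value problem \<open>D' = \<phi> - \<beta> E\<close>, \<open>E' = \<gamma> - n D\<close>, \<open>D(a) = D(b) = 0\<close> with
  \<open>\<beta> = m / (q\<^sub>s q\<^sub>t)\<close>.  An energy estimate bounds its solutions by the data, uniformly as long as \<open>\<beta>\<close>
  stays between positive constants, which follows from a bound on the oscillation of \<open>ln q\<close>.  Hence
  difference quotients converge uniformly; applied to the limit, the same argument gives the second
  time derivative.

  \<^emph>\<open>Regularity in space\<close> follows from the differential equations by bootstrapping.  The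
  \<open>C\<^sup>n\<close>-valued curves are handled through joint continuity of all space derivatives in time and
  space, which the chain rule carries over to compositions with \<open>\<Phi>\<^sup>-\<^sup>1\<close>; a time derivative of an
  Eulerian quantity costs one space derivative through the transport term.
\<close>

section \<open>Families of functions with jointly continuous space derivatives\<close>

text \<open>Time and space are curried arguments so that \<open>U t\<close> is the function of space at a frozen time.\<close>

definition jcont :: "real \<Rightarrow> real \<Rightarrow> (real \<Rightarrow> real \<Rightarrow> real) \<Rightarrow> bool" where
  "jcont a b U \<longleftrightarrow> continuous_on ({0..} \<times> {a..b}) (\<lambda>z. U (fst z) (snd z))"

text \<open>Joint continuity of all space derivatives up to order \<open>n\<close> is, on a compact interval, the same
  as continuity of \<open>t \<mapsto> U t\<close> for the \<open>C\<^sup>n\<close> norm, and in this form products and compositions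
  inherit it through the Leibniz and chain rules.\<close>

fun Ck_family :: "real \<Rightarrow> real \<Rightarrow> nat \<Rightarrow> (real \<Rightarrow> real \<Rightarrow> real) \<Rightarrow> bool" where
  "Ck_family a b 0 U = jcont a b U"
| "Ck_family a b (Suc n) U =
     (jcont a b U \<and>
      (\<exists>V. (\<forall>t\<ge>0. \<forall>x\<in>{a..b}. (U t has_real_derivative V t x) (at x within {a..b})) \<and>
           Ck_family a b n V))"

lemma jcont_cong:
  assumes "\<And>t x. t \<ge> 0 \<Longrightarrow> x \<in> {a..b} \<Longrightarrow> U t x = V t x"
  shows "jcont a b U \<longleftrightarrow> jcont a b V"
  unfolding jcont_def by (rule continuous_on_cong) (auto simp: assms)

lemma jcont_compose:
  assumes U: "jcont a b U" and T: "jcont a b T"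
    and r: "\<And>t x. t \<ge> 0 \<Longrightarrow> x \<in> {a..b} \<Longrightarrow> T t x \<in> {a..b}"
  shows "jcont a b (\<lambda>t x. U t (T t x))"
proof -
  have "continuous_on ({0..} \<times> {a..b}) (\<lambda>z. (fst z, T (fst z) (snd z)))"
    using T unfolding jcont_def by (intro continuous_intros)
  moreover have "(\<lambda>z. (fst z, T (fst z) (snd z))) ` ({0..} \<times> {a..b}) \<subseteq> {0..} \<times> {a..b}"
    using r by auto
  ultimately show ?thesis
    unfolding jcont_def using continuous_on_compose2[OF U[unfolded jcont_def]] by fastforce
qed

lemma jcont_slice:
  assumes "jcont a b U" "t \<ge> 0"
  shows "continuous_on {a..b} (U t)"
proof -
  have "continuous_on {a..b} (\<lambda>x. (t, x))" by (intro continuous_intros)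
  from continuous_on_compose2[OF assms(1)[unfolded jcont_def] this] assms(2)
  show ?thesis by auto
qed

lemma jcont_arith:
  assumes "jcont a b U" "jcont a b V"
  shows "jcont a b (\<lambda>t x. U t x + V t x)" "jcont a b (\<lambda>t x. U t x - V t x)"
    "jcont a b (\<lambda>t x. U t x * V t x)"
  using assms unfolding jcont_def by (auto intro!: continuous_intros)

lemma jcont_divide:
  assumes "jcont a b U" "jcont a b V" "\<And>t x. t \<ge> 0 \<Longrightarrow> x \<in> {a..b} \<Longrightarrow> V t x \<noteq> 0"
  shows "jcont a b (\<lambda>t x. U t x / V t x)"
  using assms unfolding jcont_def by (auto intro!: continuous_intros)

lemma jcont_space:
  assumes "continuous_on {a..b} f" shows "jcont a b (\<lambda>t. f)"
proof -
  have "continuous_on ({0::real..} \<times> {a..b}) snd" by (intro continuous_intros)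
  from continuous_on_compose2[OF assms this] show ?thesis unfolding jcont_def by auto
qed

lemma jcont_time: "continuous_on {0..} f \<Longrightarrow> jcont a b (\<lambda>t x. f t)"
  unfolding jcont_def by (rule continuous_on_compose2[of "{0..}" f]) (auto intro!: continuous_intros)

lemma Ck_family_SucI:
  assumes "jcont a b U"
    "\<And>t x. t \<ge> 0 \<Longrightarrow> x \<in> {a..b} \<Longrightarrow> (U t has_real_derivative V t x) (at x within {a..b})"
    "Ck_family a b n V"
  shows "Ck_family a b (Suc n) U"
  unfolding Ck_family.simps
  by (intro conjI exI[of _ V] allI impI ballI assms)

lemma Ck_family_SucE:
  assumes "Ck_family a b (Suc n) U"
  obtains V where "jcont a b U"
    "\<And>t x. t \<ge> 0 \<Longrightarrow> x \<in> {a..b} \<Longrightarrow> (U t has_real_derivative V t x) (at x within {a..b})"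
    "Ck_family a b n V"
proof -
  from assms have "jcont a b U" unfolding Ck_family.simps by (rule conjunct1)
  moreover from assms obtain V where
    "\<forall>t\<ge>0. \<forall>x\<in>{a..b}. (U t has_real_derivative V t x) (at x within {a..b})"
    "Ck_family a b n V" unfolding Ck_family.simps by (elim conjE exE)
  ultimately show ?thesis by (intro that[of V]) auto
qed

declare Ck_family.simps(2) [simp del]

lemma Ck_family_jcont: "Ck_family a b n U \<Longrightarrow> jcont a b U"
  by (cases n) (auto elim: Ck_family_SucE)

lemma DERIV_cong_within_Icc:
  fixes f g :: "real \<Rightarrow> real"
  assumes "\<And>x. x \<in> S \<Longrightarrow> f x = g x" "x \<in> S" "(f has_real_derivative D) (at x within S)"
  shows "(g has_real_derivative D) (at x within S)"
  using assms has_field_derivative_transform_within[of f D x S 1 g] by auto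

lemma Ck_family_cong:
  assumes "\<And>t x. t \<ge> 0 \<Longrightarrow> x \<in> {a..b} \<Longrightarrow> U t x = V t x" "Ck_family a b n U"
  shows "Ck_family a b n V"
proof (cases n)
  case 0
  then show ?thesis using assms jcont_cong[of a b U V] by auto
next
  case (Suc n')
  from assms(2) obtain W where
    W: "\<And>t x. t \<ge> 0 \<Longrightarrow> x \<in> {a..b} \<Longrightarrow> (U t has_real_derivative W t x) (at x within {a..b})"
      "Ck_family a b n' W" and j: "jcont a b U"
    using Ck_family_SucE[of a b n' U] unfolding Suc by metis
  have "(V t has_real_derivative W t x) (at x within {a..b})" if "t \<ge> 0" "x \<in> {a..b}" for t x
    by (rule DERIV_cong_within_Icc[OF _ that(2) W(1)[OF that]]) (simp add: assms(1) that(1))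
  with W j show ?thesis using jcont_cong[of a b U V, OF assms(1)] by (auto simp: Suc intro!: Ck_family_SucI)
qed

lemma derivative_unique_Icc:
  fixes f :: "real \<Rightarrow> real"
  assumes "a < b" "x \<in> {a..b}" "(f has_real_derivative D) (at x within {a..b})"
    "(f has_real_derivative E) (at x within {a..b})"
  shows "D = E"
  using vector_derivative_unique_within_closed_interval[of a b x f D E] assms
  by (auto simp: has_real_derivative_iff_has_vector_derivative)

lemma pd_eqI:
  assumes "a < b" "x \<in> {a..b}" "(f has_real_derivative D) (at x within {a..b})"
  shows "pd {a..b} f x = D"
proof (rule derivative_unique_Icc[OF assms(1,2) _ assms(3)])
  have "f differentiable (at x within {a..b})"
    using assms(3) real_differentiable_def by blast
  then show "(f has_real_derivative pd {a..b} f x) (at x within {a..b})"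
    unfolding pd_def
    by (simp add: vector_derivative_works has_real_derivative_iff_has_vector_derivative)
qed

lemma Ck_family_deriv:
  assumes "a < b" "Ck_family a b (Suc n) U"
    "\<And>t x. t \<ge> 0 \<Longrightarrow> x \<in> {a..b} \<Longrightarrow> (U t has_real_derivative V t x) (at x within {a..b})"
  shows "Ck_family a b n V"
proof -
  from assms(2) obtain W where
    W: "\<And>t x. t \<ge> 0 \<Longrightarrow> x \<in> {a..b} \<Longrightarrow> (U t has_real_derivative W t x) (at x within {a..b})"
      "Ck_family a b n W"
    using Ck_family_SucE by metis
  show ?thesis
    by (rule Ck_family_cong[OF _ W(2)]) (rule derivative_unique_Icc[OF assms(1) _ W(1) assms(3)])
qed

lemma Ck_family_Suc_mono: "Ck_family a b (Suc n) U \<Longrightarrow> Ck_family a b n U"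
proof (induction n arbitrary: U)
  case (Suc n)
  from Suc.prems obtain V where
    V: "\<And>t x. t \<ge> 0 \<Longrightarrow> x \<in> {a..b} \<Longrightarrow> (U t has_real_derivative V t x) (at x within {a..b})"
      "Ck_family a b (Suc n) V" "jcont a b U" using Ck_family_SucE by metis
  show ?case by (rule Ck_family_SucI[OF V(3,1) Suc.IH[OF V(2)]])
qed (auto intro: Ck_family_jcont)

lemma Ck_family_mono: "Ck_family a b n U \<Longrightarrow> k \<le> n \<Longrightarrow> Ck_family a b k U"
proof (induction n)
  case (Suc n)
  then show ?case using Ck_family_Suc_mono by (cases "k = Suc n") (auto simp del: Ck_family.simps)
qed auto

lemma Ck_family_add:
  assumes "Ck_family a b n U" "Ck_family a b n V"
  shows "Ck_family a b n (\<lambda>t x. U t x + V t x)"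
  using assms
proof (induction n arbitrary: U V)
  case (Suc n)
  from Suc.prems(1) obtain U' where
    U: "\<And>t x. t \<ge> 0 \<Longrightarrow> x \<in> {a..b} \<Longrightarrow> (U t has_real_derivative U' t x) (at x within {a..b})"
      "Ck_family a b n U'" "jcont a b U" using Ck_family_SucE by metis
  from Suc.prems(2) obtain V' where
    V: "\<And>t x. t \<ge> 0 \<Longrightarrow> x \<in> {a..b} \<Longrightarrow> (V t has_real_derivative V' t x) (at x within {a..b})"
      "Ck_family a b n V'" "jcont a b V" using Ck_family_SucE by metis
  show ?case
    by (rule Ck_family_SucI[OF jcont_arith(1)[OF U(3) V(3)] DERIV_add[OF U(1) V(1)]
          Suc.IH[OF U(2) V(2)]])
qed (simp add: jcont_arith)

lemma Ck_family_mult: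
  assumes "Ck_family a b n U" "Ck_family a b n V"
  shows "Ck_family a b n (\<lambda>t x. U t x * V t x)"
  using assms
proof (induction n arbitrary: U V)
  case (Suc n)
  note g = Suc.prems[THEN Ck_family_Suc_mono]
  from Suc.prems(1) obtain U' where
    U: "\<And>t x. t \<ge> 0 \<Longrightarrow> x \<in> {a..b} \<Longrightarrow> (U t has_real_derivative U' t x) (at x within {a..b})"
      "Ck_family a b n U'" "jcont a b U" using Ck_family_SucE by metis
  from Suc.prems(2) obtain V' where
    V: "\<And>t x. t \<ge> 0 \<Longrightarrow> x \<in> {a..b} \<Longrightarrow> (V t has_real_derivative V' t x) (at x within {a..b})"
      "Ck_family a b n V'" "jcont a b V" using Ck_family_SucE by metis
  show ?case
    by (rule Ck_family_SucI[OF jcont_arith(3)[OF U(3) V(3)] DERIV_mult[OF U(1) V(1)]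
          Ck_family_add[OF Suc.IH[OF U(2) g(2)] Suc.IH[OF V(2) g(1)]]])
qed (simp add: jcont_arith)

lemma Ck_family_time: "continuous_on {0..} f \<Longrightarrow> Ck_family a b n (\<lambda>t x. f t)"
proof (induction n arbitrary: f)
  case (Suc n)
  show ?case
    by (rule Ck_family_SucI[OF jcont_time[OF Suc.prems] _ Suc.IH[of "\<lambda>_. 0"]]) auto
qed (simp add: jcont_time)

lemma Ck_family_const: "Ck_family a b n (\<lambda>t x. c)"
  by (rule Ck_family_time) simp

lemma Ck_family_diff:
  assumes "Ck_family a b n U" "Ck_family a b n V"
  shows "Ck_family a b n (\<lambda>t x. U t x - V t x)"
  using Ck_family_add[OF assms(1) Ck_family_mult[OF Ck_family_const[of a b n "-1"] assms(2)]]
  by simp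

lemma Ck_family_inverse:
  assumes "Ck_family a b n U" "\<And>t x. t \<ge> 0 \<Longrightarrow> x \<in> {a..b} \<Longrightarrow> U t x \<noteq> 0"
  shows "Ck_family a b n (\<lambda>t x. inverse (U t x))"
  using assms
proof (induction n arbitrary: U)
  case 0
  then show ?case using jcont_divide[OF jcont_time[of "\<lambda>_. 1"] _ 0(2)] by (simp add: inverse_eq_divide)
next
  case (Suc n)
  obtain V where
    V: "\<And>t x. t \<ge> 0 \<Longrightarrow> x \<in> {a..b} \<Longrightarrow> (U t has_real_derivative V t x) (at x within {a..b})"
      "Ck_family a b n V" "jcont a b U" using Suc.prems(1) Ck_family_SucE by metis
  have i: "Ck_family a b n (\<lambda>t x. inverse (U t x))"
    by (rule Suc.IH[OF Ck_family_Suc_mono[OF Suc.prems(1)] Suc.prems(2)])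
  have j: "jcont a b (\<lambda>t x. inverse (U t x))"
    using Ck_family_jcont[OF i] .
  have d: "((\<lambda>x. inverse (U t x)) has_real_derivative
      (-1) * (V t x * (inverse (U t x) * inverse (U t x)))) (at x within {a..b})"
    if "t \<ge> 0" "x \<in> {a..b}" for t x
    using DERIV_inverse_fun[OF V(1)[OF that] Suc.prems(2)[OF that]]
    by (simp add: field_simps)
  show ?case
    by (rule Ck_family_SucI[OF j d
          Ck_family_mult[OF Ck_family_const Ck_family_mult[OF V(2) Ck_family_mult[OF i i]]]])
qed

lemma Ck_family_divide:
  assumes "Ck_family a b n U" "Ck_family a b n V"
    "\<And>t x. t \<ge> 0 \<Longrightarrow> x \<in> {a..b} \<Longrightarrow> V t x \<noteq> 0"
  shows "Ck_family a b n (\<lambda>t x. U t x / V t x)"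
  using Ck_family_mult[OF assms(1) Ck_family_inverse[OF assms(2,3)]] by (simp add: divide_inverse)

lemma DERIV_chain_Icc:
  fixes f g :: "real \<Rightarrow> real"
  assumes "(f has_real_derivative D) (at (g x) within {a..b})"
    "(g has_real_derivative E) (at x within {a..b})" "\<And>y. y \<in> {a..b} \<Longrightarrow> g y \<in> {a..b}"
  shows "((\<lambda>x. f (g x)) has_real_derivative D * E) (at x within {a..b})"
proof -
  have "(f has_real_derivative D) (at (g x) within g ` {a..b})"
    using assms(3) by (intro DERIV_subset[OF assms(1)]) auto
  from DERIV_image_chain[OF this assms(2)] show ?thesis by (simp add: o_def)
qed

lemma Ck_family_compose:
  assumes "Ck_family a b n U" "Ck_family a b n T"
    and r: "\<And>t x. t \<ge> 0 \<Longrightarrow> x \<in> {a..b} \<Longrightarrow> T t x \<in> {a..b}"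
  shows "Ck_family a b n (\<lambda>t x. U t (T t x))"
  using assms(1,2)
proof (induction n arbitrary: U)
  case 0
  then show ?case by (auto intro: jcont_compose r)
next
  case (Suc n)
  obtain V where
    V: "\<And>t x. t \<ge> 0 \<Longrightarrow> x \<in> {a..b} \<Longrightarrow> (U t has_real_derivative V t x) (at x within {a..b})"
      "Ck_family a b n V" "jcont a b U" using Suc.prems(1) Ck_family_SucE by metis
  obtain T' where
    T': "\<And>t x. t \<ge> 0 \<Longrightarrow> x \<in> {a..b} \<Longrightarrow> (T t has_real_derivative T' t x) (at x within {a..b})"
      "Ck_family a b n T'" "jcont a b T" using Suc.prems(2) Ck_family_SucE by metis
  have d: "((\<lambda>x. U t (T t x)) has_real_derivative V t (T t x) * T' t x) (at x within {a..b})"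
    if "t \<ge> 0" "x \<in> {a..b}" for t x
    by (rule DERIV_chain_Icc[OF V(1)[OF that(1) r[OF that]] T'(1)[OF that] r[OF that(1)]])
  show ?case
    by (rule Ck_family_SucI[OF jcont_compose[OF V(3) T'(3) r] d
          Ck_family_mult[OF Suc.IH[OF V(2) Ck_family_Suc_mono[OF Suc.prems(2)]] T'(2)]])
qed

lemma Ck_on_Suc_iff:
  "Ck_on S (Suc n) f \<longleftrightarrow> f differentiable_on S \<and> Ck_on S n (pd S f)"
proof -
  have "(\<forall>j<Suc n. (pd S ^^ j) f differentiable_on S) \<longleftrightarrow>
      f differentiable_on S \<and> (\<forall>j<n. (pd S ^^ j) (pd S f) differentiable_on S)"
    by (auto simp: less_Suc_eq_0_disj funpow_Suc_right simp del: funpow.simps)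
  then show ?thesis by (auto simp: Ck_on_def funpow_Suc_right simp del: funpow.simps(2))
qed

lemma Ck_on_imp_family:
  assumes "a < b" "Ck_on {a..b} n f"
  shows "Ck_family a b n (\<lambda>t. f)"
  using assms(2)
proof (induction n arbitrary: f)
  case 0
  then show ?case by (simp add: Ck_on_def jcont_space)
next
  case (Suc n)
  then have f: "f differentiable_on {a..b}" "Ck_on {a..b} n (pd {a..b} f)"
    by (auto simp: Ck_on_Suc_iff)
  show ?case
    by (rule Ck_family_SucI[OF jcont_space[OF differentiable_imp_continuous_on[OF f(1)]]
        has_field_derivative_pd[OF assms(1) f(1)] Suc.IH[OF f(2)]])
qed

section \<open>Curves in spaces of continuously differentiable functions\<close>

lemma pd_cong:
  assumes "\<And>x. x \<in> S \<Longrightarrow> f x = g x" "x \<in> S"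
  shows "pd S f x = pd S g x"
proof -
  have "(f has_vector_derivative d) (at x within S) \<longleftrightarrow> (g has_vector_derivative d) (at x within S)"
    for d
    using assms
    by (intro iffI) (erule has_vector_derivative_transform[rotated 2]; simp)+
  then show ?thesis unfolding pd_def vector_derivative_def by simp
qed

lemma funpow_pd_cong:
  assumes "\<And>x. x \<in> S \<Longrightarrow> f x = g x" "x \<in> S"
  shows "(pd S ^^ j) f x = (pd S ^^ j) g x"
  using assms(2)
proof (induction j arbitrary: x)
  case (Suc j)
  then show ?case using pd_cong[of S "(pd S ^^ j) f" "(pd S ^^ j) g"] by auto
qed (use assms in auto)

lemma Ck_family_funpow_pd:
  assumes "a < b" "Ck_family a b n U" "j \<le> n"
  shows "\<exists>V. Ck_family a b (n - j) V \<and> (\<forall>t\<ge>0. \<forall>x\<in>{a..b}. (pd {a..b} ^^ j) (U t) x = V t x)"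
  using assms(3)
proof (induction j)
  case 0
  then show ?case using assms by auto
next
  case (Suc j)
  then obtain V where V: "Ck_family a b (Suc (n - Suc j)) V"
    "\<And>t x. t \<ge> 0 \<Longrightarrow> x \<in> {a..b} \<Longrightarrow> (pd {a..b} ^^ j) (U t) x = V t x"
    by (metis Suc_leD Suc_diff_Suc Suc_le_eq)
  then obtain W where W: "Ck_family a b (n - Suc j) W"
    "\<And>t x. t \<ge> 0 \<Longrightarrow> x \<in> {a..b} \<Longrightarrow> (V t has_real_derivative W t x) (at x within {a..b})"
    using Ck_family_SucE by metis
  have "(pd {a..b} ^^ Suc j) (U t) x = W t x" if "t \<ge> 0" "x \<in> {a..b}" for t x
    using pd_cong[of "{a..b}" "(pd {a..b} ^^ j) (U t)" "V t" x] V(2) that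
      pd_eqI[OF assms(1) that(2) W(2)[OF that]] by auto
  then show ?case using W(1) by blast
qed

lemma Ck_family_imp_Ck_on:
  assumes "a < b" "Ck_family a b n U" "t \<ge> 0"
  shows "Ck_on {a..b} n (U t)"
proof -
  have "(pd {a..b} ^^ j) (U t) differentiable_on {a..b}" if j: "j < n" for j
  proof -
    obtain V where V: "Ck_family a b (Suc (n - Suc j)) V"
      "\<And>t x. t \<ge> 0 \<Longrightarrow> x \<in> {a..b} \<Longrightarrow> (pd {a..b} ^^ j) (U t) x = V t x"
      using Ck_family_funpow_pd[OF assms(1,2), of j] j by (metis Suc_diff_Suc less_imp_le)
    then obtain W where W:
      "\<And>t x. t \<ge> 0 \<Longrightarrow> x \<in> {a..b} \<Longrightarrow> (V t has_real_derivative W t x) (at x within {a..b})"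
      using Ck_family_SucE by metis
    have "V t differentiable_on {a..b}"
      using W[OF assms(3)] unfolding differentiable_on_def real_differentiable_def by blast
    then show ?thesis
      using V(2)[OF assms(3)] by (auto simp: differentiable_on_def intro: differentiable_transform_within[where d=1])
  qed
  moreover have "continuous_on {a..b} ((pd {a..b} ^^ n) (U t))"
  proof -
    obtain V where V: "Ck_family a b 0 V"
      "\<And>t x. t \<ge> 0 \<Longrightarrow> x \<in> {a..b} \<Longrightarrow> (pd {a..b} ^^ n) (U t) x = V t x"
      using Ck_family_funpow_pd[OF assms(1,2), of n] by auto
    then have "continuous_on {a..b} (V t)" using jcont_slice assms(3) by auto
    then show ?thesis by (rule continuous_on_eq) (simp add: V assms)
  qed
  ultimately show ?thesis by (auto simp: Ck_on_def)
qed

text \<open>The tube lemma, from uniform continuity on a compact time interval around \<open>t\<close>.\<close>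

lemma jcont_uniform_limit:
  assumes V: "jcont a b V" and t: "t \<ge> 0"
  shows "uniform_limit {a..b} V (V t) (at t within {0..})"
proof (rule uniform_limitI)
  fix e :: real assume e: "e > 0"
  have "compact ({max 0 (t - 1)..t+1} \<times> {a..b})" by (intro compact_Times) auto
  moreover have "continuous_on ({max 0 (t - 1)..t+1} \<times> {a..b}) (\<lambda>z. V (fst z) (snd z))"
    by (rule continuous_on_subset[OF V[unfolded jcont_def]]) auto
  ultimately have "uniformly_continuous_on ({max 0 (t - 1)..t+1} \<times> {a..b}) (\<lambda>z. V (fst z) (snd z))"
    by (rule compact_uniformly_continuous[rotated])
  then obtain d where d: "d > 0" and D: "\<forall>z \<in> {max 0 (t - 1)..t+1} \<times> {a..b}.
     \<forall>z' \<in> {max 0 (t - 1)..t+1} \<times> {a..b}. dist z' z < d \<longrightarrow>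
     dist (V (fst z') (snd z')) (V (fst z) (snd z)) < e"
    using e unfolding uniformly_continuous_on_def by blast
  have "\<forall>\<^sub>F s in at t within {0..}. s \<ge> 0 \<and> dist s t < min d 1"
    unfolding eventually_at using d by (intro exI[of _ "min d 1"]) auto
  then show "\<forall>\<^sub>F s in at t within {0..}. \<forall>x\<in>{a..b}. dist (V s x) (V t x) < e"
  proof eventually_elim
    case (elim s)
    then have s: "s \<in> {max 0 (t - 1)..t+1}" "t \<in> {max 0 (t - 1)..t+1}"
      using t by (auto simp: dist_real_def abs_real_def split: if_splits)
    show ?case
    proof
      fix x assume x: "x \<in> {a..b}"
      have "dist (s, x) (t, x) < d" using elim by (simp add: dist_Pair_Pair)
      then have "dist (V (fst (s, x)) (snd (s, x))) (V (fst (t, x)) (snd (t, x))) < e"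
        using D s x by blast
      then show "dist (V s x) (V t x) < e" by simp
    qed
  qed
qed

lemma eventually_nonneg: "\<forall>\<^sub>F s in at t within {0..}. 0 \<le> s" for t :: real
  unfolding eventually_at by (intro exI[of _ 1]) simp

lemma funpow_pd_zero:
  assumes "a < b" "x \<in> {a..b}"
  shows "(pd {a..b} ^^ j) (\<lambda>_. 0) x = 0"
  using assms(2)
proof (induction j arbitrary: x)
  case (Suc j)
  have "pd {a..b} ((pd {a..b} ^^ j) (\<lambda>_. 0)) x = pd {a..b} (\<lambda>_. 0) x"
    by (rule pd_cong[OF Suc.IH Suc.prems])
  also have "\<dots> = 0" by (rule pd_eqI[OF assms(1) Suc.prems]) simp
  finally show ?case by simp
qed simp

text \<open>Applied to differences \<open>U s - U t\<close> and to difference quotients minus their limit, frozen to \<open>0\<close>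
  at \<open>s = t\<close>: convergence in the \<open>C\<^sup>n\<close> norm then is continuity at \<open>t\<close>.\<close>

lemma Ck_norm_tendsto_0:
  assumes ab: "a < b" and W: "Ck_family a b n W" and t: "t \<ge> 0"
    and 0: "\<And>x. x \<in> {a..b} \<Longrightarrow> W t x = 0"
  shows "((\<lambda>s. Ck_norm {a..b} n (W s)) \<longlongrightarrow> 0) (at t within {0..})"
proof -
  have "((\<lambda>s. SUP x\<in>{a..b}. \<bar>(pd {a..b} ^^ j) (W s) x\<bar>) \<longlongrightarrow> 0) (at t within {0..})"
    if j: "j \<le> n" for j
  proof -
    obtain V where V: "Ck_family a b (n - j) V"
      "\<And>t x. t \<ge> 0 \<Longrightarrow> x \<in> {a..b} \<Longrightarrow> (pd {a..b} ^^ j) (W t) x = V t x"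
      using Ck_family_funpow_pd[OF ab W j] by auto
    have V0: "V t x = 0" if "x \<in> {a..b}" for x
    proof -
      have "V t x = (pd {a..b} ^^ j) (W t) x" using V(2)[OF t that] by simp
      also have "\<dots> = (pd {a..b} ^^ j) (\<lambda>_. 0) x" by (rule funpow_pd_cong[OF 0 that])
      finally show ?thesis using funpow_pd_zero[OF ab that] by simp
    qed
    have u: "uniform_limit {a..b} V (V t) (at t within {0..})"
      by (rule jcont_uniform_limit[OF Ck_family_jcont[OF V(1)] t])
    show ?thesis
    proof (rule tendstoI)
      fix e :: real assume e: "e > 0"
      have "\<forall>\<^sub>F s in at t within {0..}. \<forall>x\<in>{a..b}. dist (V s x) (V t x) < e / 2"
        by (rule uniform_limitD[OF u]) (use e in simp)
      moreover have "\<forall>\<^sub>F s in at t within {0..}. s \<ge> 0"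
        by (rule eventually_nonneg)
      ultimately show "\<forall>\<^sub>F s in at t within {0..}.
          dist (SUP x\<in>{a..b}. \<bar>(pd {a..b} ^^ j) (W s) x\<bar>) 0 < e"
      proof eventually_elim
        case (elim s)
        have le: "\<bar>(pd {a..b} ^^ j) (W s) x\<bar> \<le> e / 2" if "x \<in> {a..b}" for x
        proof -
          have "dist (V s x) (V t x) < e / 2" using elim that by blast
          then show ?thesis using V0[OF that] V(2)[OF elim(2) that] by (simp add: dist_real_def)
        qed
        have "(SUP x\<in>{a..b}. \<bar>(pd {a..b} ^^ j) (W s) x\<bar>) \<le> e / 2"
          using ab by (intro cSUP_least le) simp_all
        moreover have "\<bar>(pd {a..b} ^^ j) (W s) a\<bar> \<le> (SUP x\<in>{a..b}. \<bar>(pd {a..b} ^^ j) (W s) x\<bar>)"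
          using ab by (intro cSUP_upper bdd_aboveI2[of _ _ "e / 2"] le) simp_all
        ultimately show ?case using e by (simp add: dist_real_def)
      qed
    qed
  qed
  then have "((\<lambda>s. Ck_norm {a..b} n (W s)) \<longlongrightarrow> (\<Sum>j\<le>n. 0)) (at t within {0..})"
    unfolding Ck_norm_def by (intro tendsto_sum) simp
  then show ?thesis by simp
qed

lemma Ck_family_freeze:
  assumes "a < b" "Ck_family a b n U" "t \<ge> 0"
  shows "Ck_family a b n (\<lambda>s. U t)"
  by (rule Ck_on_imp_family[OF assms(1) Ck_family_imp_Ck_on[OF assms]])

lemma Ck_family_imp_C0_curve:
  assumes "a < b" "Ck_family a b n U"
  shows "C0_curve {a..b} n U"
  unfolding C0_curve_def
proof (intro conjI allI impI)
  fix t :: real assume t: "t \<ge> 0"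
  show "Ck_on {a..b} n (U t)" by (rule Ck_family_imp_Ck_on[OF assms t])
  show "((\<lambda>s. Ck_norm {a..b} n (\<lambda>x. U s x - U t x)) \<longlongrightarrow> 0) (at t within {0..})"
    by (rule Ck_norm_tendsto_0[OF assms(1) Ck_family_diff[OF assms(2) Ck_family_freeze[OF assms t]] t])
      simp
qed

lemma segment_nonneg:
  fixes s t \<theta> :: real
  assumes "s \<ge> 0" "t \<ge> 0" "\<theta> \<in> {0..1}"
  shows "t + \<theta> * (s - t) \<ge> 0"
proof -
  have "0 \<le> (1 - \<theta>) * t" "0 \<le> \<theta> * s" using assms by auto
  moreover have "t + \<theta> * (s - t) = (1 - \<theta>) * t + \<theta> * s" by (simp add: algebra_simps)
  ultimately show ?thesis by linarith
qed

lemma jcont_segment: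
  assumes "jcont a b V" "t \<ge> 0"
  shows "continuous_on (({0..} \<times> {a..b}) \<times> cbox 0 1)
           (\<lambda>(z, \<theta>). V (t + \<theta> * (fst z - t)) (snd z))"
proof -
  have "continuous_on (({0..} \<times> {a..b}) \<times> cbox 0 1)
      (\<lambda>z. (t + snd z * (fst (fst z) - t), snd (fst z)))"
    by (intro continuous_intros)
  moreover have "(\<lambda>z. (t + snd z * (fst (fst z) - t), snd (fst z))) ` (({0..} \<times> {a..b}) \<times> cbox 0 1)
      \<subseteq> {0..} \<times> {a..b}"
    using segment_nonneg[OF _ assms(2)] by auto
  ultimately have "continuous_on (({0..} \<times> {a..b}) \<times> cbox 0 1)
      (\<lambda>z. V (fst (t + snd z * (fst (fst z) - t), snd (fst z)))
             (snd (t + snd z * (fst (fst z) - t), snd (fst z))))"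
    by (rule continuous_on_compose2[OF assms(1)[unfolded jcont_def]])
  then show ?thesis by (simp add: case_prod_unfold)
qed

lemma jcont_mean:
  assumes "jcont a b V" "t \<ge> 0"
  shows "jcont a b (\<lambda>s x. integral {0..1} (\<lambda>\<theta>. V (t + \<theta> * (s - t)) x))"
  using integral_continuous_on_param[OF jcont_segment[OF assms]]
  unfolding jcont_def cbox_interval .

text \<open>The difference quotient of \<open>U\<close> at \<open>t\<close> is the mean of the time derivative over the segment
  from \<open>t\<close> to \<open>s\<close>.  In this form it has as many space derivatives as the time derivative,
  including at \<open>s = t\<close>, by differentiation under the integral sign.\<close>

lemma Ck_family_mean:
  assumes ab: "a < b" and V: "Ck_family a b n V" and t: "t \<ge> 0"
  shows "Ck_family a b n (\<lambda>s x. integral {0..1} (\<lambda>\<theta>. V (t + \<theta> * (s - t)) x))"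
  using V
proof (induction n arbitrary: V)
  case 0
  then show ?case using jcont_mean t by simp
next
  case (Suc n)
  obtain W where
    W: "\<And>t x. t \<ge> 0 \<Longrightarrow> x \<in> {a..b} \<Longrightarrow> (V t has_real_derivative W t x) (at x within {a..b})"
      "Ck_family a b n W" "jcont a b V" using Suc.prems Ck_family_SucE by metis
  have d: "((\<lambda>x. integral {0..1} (\<lambda>\<theta>. V (t + \<theta> * (s - t)) x)) has_real_derivative
     integral {0..1} (\<lambda>\<theta>. W (t + \<theta> * (s - t)) x)) (at x within {a..b})"
    if s: "s \<ge> 0" and x: "x \<in> {a..b}" for s x
  proof -
    have c: "continuous_on ({a..b} \<times> cbox 0 1) (\<lambda>(x, \<theta>). U (t + \<theta> * (s - t)) x)"
      if "jcont a b U" for U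
    proof -
      have "continuous_on ({a..b} \<times> cbox (0::real) 1) (\<lambda>z. ((s, fst z), snd z))"
        by (intro continuous_intros)
      moreover have "(\<lambda>z. ((s, fst z), snd z)) ` ({a..b} \<times> cbox (0::real) 1)
          \<subseteq> ({0..} \<times> {a..b}) \<times> cbox 0 1"
        using s by auto
      ultimately show ?thesis
        using continuous_on_compose2[OF jcont_segment[OF that t], of "{a..b} \<times> cbox 0 1"
            "\<lambda>z. ((s, fst z), snd z)"]
        by (simp add: case_prod_unfold)
    qed
    have i: "(\<lambda>\<theta>. V (t + \<theta> * (s - t)) x) integrable_on cbox 0 1" if x: "x \<in> {a..b}" for x
    proof (rule integrable_continuous)
      have "continuous_on (cbox 0 1) (\<lambda>\<theta>::real. (x, \<theta>))" by (intro continuous_intros)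
      moreover have "(\<lambda>\<theta>::real. (x, \<theta>)) ` cbox 0 1 \<subseteq> {a..b} \<times> cbox 0 1" using x by auto
      ultimately show "continuous_on (cbox 0 1) (\<lambda>\<theta>. V (t + \<theta> * (s - t)) x)"
        using continuous_on_compose2[OF c[OF W(3)], of "cbox 0 1" "\<lambda>\<theta>. (x, \<theta>)"] by simp
    qed
    have e: "(V (t + \<theta> * (s - t)) has_real_derivative W (t + \<theta> * (s - t)) y) (at y within {a..b})"
      if "y \<in> {a..b}" "\<theta> \<in> cbox 0 1" for y \<theta>
      by (rule W(1)[OF segment_nonneg[OF s t] that(1)]) (use that in simp)
    show ?thesis
      using leibniz_rule_field_derivative[OF e i c[OF Ck_family_jcont[OF W(2)]] x
          convex_closed_interval[of a b, unfolded cbox_interval]]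
      by simp
  qed
  show ?case
    by (rule Ck_family_SucI[OF jcont_mean[OF W(3) t] d Suc.IH[OF W(2)]])
qed

lemma Ck_family_imp_C1_curve:
  assumes ab: "a < b" and U: "Ck_family a b n U" and V: "Ck_family a b n V"
    and d: "\<And>t x. t \<ge> 0 \<Longrightarrow> x \<in> {a..b} \<Longrightarrow>
              ((\<lambda>s. U s x) has_real_derivative V t x) (at t within {0..})"
  shows "C1_curve {a..b} n U"
  unfolding C1_curve_def
proof (intro conjI allI impI exI[of _ V])
  fix t :: real assume t: "t \<ge> 0"
  show "Ck_on {a..b} n (U t)" by (rule Ck_family_imp_Ck_on[OF ab U t])
  define W where "W s x = integral {0..1} (\<lambda>\<theta>. V (t + \<theta> * (s - t)) x) - V t x" for s x
  have W: "Ck_family a b n W"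
    unfolding W_def[abs_def]
    by (rule Ck_family_diff[OF Ck_family_mean[OF ab V t] Ck_family_freeze[OF ab V t]])
  have Wt: "W t x = 0" for x by (simp add: W_def)
  have eq: "(U s x - U t x) / (s - t) - V t x = W s x" if s: "s \<ge> 0" "s \<noteq> t" and x: "x \<in> {a..b}"
    for s x
  proof -
    note conv = segment_nonneg[OF s(1) t]
    have "((\<lambda>\<theta>. U (t + \<theta> * (s - t)) x) has_vector_derivative (s - t) * V (t + \<theta> * (s - t)) x)
        (at \<theta> within {0..1})" if "\<theta> \<in> {0..1}" for \<theta>
    proof -
      have "((\<lambda>s. U s x) has_real_derivative V (t + \<theta> * (s - t)) x)
         (at (t + \<theta> * (s - t)) within (\<lambda>\<theta>. t + \<theta> * (s - t)) ` {0..1})"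
        by (rule DERIV_subset[OF d]) (use conv that x in auto)
      moreover have "((\<lambda>\<theta>. t + \<theta> * (s - t)) has_real_derivative (s - t)) (at \<theta> within {0..1})"
        by (auto intro!: derivative_eq_intros)
      ultimately have "((\<lambda>s. U s x) \<circ> (\<lambda>\<theta>. t + \<theta> * (s - t)) has_real_derivative
          V (t + \<theta> * (s - t)) x * (s - t)) (at \<theta> within {0..1})"
        by (rule DERIV_image_chain)
      then show ?thesis
        by (simp add: has_real_derivative_iff_has_vector_derivative o_def mult.commute)
    qed
    from fundamental_theorem_of_calculus[OF _ this]
    have "((\<lambda>\<theta>. (s - t) * V (t + \<theta> * (s - t)) x) has_integral U s x - U t x) {0..1}" by simp
    from integral_unique[OF this, symmetric]
    have "U s x - U t x = (s - t) * integral {0..1} (\<lambda>\<theta>. V (t + \<theta> * (s - t)) x)"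
      by (simp only: Henstock_Kurzweil_Integration.integral_mult_right)
    then show ?thesis using s by (simp add: W_def)
  qed
  have "\<forall>\<^sub>F s in at t within {0..}. s \<ge> 0 \<and> s \<noteq> t"
    unfolding eventually_at by (intro exI[of _ 1]) simp
  then have "\<forall>\<^sub>F s in at t within {0..}. Ck_norm {a..b} n (W s) =
     Ck_norm {a..b} n (\<lambda>x. (U s x - U t x) / (s - t) - V t x)"
  proof eventually_elim
    case (elim s)
    show ?case unfolding Ck_norm_def
    proof (intro sum.cong refl SUP_cong arg_cong[of _ _ abs])
      fix j x assume "x \<in> {a..b}"
      then show "(pd {a..b} ^^ j) (W s) x = (pd {a..b} ^^ j) (\<lambda>x. (U s x - U t x) / (s - t) - V t x) x"
        by (intro funpow_pd_cong) (use eq elim in auto)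
    qed
  qed
  then show "((\<lambda>s. Ck_norm {a..b} n (\<lambda>x. (U s x - U t x) / (s - t) - V t x)) \<longlongrightarrow> 0) (at t within {0..})"
    using Ck_norm_tendsto_0[OF ab W t Wt] by (rule Lim_transform_eventually[rotated])
qed (rule Ck_family_imp_C0_curve[OF ab V])

section \<open>A linear two-point boundary value problem\<close>

lemma MVT_Icc:
  fixes f :: "real \<Rightarrow> real"
  assumes d: "\<And>z. z \<in> {a..b} \<Longrightarrow> (f has_real_derivative f' z) (at z within {a..b})"
    and x: "x \<in> {a..b}" and y: "y \<in> {a..b}"
  obtains z where "z \<in> closed_segment x y" "z \<in> {a..b}" "f y - f x = f' z * (y - x)"
proof -
  have "\<exists>z\<in>closed_segment x y. f y - f x = f' z * (y - x)"
  proof (cases "x = y")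
    case False
    have *: "\<exists>z\<in>{x<..<y}. f y - f x = f' z * (y - x)" if "x < y" "x \<in> {a..b}" "y \<in> {a..b}" for x y
    proof -
      have "(f has_derivative (\<lambda>h. f' z * h)) (at z within {x..y})" if "x \<le> z" "z \<le> y" for z
        using DERIV_subset[OF d[of z], of "{x..y}"] that \<open>x \<in> _\<close> \<open>y \<in> _\<close>
        by (auto simp: has_field_derivative_def)
      from mvt_simple[OF \<open>x < y\<close> this] show ?thesis by auto
    qed
    consider "x < y" | "y < x" using False by linarith
    then show ?thesis
    proof cases
      case 1
      then show ?thesis using *[OF 1 x y] by (auto simp: closed_segment_eq_real_ivl)
    next
      case 2
      obtain z where z: "z \<in> {y<..<x}" "f x - f y = f' z * (x - y)" using *[OF 2 y x] by auto
      from z(2) have "f y - f x = f' z * (y - x)" by (simp add: algebra_simps)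
      then show ?thesis using z(1) 2 by (intro bexI[of _ z]) (auto simp: closed_segment_eq_real_ivl)
    qed
  qed auto
  moreover have "closed_segment x y \<subseteq> {a..b}" using x y by (auto simp: closed_segment_eq_real_ivl)
  ultimately show ?thesis using that by blast
qed

lemma increment_bound:
  fixes f :: "real \<Rightarrow> real"
  assumes d: "\<And>z. z \<in> {a..b} \<Longrightarrow> (f has_real_derivative f' z) (at z within {a..b})"
    and \<psi>: "continuous_on {a..b} \<psi>" "\<And>z. z \<in> {a..b} \<Longrightarrow> \<bar>f' z\<bar> \<le> \<psi> z"
    and x: "x \<in> {a..b}" and y: "y \<in> {a..b}"
  shows "\<bar>f y - f x\<bar> \<le> integral {a..b} \<psi>"
proof -
  have pos: "0 \<le> \<psi> z" if "z \<in> {a..b}" for z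
    using \<psi>(2)[OF that] by linarith
  have *: "\<bar>f y - f x\<bar> \<le> integral {a..b} \<psi>" if "x \<le> y" "x \<in> {a..b}" "y \<in> {a..b}" for x y
  proof -
    have sub: "{x..y} \<subseteq> {a..b}" using that by auto
    have i: "(f' has_integral f y - f x) {x..y}"
      using sub by (intro fundamental_theorem_of_calculus[OF that(1)])
        (auto simp: has_real_derivative_iff_has_vector_derivative[symmetric] intro: DERIV_subset[OF d])
    have p: "\<psi> integrable_on {x..y}"
      by (rule integrable_continuous_interval[OF continuous_on_subset[OF \<psi>(1) sub]])
    have "norm (integral {x..y} f') \<le> integral {x..y} \<psi>"
      using sub \<psi>(2) by (intro integral_norm_bound_integral has_integral_integrable[OF i] p) auto
    also have "\<dots> \<le> integral {a..b} \<psi>"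
      by (rule integral_subset_le[OF sub p integrable_continuous_interval[OF \<psi>(1)]])
        (simp add: pos)
    finally show ?thesis using integral_unique[OF i] by simp
  qed
  show ?thesis
    using *[OF _ x y] *[OF _ y x] by (cases "x \<le> y") (auto simp: abs_minus_commute)
qed

text \<open>This problem arises in two ways.  Differentiating the Euler--Lagrange equation in time gives it for
  the velocity \<open>D\<close> and for the time derivative \<open>E\<close> of \<open>m / \<Phi>'\<close>, and it is also the elliptic equation
  for the pressure, written as a first order system.  Positivity of \<open>\<beta>\<close> and \<open>n\<close> makes it coercive.\<close>

definition bvp ::
  "real \<Rightarrow> real \<Rightarrow> (real \<Rightarrow> real) \<Rightarrow> (real \<Rightarrow> real) \<Rightarrow> (real \<Rightarrow> real) \<Rightarrow> (real \<Rightarrow> real) \<Rightarrow>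
   (real \<Rightarrow> real) \<Rightarrow> (real \<Rightarrow> real) \<Rightarrow> bool" where
  "bvp a b \<beta> n \<phi> \<gamma> D E \<longleftrightarrow>
     (\<forall>x\<in>{a..b}. (D has_real_derivative \<phi> x - \<beta> x * E x) (at x within {a..b}) \<and>
                 (E has_real_derivative \<gamma> x - n x * D x) (at x within {a..b})) \<and>
     D a = 0 \<and> D b = 0"

lemma bvpD:
  assumes "bvp a b \<beta> n \<phi> \<gamma> D E"
  shows "x \<in> {a..b} \<Longrightarrow> (D has_real_derivative \<phi> x - \<beta> x * E x) (at x within {a..b})"
    "x \<in> {a..b} \<Longrightarrow> (E has_real_derivative \<gamma> x - n x * D x) (at x within {a..b})"
    "D a = 0" "D b = 0"
  using assms by (auto simp: bvp_def)

lemma bvp_continuous: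
  assumes "bvp a b \<beta> n \<phi> \<gamma> D E"
  shows "continuous_on {a..b} D" "continuous_on {a..b} E"
  by (rule DERIV_continuous_on, erule bvpD[OF assms])+

text \<open>Turns an a priori bound into continuous dependence on all data: a change of the coefficient
  \<open>\<beta>\<close> acts as the additional forcing \<open>- (\<beta>1 - \<beta>2) E2\<close>.\<close>

lemma bvp_diff:
  assumes "bvp a b \<beta>1 n \<phi>1 \<gamma>1 D1 E1" "bvp a b \<beta>2 n \<phi>2 \<gamma>2 D2 E2"
  shows "bvp a b \<beta>1 n (\<lambda>x. \<phi>1 x - \<phi>2 x - (\<beta>1 x - \<beta>2 x) * E2 x) (\<lambda>x. \<gamma>1 x - \<gamma>2 x)
           (\<lambda>x. D1 x - D2 x) (\<lambda>x. E1 x - E2 x)"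
  unfolding bvp_def
proof (intro conjI ballI)
  fix x assume x: "x \<in> {a..b}"
  show "((\<lambda>x. D1 x - D2 x) has_real_derivative
      \<phi>1 x - \<phi>2 x - (\<beta>1 x - \<beta>2 x) * E2 x - \<beta>1 x * (E1 x - E2 x)) (at x within {a..b})"
    by (rule DERIV_cong[OF DERIV_diff[OF bvpD(1)[OF assms(1) x] bvpD(1)[OF assms(2) x]]])
      (simp add: algebra_simps)
  show "((\<lambda>x. E1 x - E2 x) has_real_derivative \<gamma>1 x - \<gamma>2 x - n x * (D1 x - D2 x)) (at x within {a..b})"
    by (rule DERIV_cong[OF DERIV_diff[OF bvpD(2)[OF assms(1) x] bvpD(2)[OF assms(2) x]]])
      (simp add: algebra_simps)
qed (use bvpD(3,4)[OF assms(1)] bvpD(3,4)[OF assms(2)] in auto)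

text \<open>The energy identity \<open>(D E)' + \<beta> E\<^sup>2 + n D\<^sup>2 = \<phi> E + \<gamma> D\<close> and the boundary conditions bound the
  \<open>L\<^sup>2\<close> norms; the equations then bound the increments of \<open>D\<close> and \<open>E\<close>.  The value of \<open>E\<close> is
  controlled at a point where \<open>D' = 0\<close>, which exists by Rolle's theorem.\<close>

lemma bvp_bound_positive:
  assumes ab: "a < b" and \<beta>0: "0 < \<beta>0" "\<beta>0 \<le> \<beta>1" and n0: "0 < n0" "n0 \<le> n1"
    and bvp: "bvp a b \<beta> n \<phi> \<gamma> D E" and \<delta>: "0 < \<delta>"
    and \<beta>: "\<And>x. x \<in> {a..b} \<Longrightarrow> \<beta>0 \<le> \<beta> x \<and> \<beta> x \<le> \<beta>1"
    and n: "\<And>x. x \<in> {a..b} \<Longrightarrow> n0 \<le> n x \<and> n x \<le> n1"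
    and \<phi>: "\<And>x. x \<in> {a..b} \<Longrightarrow> \<bar>\<phi> x\<bar> \<le> \<delta>"
    and \<gamma>: "\<And>x. x \<in> {a..b} \<Longrightarrow> \<bar>\<gamma> x\<bar> \<le> \<delta>"
    and x: "x \<in> {a..b}"
  shows "\<bar>D x\<bar> \<le> ((b - a) * (1 + \<beta>1 / 2) + \<beta>1 / \<beta>0 * ((b - a) * (1 / (2 * \<beta>0) + 1 / (2 * n0)))) * \<delta>"
    and "\<bar>E x\<bar> \<le> (1 / \<beta>0 + (b - a) * (1 + n1 / 2)
              + n1 / n0 * ((b - a) * (1 / (2 * \<beta>0) + 1 / (2 * n0)))) * \<delta>"
proof -
  note D = bvpD(1)[OF bvp] and E = bvpD(2)[OF bvp] and bc = bvpD(3,4)[OF bvp]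
  note c = bvp_continuous[OF bvp]
  define \<kappa> where "\<kappa> = 1 / (2 * \<beta>0) + 1 / (2 * n0)"
  define e where "e x = (\<beta>0 * (E x)\<^sup>2 + n0 * (D x)\<^sup>2) / 2" for x
  have ce: "continuous_on {a..b} e" unfolding e_def[abs_def] by (auto intro!: continuous_intros c)
  have ie: "e integrable_on {a..b}" by (rule integrable_continuous_interval[OF ce])
  have young: "\<delta> * \<bar>y\<bar> \<le> r * y\<^sup>2 / 2 + \<delta>\<^sup>2 / (2 * r)" if "r > 0" for r y
  proof -
    have "0 \<le> (r * \<bar>y\<bar> - \<delta>)\<^sup>2 / (2 * r)" using that by simp
    also have "\<dots> = (r\<^sup>2 * y\<^sup>2 - 2 * (r * \<bar>y\<bar>) * \<delta> + \<delta>\<^sup>2) / (2 * r)"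
      by (simp add: power2_diff power_mult_distrib)
    also have "\<dots> = r * y\<^sup>2 / 2 + \<delta>\<^sup>2 / (2 * r) - \<delta> * \<bar>y\<bar>"
      using that by (simp add: field_simps power2_eq_square)
    finally show ?thesis by simp
  qed
  have prod: "u * y \<le> \<delta> * \<bar>y\<bar>" if "\<bar>u\<bar> \<le> \<delta>" for u y
  proof -
    have "u * y \<le> \<bar>u\<bar> * \<bar>y\<bar>" by (metis abs_ge_self abs_mult)
    also have "\<dots> \<le> \<delta> * \<bar>y\<bar>" using that by (intro mult_right_mono) auto
    finally show ?thesis .
  qed
  have "((\<lambda>x. (\<phi> x - \<beta> x * E x) * E x + (\<gamma> x - n x * D x) * D x) has_integral
          D b * E b - D a * E a) {a..b}"
    using ab by (intro fundamental_theorem_of_calculus)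
      (auto simp: has_real_derivative_iff_has_vector_derivative[symmetric] intro!: DERIV_mult D E)
  then have i1: "((\<lambda>x. (\<phi> x - \<beta> x * E x) * E x + (\<gamma> x - n x * D x) * D x) has_integral 0) {a..b}"
    using bc by simp
  have i2: "((\<lambda>x. \<delta>\<^sup>2 * \<kappa> - e x) has_integral (b - a) * (\<delta>\<^sup>2 * \<kappa>) - integral {a..b} e) {a..b}"
    using has_integral_diff[OF has_integral_const_real[of "\<delta>\<^sup>2 * \<kappa>" a b] integrable_integral[OF ie]] ab
    by simp
  have "0 \<le> (b - a) * (\<delta>\<^sup>2 * \<kappa>) - integral {a..b} e"
  proof (rule has_integral_le[OF i1 i2])
    fix x assume x: "x \<in> {a..b}"
    have "\<phi> x * E x \<le> \<beta>0 * (E x)\<^sup>2 / 2 + \<delta>\<^sup>2 / (2 * \<beta>0)"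
      using prod[OF \<phi>[OF x]] young[OF \<beta>0(1)] order_trans by blast
    moreover have "\<gamma> x * D x \<le> n0 * (D x)\<^sup>2 / 2 + \<delta>\<^sup>2 / (2 * n0)"
      using prod[OF \<gamma>[OF x]] young[OF n0(1)] order_trans by blast
    moreover have "\<beta>0 * (E x)\<^sup>2 \<le> \<beta> x * (E x)\<^sup>2" using \<beta>[OF x] by (intro mult_right_mono) auto
    moreover have "n0 * (D x)\<^sup>2 \<le> n x * (D x)\<^sup>2" using n[OF x] by (intro mult_right_mono) auto
    ultimately have "\<phi> x * E x + \<gamma> x * D x - \<beta> x * (E x)\<^sup>2 - n x * (D x)\<^sup>2
       \<le> \<delta>\<^sup>2 / (2 * \<beta>0) + \<delta>\<^sup>2 / (2 * n0) - e x"
      unfolding e_def by (simp add: field_simps)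
    also have "\<dots> = \<delta>\<^sup>2 * \<kappa> - e x" by (simp add: \<kappa>_def algebra_simps)
    finally show "(\<phi> x - \<beta> x * E x) * E x + (\<gamma> x - n x * D x) * D x \<le> \<delta>\<^sup>2 * \<kappa> - e x"
      by (simp add: algebra_simps power2_eq_square)
  qed
  then have J: "integral {a..b} e \<le> (b - a) * (\<delta>\<^sup>2 * \<kappa>)" by simp
  have half: "\<bar>y\<bar> \<le> \<delta> / 2 + y\<^sup>2 / (2 * \<delta>)" for y
  proof -
    have "\<delta> * \<bar>y\<bar> \<le> y\<^sup>2 / 2 + \<delta>\<^sup>2 / 2" using young[of 1 y] by simp
    then have "\<bar>y\<bar> \<le> (y\<^sup>2 / 2 + \<delta>\<^sup>2 / 2) / \<delta>" using \<delta> by (simp add: pos_le_divide_eq mult.commute)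
    also have "\<dots> = \<delta> / 2 + y\<^sup>2 / (2 * \<delta>)" using \<delta> by (simp add: field_simps power2_eq_square)
    finally show ?thesis .
  qed
  have incr: "\<bar>f y - f x\<bar> \<le> ((b - a) * (1 + c / 2) + c / r * ((b - a) * \<kappa>)) * \<delta>"
    if f: "\<And>z. z \<in> {a..b} \<Longrightarrow> (f has_real_derivative f' z) (at z within {a..b})"
      and f': "\<And>z. z \<in> {a..b} \<Longrightarrow> \<bar>f' z\<bar> \<le> \<delta> + c * \<bar>Y z\<bar>"
      and Y: "\<And>z. z \<in> {a..b} \<Longrightarrow> r * (Y z)\<^sup>2 / 2 \<le> e z"
      and r: "r > 0" "c \<ge> 0" and x: "x \<in> {a..b}" and y: "y \<in> {a..b}" for f f' Y c r x y
  proof -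
    have "\<bar>f y - f x\<bar> \<le> integral {a..b} (\<lambda>z. \<delta> * (1 + c / 2) + c / (r * \<delta>) * e z)"
    proof (rule increment_bound[OF f])
      fix z assume z: "z \<in> {a..b}"
      have "(Y z)\<^sup>2 / (2 * \<delta>) \<le> e z / (r * \<delta>)" using Y[OF z] r \<delta> by (simp add: field_simps)
      then have "\<bar>Y z\<bar> \<le> \<delta> / 2 + e z / (r * \<delta>)" using half[of "Y z"] by simp
      then have "c * \<bar>Y z\<bar> \<le> c * (\<delta> / 2 + e z / (r * \<delta>))" using r by (intro mult_left_mono)
      then show "\<bar>f' z\<bar> \<le> \<delta> * (1 + c / 2) + c / (r * \<delta>) * e z"
        using f'[OF z] by (simp add: algebra_simps)
    qed (use r \<delta> x y in \<open>auto intro!: continuous_intros ce\<close>)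
    also have "\<dots> = (b - a) * (\<delta> * (1 + c / 2)) + c / (r * \<delta>) * integral {a..b} e"
      using has_integral_add[OF has_integral_const_real[of "\<delta> * (1 + c / 2)" a b]
          has_integral_mult_right[OF integrable_integral[OF ie], of "c / (r * \<delta>)"]] ab
      by (intro integral_unique) simp
    also have "\<dots> \<le> (b - a) * (\<delta> * (1 + c / 2)) + c / (r * \<delta>) * ((b - a) * (\<delta>\<^sup>2 * \<kappa>))"
      using J r \<delta> by (intro add_left_mono mult_left_mono) auto
    also have "\<dots> = ((b - a) * (1 + c / 2) + c / r * ((b - a) * \<kappa>)) * \<delta>"
      using \<delta> r by (simp add: field_simps power2_eq_square)
    finally show ?thesis .
  qed
  have a: "a \<in> {a..b}" using ab by simp
  have eD: "n0 * (D z)\<^sup>2 / 2 \<le> e z" and eE: "\<beta>0 * (E z)\<^sup>2 / 2 \<le> e z" for z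
    using \<beta>0 n0 by (auto simp: e_def)
  have bD: "\<bar>\<phi> z - \<beta> z * E z\<bar> \<le> \<delta> + \<beta>1 * \<bar>E z\<bar>" if z: "z \<in> {a..b}" for z
  proof -
    have "\<bar>\<beta> z * E z\<bar> \<le> \<beta>1 * \<bar>E z\<bar>"
      using \<beta>[OF z] \<beta>0 by (auto simp: abs_mult intro!: mult_right_mono)
    then show ?thesis using \<phi>[OF z] by linarith
  qed
  have bE: "\<bar>\<gamma> z - n z * D z\<bar> \<le> \<delta> + n1 * \<bar>D z\<bar>" if z: "z \<in> {a..b}" for z
  proof -
    have "\<bar>n z * D z\<bar> \<le> n1 * \<bar>D z\<bar>"
      using n[OF z] n0 by (auto simp: abs_mult intro!: mult_right_mono)
    then show ?thesis using \<gamma>[OF z] by linarith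
  qed
  have "\<bar>D x - D a\<bar> \<le> ((b - a) * (1 + \<beta>1 / 2) + \<beta>1 / \<beta>0 * ((b - a) * \<kappa>)) * \<delta>"
    by (rule incr[OF D bD eE]) (use \<beta>0 a x in auto)
  then show "\<bar>D x\<bar> \<le> ((b - a) * (1 + \<beta>1 / 2)
      + \<beta>1 / \<beta>0 * ((b - a) * (1 / (2 * \<beta>0) + 1 / (2 * n0)))) * \<delta>"
    using bc by (simp add: \<kappa>_def)
  have Dat: "(D has_real_derivative \<phi> z - \<beta> z * E z) (at z)" if "a < z" "z < b" for z
    using D[of z] that by (simp add: at_within_Icc_at)
  obtain z where z: "a < z" "z < b" "(D has_real_derivative 0) (at z)"
    using Rolle[OF ab, of D] bc c(1) Dat real_differentiable_def by metis
  from DERIV_unique[OF Dat[OF z(1,2)] z(3)] have "\<beta> z * E z = \<phi> z" by simp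
  have zi: "z \<in> {a..b}" using z by simp
  have "\<beta>0 * \<bar>E z\<bar> \<le> \<beta> z * \<bar>E z\<bar>" using \<beta>[OF zi] by (intro mult_right_mono) auto
  also have "\<dots> = \<bar>\<phi> z\<bar>" using \<open>\<beta> z * E z = \<phi> z\<close> \<beta>[OF zi] \<beta>0 by (simp add: abs_mult flip: \<open>\<beta> z * E z = \<phi> z\<close>)
  also have "\<dots> \<le> \<delta>" by (rule \<phi>[OF zi])
  finally have Ez: "\<bar>E z\<bar> \<le> 1 / \<beta>0 * \<delta>" using \<beta>0 by (simp add: field_simps)
  have "\<bar>E x - E z\<bar> \<le> ((b - a) * (1 + n1 / 2) + n1 / n0 * ((b - a) * \<kappa>)) * \<delta>"
    by (rule incr[OF E bE eD]) (use n0 zi x in auto)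
  then have "\<bar>E x\<bar> \<le> 1 / \<beta>0 * \<delta> + ((b - a) * (1 + n1 / 2) + n1 / n0 * ((b - a) * \<kappa>)) * \<delta>"
    using Ez by linarith
  then show "\<bar>E x\<bar> \<le> (1 / \<beta>0 + (b - a) * (1 + n1 / 2)
              + n1 / n0 * ((b - a) * (1 / (2 * \<beta>0) + 1 / (2 * n0)))) * \<delta>"
    by (simp add: \<kappa>_def algebra_simps)
qed

text \<open>Letting \<open>\<delta>'\<close> decrease to \<open>\<delta>\<close> includes the case \<open>\<delta> = 0\<close>, that is uniqueness.\<close>

lemma bvp_bound:
  assumes ab: "a < b" and \<beta>0: "0 < \<beta>0" "\<beta>0 \<le> \<beta>1" and n0: "0 < n0" "n0 \<le> n1"
  obtains C where "C > 0"
    "\<And>\<beta> n \<phi> \<gamma> D E \<delta> x. bvp a b \<beta> n \<phi> \<gamma> D E \<Longrightarrow>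
       (\<And>x. x \<in> {a..b} \<Longrightarrow> \<beta>0 \<le> \<beta> x \<and> \<beta> x \<le> \<beta>1) \<Longrightarrow>
       (\<And>x. x \<in> {a..b} \<Longrightarrow> n0 \<le> n x \<and> n x \<le> n1) \<Longrightarrow>
       (\<And>x. x \<in> {a..b} \<Longrightarrow> \<bar>\<phi> x\<bar> \<le> \<delta>) \<Longrightarrow> (\<And>x. x \<in> {a..b} \<Longrightarrow> \<bar>\<gamma> x\<bar> \<le> \<delta>) \<Longrightarrow>
       x \<in> {a..b} \<Longrightarrow> \<bar>D x\<bar> \<le> C * \<delta> \<and> \<bar>E x\<bar> \<le> C * \<delta>"
proof -
  define C1 where "C1 = (b - a) * (1 + \<beta>1 / 2) + \<beta>1 / \<beta>0 * ((b - a) * (1 / (2 * \<beta>0) + 1 / (2 * n0)))"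
  define C2 where "C2 = 1 / \<beta>0 + (b - a) * (1 + n1 / 2)
      + n1 / n0 * ((b - a) * (1 / (2 * \<beta>0) + 1 / (2 * n0)))"
  have "0 \<le> \<beta>1 / \<beta>0 * ((b - a) * (1 / (2 * \<beta>0) + 1 / (2 * n0)))"
    "0 \<le> n1 / n0 * ((b - a) * (1 / (2 * \<beta>0) + 1 / (2 * n0)))"
    "0 < (b - a) * (1 + \<beta>1 / 2)" "0 < (b - a) * (1 + n1 / 2)" "0 < 1 / \<beta>0"
    using assms by simp_all
  then have pos: "C1 > 0" "C2 > 0" unfolding C1_def C2_def by linarith+
  show ?thesis
  proof (rule that[of "C1 + C2"])
    fix \<beta> n \<phi> \<gamma> D E \<delta> x
    assume h: "bvp a b \<beta> n \<phi> \<gamma> D E"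
       "\<And>x. x \<in> {a..b} \<Longrightarrow> \<beta>0 \<le> \<beta> x \<and> \<beta> x \<le> \<beta>1"
       "\<And>x. x \<in> {a..b} \<Longrightarrow> n0 \<le> n x \<and> n x \<le> n1"
       "\<And>x. x \<in> {a..b} \<Longrightarrow> \<bar>\<phi> x\<bar> \<le> \<delta>" "\<And>x. x \<in> {a..b} \<Longrightarrow> \<bar>\<gamma> x\<bar> \<le> \<delta>"
       "x \<in> {a..b}"
    have \<delta>: "0 \<le> \<delta>" using h(4)[OF h(6)] by linarith
    have "\<bar>D x\<bar> \<le> (C1 + C2) * d \<and> \<bar>E x\<bar> \<le> (C1 + C2) * d" if d: "d > \<delta>" for d
    proof -
      have d0: "0 < d" using d \<delta> by simp
      have bd: "\<bar>\<phi> x\<bar> \<le> d" "\<bar>\<gamma> x\<bar> \<le> d" if "x \<in> {a..b}" for x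
        using h(4)[OF that] h(5)[OF that] d by auto
      have "\<bar>D x\<bar> \<le> C1 * d"
        unfolding C1_def by (rule bvp_bound_positive(1)[OF ab \<beta>0 n0 h(1) d0 h(2,3) bd h(6)])
      moreover have "\<bar>E x\<bar> \<le> C2 * d"
        unfolding C2_def by (rule bvp_bound_positive(2)[OF ab \<beta>0 n0 h(1) d0 h(2,3) bd h(6)])
      moreover have "C1 * d \<le> (C1 + C2) * d" "C2 * d \<le> (C1 + C2) * d"
        using pos d0 by (auto intro!: mult_right_mono)
      ultimately show ?thesis by linarith
    qed
    then have *: "\<forall>\<^sub>F d in at_right \<delta>. \<bar>D x\<bar> \<le> (C1 + C2) * d \<and> \<bar>E x\<bar> \<le> (C1 + C2) * d"
      by (auto simp: eventually_at_right_less eventually_at_filter)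
    have t: "((\<lambda>d. (C1 + C2) * d) \<longlongrightarrow> (C1 + C2) * \<delta>) (at_right \<delta>)"
      by (intro tendsto_intros)
    show "\<bar>D x\<bar> \<le> (C1 + C2) * \<delta> \<and> \<bar>E x\<bar> \<le> (C1 + C2) * \<delta>"
      by (intro conjI tendsto_lowerbound[OF t] eventually_mono[OF *]) auto
  qed (use pos in simp)
qed

lemma bvp_unique:
  assumes ab: "a < b" and b: "bvp a b \<beta> n (\<lambda>_. 0) (\<lambda>_. 0) D E" and x: "x \<in> {a..b}"
    and c: "continuous_on {a..b} \<beta>" "continuous_on {a..b} n"
    and pos: "\<And>x. x \<in> {a..b} \<Longrightarrow> \<beta> x > 0" "\<And>x. x \<in> {a..b} \<Longrightarrow> n x > 0"
  shows "D x = 0" "E x = 0"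
proof -
  have ne: "{a..b} \<noteq> {}" using ab by auto
  obtain x1 x2 where m: "x1 \<in> {a..b}" "\<And>y. y \<in> {a..b} \<Longrightarrow> \<beta> x1 \<le> \<beta> y"
      "x2 \<in> {a..b}" "\<And>y. y \<in> {a..b} \<Longrightarrow> n x2 \<le> n y"
    using continuous_attains_inf[OF compact_Icc ne c(1)] continuous_attains_inf[OF compact_Icc ne c(2)]
    by metis
  obtain x3 x4 where M: "x3 \<in> {a..b}" "\<And>y. y \<in> {a..b} \<Longrightarrow> \<beta> y \<le> \<beta> x3"
      "x4 \<in> {a..b}" "\<And>y. y \<in> {a..b} \<Longrightarrow> n y \<le> n x4"
    using continuous_attains_sup[OF compact_Icc ne c(1)] continuous_attains_sup[OF compact_Icc ne c(2)]
    by metis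
  obtain C where "C > 0" and C: "\<And>\<beta>' n' \<phi> \<gamma> D E \<delta> x. bvp a b \<beta>' n' \<phi> \<gamma> D E \<Longrightarrow>
       (\<And>x. x \<in> {a..b} \<Longrightarrow> \<beta> x1 \<le> \<beta>' x \<and> \<beta>' x \<le> \<beta> x3) \<Longrightarrow>
       (\<And>x. x \<in> {a..b} \<Longrightarrow> n x2 \<le> n' x \<and> n' x \<le> n x4) \<Longrightarrow>
       (\<And>x. x \<in> {a..b} \<Longrightarrow> \<bar>\<phi> x\<bar> \<le> \<delta>) \<Longrightarrow> (\<And>x. x \<in> {a..b} \<Longrightarrow> \<bar>\<gamma> x\<bar> \<le> \<delta>) \<Longrightarrow>
       x \<in> {a..b} \<Longrightarrow> \<bar>D x\<bar> \<le> C * \<delta> \<and> \<bar>E x\<bar> \<le> C * \<delta>"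
    using bvp_bound[OF ab pos(1)[OF m(1)] m(2)[OF M(1)] pos(2)[OF m(3)] m(4)[OF M(3)]] by blast
  have "\<bar>D x\<bar> \<le> C * 0 \<and> \<bar>E x\<bar> \<le> C * 0"
    by (rule C[OF b _ _ _ _ x]) (use m M in auto)
  then show "D x = 0" "E x = 0" by auto
qed

section \<open>Limits of solutions of the boundary value problem\<close>

lemma continuous_on_Icc_bounded:
  fixes f :: "real \<Rightarrow> real"
  assumes "continuous_on {a..b} f"
  obtains M where "M > 0" "\<And>x. x \<in> {a..b} \<Longrightarrow> \<bar>f x\<bar> \<le> M"
proof -
  have "bounded (f ` {a..b})" by (rule compact_imp_bounded[OF compact_continuous_image[OF assms compact_Icc]])
  then show ?thesis using that by (auto simp: bounded_pos)
qed

lemma continuous_on_Icc_pos_bounds: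
  fixes f :: "real \<Rightarrow> real"
  assumes "a < b" and c: "continuous_on {a..b} f" and "\<And>x. x \<in> {a..b} \<Longrightarrow> f x > 0"
  obtains l u where "0 < l" "l \<le> u" "\<And>x. x \<in> {a..b} \<Longrightarrow> l \<le> f x \<and> f x \<le> u"
proof -
  have ne: "{a..b} \<noteq> {}" using assms by auto
  obtain y where y: "y \<in> {a..b}" "\<forall>x\<in>{a..b}. f y \<le> f x"
    using continuous_attains_inf[OF compact_Icc ne c] by blast
  obtain z where z: "z \<in> {a..b}" "\<forall>x\<in>{a..b}. f x \<le> f z"
    using continuous_attains_sup[OF compact_Icc ne c] by blast
  show ?thesis by (rule that[of "f y" "f z"]) (use assms y z in auto)
qed

lemma uniform_limit_mult_Icc:
  fixes f g :: "'c \<Rightarrow> real \<Rightarrow> real"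
  assumes "uniform_limit {a..b} f l F" "uniform_limit {a..b} g k F"
    "continuous_on {a..b} l" "continuous_on {a..b} k"
  shows "uniform_limit {a..b} (\<lambda>s x. f s x * g s x) (\<lambda>x. l x * k x) F"
  using assms by (intro uniform_lim_mult compact_imp_bounded compact_continuous_image) auto

lemma uniform_limit_inverse_Icc:
  fixes f :: "'c \<Rightarrow> real \<Rightarrow> real"
  assumes "a < b" "uniform_limit {a..b} f l F" "continuous_on {a..b} l" "\<And>x. x \<in> {a..b} \<Longrightarrow> l x > 0"
  shows "uniform_limit {a..b} (\<lambda>s x. inverse (f s x)) (\<lambda>x. inverse (l x)) F"
proof -
  obtain c u where c: "0 < c" "\<And>x. x \<in> {a..b} \<Longrightarrow> c \<le> l x \<and> l x \<le> u"
    using continuous_on_Icc_pos_bounds[OF assms(1,3,4)] by metis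
  have "c \<le> norm (l x)" if "x \<in> {a..b}" for x using c(2)[OF that] by (simp add: abs_if)
  from uniform_lim_inverse[OF assms(2) this c(1)] show ?thesis by (simp add: o_def)
qed

lemma uniform_limit_DERIV:
  fixes f f' :: "nat \<Rightarrow> real \<Rightarrow> real"
  assumes d: "\<And>k x. x \<in> {a..b} \<Longrightarrow> (f k has_real_derivative f' k x) (at x within {a..b})"
    and f': "uniform_limit {a..b} f' g sequentially"
    and f: "\<And>x. x \<in> {a..b} \<Longrightarrow> (\<lambda>k. f k x) \<longlonglongrightarrow> l x" and x: "x \<in> {a..b}"
  shows "(l has_real_derivative g x) (at x within {a..b})"
proof -
  have "\<exists>h. \<forall>x\<in>{a..b}. (\<lambda>k. f k x) \<longlonglongrightarrow> h x \<and> (h has_derivative (\<lambda>y. g x * y)) (at x within {a..b})"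
  proof (rule has_derivative_sequence[where ?x0.0 = x and l = "l x" and f' = "\<lambda>k x y. f' k x * y"])
    show "(f k has_derivative (\<lambda>y. f' k x * y)) (at x within {a..b})" if "x \<in> {a..b}" for k x
      using d[OF that] by (simp add: has_field_derivative_def)
    fix e :: real assume e: "e > 0"
    from uniform_limitD[OF f' e]
    show "\<forall>\<^sub>F k in sequentially. \<forall>x\<in>{a..b}. \<forall>y. norm (f' k x * y - g x * y) \<le> e * norm y"
    proof eventually_elim
      case (elim k)
      show ?case
      proof (intro ballI allI)
        fix x y assume "x \<in> {a..b}"
        then have "\<bar>f' k x - g x\<bar> * \<bar>y\<bar> \<le> e * \<bar>y\<bar>"
          using elim by (intro mult_right_mono) (auto simp: dist_real_def intro: less_imp_le)
        then show "norm (f' k x * y - g x * y) \<le> e * norm y"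
          by (simp add: abs_mult left_diff_distrib flip: abs_mult)
      qed
    qed
  qed (use x f in auto)
  then obtain h where h: "\<forall>x\<in>{a..b}. (\<lambda>k. f k x) \<longlonglongrightarrow> h x \<and> (h has_derivative (\<lambda>y. g x * y)) (at x within {a..b})"
    by blast
  have "h y = l y" if "y \<in> {a..b}" for y using h f[OF that] that LIMSEQ_unique by blast
  moreover have "(h has_real_derivative g x) (at x within {a..b})"
    using h x by (simp add: has_field_derivative_def)
  ultimately show ?thesis by (rule DERIV_cong_within_Icc[OF _ x])
qed

text \<open>A bound on the coefficients keeps the constant in the a priori bound fixed.  The limit
  solution depends on the perturbed coefficient \<open>\<beta>\<close> only through \<open>(\<beta>' - \<beta>) E\<close>.\<close>

lemma bvp_stable:
  assumes ab: "a < b" and \<beta>0: "0 < \<beta>0" "\<beta>0 \<le> \<beta>1" and n0: "0 < n0" "n0 \<le> n1"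
    and n: "\<And>x. x \<in> {a..b} \<Longrightarrow> n0 \<le> n x \<and> n x \<le> n1"
    and ev: "\<forall>\<^sub>F s in F. bvp a b (\<beta>s s) n (\<phi>s s) (\<gamma>s s) (Ds s) (Es s) \<and>
               (\<forall>x\<in>{a..b}. \<beta>0 \<le> \<beta>s s x \<and> \<beta>s s x \<le> \<beta>1)"
    and lim: "uniform_limit {a..b} \<beta>s \<beta> F" "uniform_limit {a..b} \<phi>s \<phi> F" "uniform_limit {a..b} \<gamma>s \<gamma> F"
    and bvp: "bvp a b \<beta> n \<phi> \<gamma> D E"
  shows "uniform_limit {a..b} Ds D F" "uniform_limit {a..b} Es E F"
proof -
  obtain C where "C > 0" and C: "\<And>\<beta> n \<phi> \<gamma> D E \<delta> x. bvp a b \<beta> n \<phi> \<gamma> D E \<Longrightarrow>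
       (\<And>x. x \<in> {a..b} \<Longrightarrow> \<beta>0 \<le> \<beta> x \<and> \<beta> x \<le> \<beta>1) \<Longrightarrow>
       (\<And>x. x \<in> {a..b} \<Longrightarrow> n0 \<le> n x \<and> n x \<le> n1) \<Longrightarrow>
       (\<And>x. x \<in> {a..b} \<Longrightarrow> \<bar>\<phi> x\<bar> \<le> \<delta>) \<Longrightarrow> (\<And>x. x \<in> {a..b} \<Longrightarrow> \<bar>\<gamma> x\<bar> \<le> \<delta>) \<Longrightarrow>
       x \<in> {a..b} \<Longrightarrow> \<bar>D x\<bar> \<le> C * \<delta> \<and> \<bar>E x\<bar> \<le> C * \<delta>"
    by (rule bvp_bound[OF ab \<beta>0 n0]) blast
  obtain M where M: "M > 0" "\<And>x. x \<in> {a..b} \<Longrightarrow> \<bar>E x\<bar> \<le> M"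
    using continuous_on_Icc_bounded[OF bvp_continuous(2)[OF bvp]] by metis
  have "\<forall>\<^sub>F s in F. \<forall>x\<in>{a..b}. dist (Ds s x) (D x) < e \<and> dist (Es s x) (E x) < e" if e: "e > 0" for e
  proof -
    define d where "d = e / (2 * (C * (1 + M)))"
    have d: "d > 0" using e M \<open>C > 0\<close> by (simp add: d_def)
    have Cd: "C * (d + d * M) < e"
    proof -
      have "C * (d + d * M) = (C * (1 + M)) * d" by (simp add: algebra_simps)
      also have "\<dots> = e / 2" using M \<open>C > 0\<close> by (simp add: d_def)
      finally show ?thesis using e by simp
    qed
    from ev uniform_limitD[OF lim(1) d] uniform_limitD[OF lim(2) d] uniform_limitD[OF lim(3) d]
    show ?thesis
    proof eventually_elim
      case (elim s)
      have \<phi>: "\<bar>\<phi>s s x - \<phi> x - (\<beta>s s x - \<beta> x) * E x\<bar> \<le> d + d * M" if x: "x \<in> {a..b}" for x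
      proof -
        have "\<bar>(\<beta>s s x - \<beta> x) * E x\<bar> \<le> d * M"
          unfolding abs_mult using elim x M d
          by (intro mult_mono) (auto simp: dist_real_def intro: less_imp_le)
        moreover have "\<bar>\<phi>s s x - \<phi> x\<bar> \<le> d" using elim x by (auto simp: dist_real_def intro: less_imp_le)
        ultimately show ?thesis by linarith
      qed
      have \<gamma>: "\<bar>\<gamma>s s x - \<gamma> x\<bar> \<le> d + d * M" if x: "x \<in> {a..b}" for x
      proof -
        have "\<bar>\<gamma>s s x - \<gamma> x\<bar> \<le> d" using elim x by (auto simp: dist_real_def intro: less_imp_le)
        moreover have "0 \<le> d * M" using d M by simp
        ultimately show ?thesis by linarith
      qed
      have "\<bar>Ds s x - D x\<bar> \<le> C * (d + d * M) \<and> \<bar>Es s x - E x\<bar> \<le> C * (d + d * M)"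
        if x: "x \<in> {a..b}" for x
        by (rule C[OF bvp_diff[OF conjunct1[OF elim(1)] bvp] _ n \<phi> \<gamma> x]) (use elim in auto)
      then show ?case using Cd by (fastforce simp: dist_real_def)
    qed
  qed
  note ev' = this
  show "uniform_limit {a..b} Ds D F"
    by (rule uniform_limitI, rule eventually_mono[OF ev']) auto
  show "uniform_limit {a..b} Es E F"
    by (rule uniform_limitI, rule eventually_mono[OF ev']) auto
qed

text \<open>Solutions of approximating problems form a uniform Cauchy sequence by the a priori bound, and
  the equations then make their derivatives converge uniformly as well.\<close>

lemma bvp_limit_exists:
  assumes ab: "a < b" and \<beta>0: "0 < \<beta>0" "\<beta>0 \<le> \<beta>1" and n0: "0 < n0" "n0 \<le> n1"
    and n: "\<And>x. x \<in> {a..b} \<Longrightarrow> n0 \<le> n x \<and> n x \<le> n1"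
    and bvp: "\<And>k :: nat. bvp a b (\<beta>s k) n (\<phi>s k) (\<gamma>s k) (Ds k) (Es k)"
    and \<beta>s: "\<And>k x. x \<in> {a..b} \<Longrightarrow> \<beta>0 \<le> \<beta>s k x \<and> \<beta>s k x \<le> \<beta>1"
    and bd: "\<And>k x. x \<in> {a..b} \<Longrightarrow> \<bar>\<phi>s k x\<bar> \<le> M \<and> \<bar>\<gamma>s k x\<bar> \<le> M"
    and lim: "uniform_limit {a..b} \<beta>s \<beta> sequentially" "uniform_limit {a..b} \<phi>s \<phi> sequentially"
      "uniform_limit {a..b} \<gamma>s \<gamma> sequentially"
    and c: "continuous_on {a..b} \<beta>" "continuous_on {a..b} n"
  shows "\<exists>D E. bvp a b \<beta> n \<phi> \<gamma> D E"
proof -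
  obtain C where "C > 0" and C: "\<And>\<beta> n \<phi> \<gamma> D E \<delta> x. bvp a b \<beta> n \<phi> \<gamma> D E \<Longrightarrow>
       (\<And>x. x \<in> {a..b} \<Longrightarrow> \<beta>0 \<le> \<beta> x \<and> \<beta> x \<le> \<beta>1) \<Longrightarrow>
       (\<And>x. x \<in> {a..b} \<Longrightarrow> n0 \<le> n x \<and> n x \<le> n1) \<Longrightarrow>
       (\<And>x. x \<in> {a..b} \<Longrightarrow> \<bar>\<phi> x\<bar> \<le> \<delta>) \<Longrightarrow> (\<And>x. x \<in> {a..b} \<Longrightarrow> \<bar>\<gamma> x\<bar> \<le> \<delta>) \<Longrightarrow>
       x \<in> {a..b} \<Longrightarrow> \<bar>D x\<bar> \<le> C * \<delta> \<and> \<bar>E x\<bar> \<le> C * \<delta>"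
    by (rule bvp_bound[OF ab \<beta>0 n0]) blast
  have a: "a \<in> {a..b}" using ab by simp
  have M0: "M \<ge> 0" using bd[OF a, of 0] by linarith
  define N where "N = C * M"
  have N0: "N \<ge> 0" using M0 \<open>C > 0\<close> by (simp add: N_def)
  have E: "\<bar>Es k x\<bar> \<le> N" if x: "x \<in> {a..b}" for k x
    unfolding N_def
    by (rule conjunct2[OF C[OF bvp \<beta>s n _ _ x]]) (use bd in blast)+
  have cau: "uniformly_Cauchy_on {a..b} \<beta>s" "uniformly_Cauchy_on {a..b} \<phi>s" "uniformly_Cauchy_on {a..b} \<gamma>s"
    by (rule uniformly_convergent_Cauchy[OF uniformly_convergentI[OF lim(1)]],
        rule uniformly_convergent_Cauchy[OF uniformly_convergentI[OF lim(2)]],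
        rule uniformly_convergent_Cauchy[OF uniformly_convergentI[OF lim(3)]])
  have main: "\<exists>K. \<forall>x\<in>{a..b}. \<forall>i\<ge>K. \<forall>j\<ge>K. dist (Ds i x) (Ds j x) < e \<and> dist (Es i x) (Es j x) < e"
    if e: "e > 0" for e
  proof -
    define d where "d = e / (2 * (C * (1 + N)))"
    have d: "d > 0" using e N0 \<open>C > 0\<close> by (simp add: d_def)
    have Cd: "C * (d + d * N) < e"
    proof -
      have "C * (d + d * N) = (C * (1 + N)) * d" by (simp add: algebra_simps)
      also have "\<dots> = e / 2" using N0 \<open>C > 0\<close> by (simp add: d_def add_nonneg_eq_0_iff)
      finally show ?thesis using e by simp
    qed
    obtain K1 where K1: "\<forall>x\<in>{a..b}. \<forall>i\<ge>K1. \<forall>j\<ge>K1. dist (\<beta>s i x) (\<beta>s j x) < d"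
      using cau(1) d unfolding uniformly_Cauchy_on_def by blast
    obtain K2 where K2: "\<forall>x\<in>{a..b}. \<forall>i\<ge>K2. \<forall>j\<ge>K2. dist (\<phi>s i x) (\<phi>s j x) < d"
      using cau(2) d unfolding uniformly_Cauchy_on_def by blast
    obtain K3 where K3: "\<forall>x\<in>{a..b}. \<forall>i\<ge>K3. \<forall>j\<ge>K3. dist (\<gamma>s i x) (\<gamma>s j x) < d"
      using cau(3) d unfolding uniformly_Cauchy_on_def by blast
    show ?thesis
    proof (intro exI[of _ "max K1 (max K2 K3)"] ballI allI impI)
      fix x i j assume x: "x \<in> {a..b}" and ij: "max K1 (max K2 K3) \<le> i" "max K1 (max K2 K3) \<le> j"
      have \<phi>: "\<bar>\<phi>s i x - \<phi>s j x - (\<beta>s i x - \<beta>s j x) * Es j x\<bar> \<le> d + d * N" if x: "x \<in> {a..b}" for x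
      proof -
        have "\<bar>\<beta>s i x - \<beta>s j x\<bar> \<le> d" using K1 ij x by (simp add: dist_real_def less_imp_le)
        then have "\<bar>(\<beta>s i x - \<beta>s j x) * Es j x\<bar> \<le> d * N"
          unfolding abs_mult using E[OF x] d by (intro mult_mono) auto
        moreover have "\<bar>\<phi>s i x - \<phi>s j x\<bar> \<le> d" using K2 ij x by (simp add: dist_real_def less_imp_le)
        ultimately show ?thesis by linarith
      qed
      have \<gamma>: "\<bar>\<gamma>s i x - \<gamma>s j x\<bar> \<le> d + d * N" if x: "x \<in> {a..b}" for x
      proof -
        have "\<bar>\<gamma>s i x - \<gamma>s j x\<bar> \<le> d" using K3 ij x by (simp add: dist_real_def less_imp_le)
        moreover have "0 \<le> d * N" using d N0 by simp
        ultimately show ?thesis by linarith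
      qed
      have "\<bar>Ds i x - Ds j x\<bar> \<le> C * (d + d * N) \<and> \<bar>Es i x - Es j x\<bar> \<le> C * (d + d * N)"
        by (rule C[OF bvp_diff[OF bvp bvp] \<beta>s n \<phi> \<gamma> x])
      then show "dist (Ds i x) (Ds j x) < e \<and> dist (Es i x) (Es j x) < e"
        using Cd by (simp add: dist_real_def)
    qed
  qed
  have "uniformly_Cauchy_on {a..b} Ds" "uniformly_Cauchy_on {a..b} Es"
    unfolding uniformly_Cauchy_on_def using main by blast+
  then obtain D E where D: "uniform_limit {a..b} Ds D sequentially"
    and E': "uniform_limit {a..b} Es E sequentially"
    by (meson Cauchy_uniformly_convergent uniformly_convergent_on_def)
  have cD: "continuous_on {a..b} D" and cE: "continuous_on {a..b} E"
    using bvp_continuous[OF bvp] by (auto intro!: uniform_limit_theorem[OF _ D] uniform_limit_theorem[OF _ E'])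
  have pD: "(\<lambda>k. Ds k x) \<longlonglongrightarrow> D x" and pE: "(\<lambda>k. Es k x) \<longlonglongrightarrow> E x" if "x \<in> {a..b}" for x
    using tendsto_uniform_limitI[OF D that] tendsto_uniform_limitI[OF E' that] by auto
  have b: "b \<in> {a..b}" using ab by simp
  have lD: "uniform_limit {a..b} (\<lambda>k x. \<phi>s k x - \<beta>s k x * Es k x) (\<lambda>x. \<phi> x - \<beta> x * E x) sequentially"
    by (intro uniform_limit_intros lim uniform_limit_mult_Icc E' cE c)
  have lE: "uniform_limit {a..b} (\<lambda>k x. \<gamma>s k x - n x * Ds k x) (\<lambda>x. \<gamma> x - n x * D x) sequentially"
    by (intro uniform_limit_intros lim uniform_limit_mult_Icc D cD c)
  have "(D has_real_derivative \<phi> x - \<beta> x * E x) (at x within {a..b})" if "x \<in> {a..b}" for x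
    by (rule uniform_limit_DERIV[OF _ lD _ that]) (auto intro: bvpD(1)[OF bvp] pD)
  moreover have "(E has_real_derivative \<gamma> x - n x * D x) (at x within {a..b})" if "x \<in> {a..b}" for x
    by (rule uniform_limit_DERIV[OF _ lE _ that]) (auto intro: bvpD(2)[OF bvp] pE)
  moreover have "D a = 0" "D b = 0"
    using LIMSEQ_unique[OF pD[OF a], of 0] LIMSEQ_unique[OF pD[OF b], of 0]
    by (simp_all add: bvpD(3,4)[OF bvp])
  ultimately show ?thesis unfolding bvp_def by blast
qed

text \<open>The filter stands for the neighbourhoods of a time, one-sided at time \<open>0\<close>; a sequence \<open>sq\<close> converging
  along it provides the limit solution, and stability the convergence along the whole filter.\<close>

lemma bvp_limit:
  fixes F :: "real filter"
  assumes ab: "a < b" and \<beta>0: "0 < \<beta>0" "\<beta>0 \<le> \<beta>1" and n0: "0 < n0" "n0 \<le> n1"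
    and n: "\<And>x. x \<in> {a..b} \<Longrightarrow> n0 \<le> n x \<and> n x \<le> n1"
    and ev: "\<forall>\<^sub>F s in F. bvp a b (\<beta>s s) n (\<phi>s s) (\<gamma>s s) (Ds s) (Es s) \<and>
               (\<forall>x\<in>{a..b}. \<beta>0 \<le> \<beta>s s x \<and> \<beta>s s x \<le> \<beta>1)"
    and lim: "uniform_limit {a..b} \<beta>s \<beta> F" "uniform_limit {a..b} \<phi>s \<phi> F" "uniform_limit {a..b} \<gamma>s \<gamma> F"
    and c: "continuous_on {a..b} \<beta>" "continuous_on {a..b} n" "continuous_on {a..b} \<phi>" "continuous_on {a..b} \<gamma>"
    and sq: "filterlim sq F sequentially"
  shows "\<exists>D E. bvp a b \<beta> n \<phi> \<gamma> D E \<and> uniform_limit {a..b} Ds D F \<and> uniform_limit {a..b} Es E F"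
proof -
  obtain M1 where M1: "\<And>x. x \<in> {a..b} \<Longrightarrow> \<bar>\<phi> x\<bar> \<le> M1" using continuous_on_Icc_bounded[OF c(3)] by metis
  obtain M2 where M2: "\<And>x. x \<in> {a..b} \<Longrightarrow> \<bar>\<gamma> x\<bar> \<le> M2" using continuous_on_Icc_bounded[OF c(4)] by metis
  define M where "M = max M1 M2 + 1"
  have "\<forall>\<^sub>F s in F. (bvp a b (\<beta>s s) n (\<phi>s s) (\<gamma>s s) (Ds s) (Es s) \<and>
          (\<forall>x\<in>{a..b}. \<beta>0 \<le> \<beta>s s x \<and> \<beta>s s x \<le> \<beta>1)) \<and>
          (\<forall>x\<in>{a..b}. \<bar>\<phi>s s x\<bar> \<le> M \<and> \<bar>\<gamma>s s x\<bar> \<le> M)"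
    using ev uniform_limitD[OF lim(2) zero_less_one] uniform_limitD[OF lim(3) zero_less_one]
  proof eventually_elim
    case (elim s)
    have "\<bar>\<phi>s s x\<bar> \<le> M \<and> \<bar>\<gamma>s s x\<bar> \<le> M" if x: "x \<in> {a..b}" for x
    proof -
      have "\<bar>\<phi>s s x - \<phi> x\<bar> < 1" "\<bar>\<gamma>s s x - \<gamma> x\<bar> < 1" using elim x by (auto simp: dist_real_def)
      then show ?thesis using M1[OF x] M2[OF x] unfolding M_def by linarith
    qed
    then show ?case using elim(1) by blast
  qed
  from eventually_compose_filterlim[OF this sq]
  obtain K where K: "\<And>k. k \<ge> K \<Longrightarrow> (bvp a b (\<beta>s (sq k)) n (\<phi>s (sq k)) (\<gamma>s (sq k)) (Ds (sq k)) (Es (sq k)) \<and>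
          (\<forall>x\<in>{a..b}. \<beta>0 \<le> \<beta>s (sq k) x \<and> \<beta>s (sq k) x \<le> \<beta>1)) \<and>
          (\<forall>x\<in>{a..b}. \<bar>\<phi>s (sq k) x\<bar> \<le> M \<and> \<bar>\<gamma>s (sq k) x\<bar> \<le> M)"
    unfolding eventually_sequentially by blast
  have sK: "filterlim (\<lambda>k. sq (k + K)) F sequentially"
    using filterlim_compose[OF sq filterlim_add_const_nat_at_top] .
  have "\<exists>D E. bvp a b \<beta> n \<phi> \<gamma> D E"
  proof (rule bvp_limit_exists[OF ab \<beta>0 n0 n])
    fix k :: nat
    have k: "K \<le> k + K" by simp
    show "bvp a b (\<beta>s (sq (k + K))) n (\<phi>s (sq (k + K))) (\<gamma>s (sq (k + K))) (Ds (sq (k + K))) (Es (sq (k + K)))"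
      using K[OF k] by (elim conjE)
    show "\<beta>0 \<le> \<beta>s (sq (k + K)) x \<and> \<beta>s (sq (k + K)) x \<le> \<beta>1" if "x \<in> {a..b}" for x
      using K[OF k] that by blast
    show "\<bar>\<phi>s (sq (k + K)) x\<bar> \<le> M \<and> \<bar>\<gamma>s (sq (k + K)) x\<bar> \<le> M" if "x \<in> {a..b}" for x
      using K[OF k] that by blast
  qed (auto intro!: c filterlim_compose[OF lim(1) sK] filterlim_compose[OF lim(2) sK] filterlim_compose[OF lim(3) sK])
  then obtain D E where DE: "bvp a b \<beta> n \<phi> \<gamma> D E" by blast
  show ?thesis
    using DE bvp_stable[OF ab \<beta>0 n0 n ev lim DE] by blast
qed

section \<open>Regularity in time of the Lagrangian flow\<close>

lemma jcontI:
  assumes "\<And>t. t \<ge> 0 \<Longrightarrow> continuous_on {a..b} (V t)"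
    and "\<And>t. t \<ge> 0 \<Longrightarrow> uniform_limit {a..b} V (V t) (at t within {0..})"
  shows "jcont a b V"
  unfolding jcont_def continuous_on_iff
proof (intro ballI allI impI)
  fix z :: "real \<times> real" and e :: real
  assume z: "z \<in> {0..} \<times> {a..b}" and e: "e > 0"
  obtain t x where tx: "z = (t, x)" "t \<ge> 0" "x \<in> {a..b}" using z by auto
  obtain d1 where d1: "d1 > 0" "\<And>y. y \<in> {a..b} \<Longrightarrow> dist y x < d1 \<Longrightarrow> dist (V t y) (V t x) < e / 2"
    using assms(1)[OF tx(2)] tx(3) e unfolding continuous_on_iff by (meson half_gt_zero)
  have "\<forall>\<^sub>F s in at t within {0..}. \<forall>y\<in>{a..b}. dist (V s y) (V t y) < e / 2"
    by (rule uniform_limitD[OF assms(2)[OF tx(2)]]) (use e in simp)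
  then obtain d2 where d2: "d2 > 0" "\<And>s y. s \<ge> 0 \<Longrightarrow> s \<noteq> t \<Longrightarrow> dist s t < d2 \<Longrightarrow> y \<in> {a..b} \<Longrightarrow>
      dist (V s y) (V t y) < e / 2"
    unfolding eventually_at by auto
  show "\<exists>d>0. \<forall>z'\<in>{0..} \<times> {a..b}. dist z' z < d \<longrightarrow>
      dist (V (fst z') (snd z')) (V (fst z) (snd z)) < e"
  proof (intro exI[of _ "min d1 d2"] conjI ballI impI)
    fix z' :: "real \<times> real" assume z': "z' \<in> {0..} \<times> {a..b}" "dist z' z < min d1 d2"
    obtain s y where sy: "z' = (s, y)" "s \<ge> 0" "y \<in> {a..b}" using z' by auto
    have "dist s t \<le> dist z' z" "dist y x \<le> dist z' z"
      using dist_fst_le[of z' z] dist_snd_le[of z' z] by (simp_all add: sy tx)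
    then have "dist s t < d2" "dist y x < d1" using z'(2) by simp_all
    then have "dist (V t y) (V t x) < e / 2" by (intro d1(2) sy)
    moreover have "dist (V s y) (V t y) < e / 2"
    proof (cases "s = t")
      case False
      then show ?thesis by (rule d2(2)[OF sy(2) _ \<open>dist s t < d2\<close> sy(3)])
    qed (use e in simp)
    ultimately have "dist (V s y) (V t x) < e" by metric
    then show "dist (V (fst z') (snd z')) (V (fst z) (snd z)) < e" by (simp add: sy tx)
  qed (use d1 d2 in auto)
qed

text \<open>The Euler--Lagrange equation as a first order system for the transport map \<open>\<Phi> t\<close> and the
  Lagrangian density \<open>q t = m / \<Phi>'\<close>.  Time enters only through the forcing, and affinely.\<close>

locale lagrangian_flow =
  fixes a b :: real and m n g0 g1 :: "real \<Rightarrow> real" and \<Phi> q :: "real \<Rightarrow> real \<Rightarrow> real"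
  assumes ab: "a < b"
    and cont: "continuous_on {a..b} m" "continuous_on {a..b} n"
      "continuous_on {a..b} g0" "continuous_on {a..b} g1"
    and m_pos: "\<And>x. x \<in> {a..b} \<Longrightarrow> m x > 0" and n_pos: "\<And>x. x \<in> {a..b} \<Longrightarrow> n x > 0"
    and \<Phi>_deriv: "\<And>t x. t \<ge> 0 \<Longrightarrow> x \<in> {a..b} \<Longrightarrow>
          (\<Phi> t has_real_derivative m x / q t x) (at x within {a..b})"
    and q_deriv: "\<And>t x. t \<ge> 0 \<Longrightarrow> x \<in> {a..b} \<Longrightarrow>
          (q t has_real_derivative g0 x + t * g1 x - n x * \<Phi> t x) (at x within {a..b})"
    and q_pos: "\<And>t x. t \<ge> 0 \<Longrightarrow> x \<in> {a..b} \<Longrightarrow> q t x > 0"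
    and \<Phi>_ends: "\<And>t. t \<ge> 0 \<Longrightarrow> \<Phi> t a = a" "\<And>t. t \<ge> 0 \<Longrightarrow> \<Phi> t b = b"
begin

lemma ends: "a \<in> {a..b}" "b \<in> {a..b}"
  using ab by auto

lemma q_cont: "t \<ge> 0 \<Longrightarrow> continuous_on {a..b} (q t)"
  and \<Phi>_cont: "t \<ge> 0 \<Longrightarrow> continuous_on {a..b} (\<Phi> t)"
  by (rule DERIV_continuous_on, erule (1) q_deriv, rule DERIV_continuous_on, erule (1) \<Phi>_deriv)

lemma \<Phi>_less:
  assumes "t \<ge> 0" "x \<in> {a..b}" "y \<in> {a..b}" "x < y"
  shows "\<Phi> t x < \<Phi> t y"
proof -
  obtain z where z: "z \<in> {a..b}" "\<Phi> t y - \<Phi> t x = m z / q t z * (y - x)"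
    by (rule MVT_Icc[OF \<Phi>_deriv[OF assms(1)] assms(2,3)])
  have "0 < m z / q t z * (y - x)" using m_pos[OF z(1)] q_pos[OF assms(1) z(1)] assms(4) by simp
  then show ?thesis using z(2) by simp
qed

lemma \<Phi>_le: "t \<ge> 0 \<Longrightarrow> x \<in> {a..b} \<Longrightarrow> y \<in> {a..b} \<Longrightarrow> x \<le> y \<Longrightarrow> \<Phi> t x \<le> \<Phi> t y"
  using \<Phi>_less[of t x y] by (cases "x = y") auto

lemma \<Phi>_range: "t \<ge> 0 \<Longrightarrow> x \<in> {a..b} \<Longrightarrow> \<Phi> t x \<in> {a..b}"
  using \<Phi>_le[of t a x] \<Phi>_le[of t x b] \<Phi>_ends[of t] ends by auto

text \<open>Since \<open>q' / q = (q' / m) \<Phi>'\<close> and \<open>\<Phi>'\<close> has mass \<open>b - a\<close>, the oscillation of \<open>ln q\<close> is bounded by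
  the data alone; and \<open>q = m\<close> somewhere by the mean value theorem for \<open>\<Phi>\<close>.\<close>

lemma q_bounds:
  obtains l u where "0 < l" "l \<le> u"
    "\<And>t x. 0 \<le> t \<Longrightarrow> t \<le> \<tau> \<Longrightarrow> x \<in> {a..b} \<Longrightarrow> l \<le> q t x \<and> q t x \<le> u"
proof -
  obtain m0 m1 where m: "0 < m0" "m0 \<le> m1" "\<And>x. x \<in> {a..b} \<Longrightarrow> m0 \<le> m x \<and> m x \<le> m1"
    using continuous_on_Icc_pos_bounds[OF ab cont(1) m_pos] by metis
  obtain G0 where G0: "G0 > 0" "\<And>x. x \<in> {a..b} \<Longrightarrow> \<bar>g0 x\<bar> \<le> G0"
    using continuous_on_Icc_bounded[OF cont(3)] by metis
  obtain G1 where G1: "G1 > 0" "\<And>x. x \<in> {a..b} \<Longrightarrow> \<bar>g1 x\<bar> \<le> G1"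
    using continuous_on_Icc_bounded[OF cont(4)] by metis
  obtain N where N: "N > 0" "\<And>x. x \<in> {a..b} \<Longrightarrow> \<bar>n x\<bar> \<le> N"
    using continuous_on_Icc_bounded[OF cont(2)] by metis
  define K where "K = G0 + \<bar>\<tau>\<bar> * G1 + N * (\<bar>a\<bar> + \<bar>b\<bar>)"
  define c where "c = K / m0"
  have K: "\<bar>g0 x + t * g1 x - n x * \<Phi> t x\<bar> \<le> K" if t: "0 \<le> t" "t \<le> \<tau>" and x: "x \<in> {a..b}" for t x
  proof -
    have "\<bar>t * g1 x\<bar> \<le> \<bar>\<tau>\<bar> * G1" unfolding abs_mult using t G1 x by (intro mult_mono) auto
    moreover have "\<bar>n x * \<Phi> t x\<bar> \<le> N * (\<bar>a\<bar> + \<bar>b\<bar>)"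
      unfolding abs_mult using N x \<Phi>_range[OF t(1) x] by (intro mult_mono) auto
    ultimately show ?thesis using G0(2)[OF x] unfolding K_def by linarith
  qed
  have "K \<ge> 0" using K_def G0 G1 N by simp
  then have c0: "c \<ge> 0" using m by (simp add: c_def)
  have osc: "\<bar>ln (q t y) - ln (q t x)\<bar> \<le> c * (b - a)"
    if t: "0 \<le> t" "t \<le> \<tau>" and x: "x \<in> {a..b}" and y: "y \<in> {a..b}" for t x y
  proof -
    have main: "\<bar>ln (q t y) - ln (q t x)\<bar> \<le> c * (\<Phi> t y - \<Phi> t x)"
      if x: "x \<in> {a..b}" and y: "y \<in> {a..b}" and xy: "x \<le> y" for x y
    proof -
      have d: "((\<lambda>z. ln (q t z)) has_real_derivative (g0 z + t * g1 z - n z * \<Phi> t z) / q t z) (at z within {a..b})"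
        if "z \<in> {a..b}" for z
        using q_deriv[OF t(1) that] q_pos[OF t(1) that]
        by (auto intro!: derivative_eq_intros)
      have d': "\<bar>(g0 z + t * g1 z - n z * \<Phi> t z) / q t z\<bar> \<le> c * (m z / q t z)" if z: "z \<in> {a..b}" for z
      proof -
        have "K = c * m0" using m by (simp add: c_def)
        also have "\<dots> \<le> c * m z" using m(3)[OF z] c0 by (intro mult_left_mono) auto
        finally have "\<bar>g0 z + t * g1 z - n z * \<Phi> t z\<bar> \<le> c * m z" using K[OF t z] by simp
        then show ?thesis using q_pos[OF t(1) z] by (simp add: abs_div divide_right_mono abs_divide)
      qed
      obtain z where z: "z \<in> {a..b}" "ln (q t y) - c * \<Phi> t y - (ln (q t x) - c * \<Phi> t x)
          = ((g0 z + t * g1 z - n z * \<Phi> t z) / q t z - c * (m z / q t z)) * (y - x)"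
        by (rule MVT_Icc[OF DERIV_diff[OF d DERIV_cmult[OF \<Phi>_deriv[OF t(1)]]] x y])
      have "((g0 z + t * g1 z - n z * \<Phi> t z) / q t z - c * (m z / q t z)) * (y - x) \<le> 0"
        using abs_le_D1[OF d'[OF z(1)]] xy by (intro mult_nonpos_nonneg) auto
      moreover obtain z' where z': "z' \<in> {a..b}" "ln (q t y) + c * \<Phi> t y - (ln (q t x) + c * \<Phi> t x)
          = ((g0 z' + t * g1 z' - n z' * \<Phi> t z') / q t z' + c * (m z' / q t z')) * (y - x)"
        by (rule MVT_Icc[OF DERIV_add[OF d DERIV_cmult[OF \<Phi>_deriv[OF t(1)]]] x y])
      have "0 \<le> ((g0 z' + t * g1 z' - n z' * \<Phi> t z') / q t z' + c * (m z' / q t z')) * (y - x)"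
        using abs_le_D2[OF d'[OF z'(1)]] xy by (intro mult_nonneg_nonneg) auto
      ultimately show ?thesis using z(2) z'(2) by (simp add: algebra_simps)
    qed
    have le: "c * (\<Phi> t y - \<Phi> t x) \<le> c * (b - a)" if "x \<in> {a..b}" "y \<in> {a..b}" for x y
      using \<Phi>_range[OF t(1) that(1)] \<Phi>_range[OF t(1) that(2)] c0 by (intro mult_left_mono) auto
    show ?thesis
      using main[OF x y] main[OF y x] le[OF x y] le[OF y x]
      by (cases "x \<le> y") (auto simp: abs_minus_commute)
  qed
  have bounds: "m0 * exp (- (c * (b - a))) \<le> q t x \<and> q t x \<le> m1 * exp (c * (b - a))"
    if t: "0 \<le> t" "t \<le> \<tau>" and x: "x \<in> {a..b}" for t x
  proof -
    obtain z where z: "z \<in> {a..b}" "\<Phi> t b - \<Phi> t a = m z / q t z * (b - a)"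
      by (rule MVT_Icc[OF \<Phi>_deriv[OF t(1)] ends])
    have "m z / q t z * (b - a) = 1 * (b - a)" using z(2) \<Phi>_ends[OF t(1)] by simp
    then have "m z / q t z = 1" unfolding mult_cancel_right using ab by simp
    then have qz: "q t z = m z" using q_pos[OF t(1) z(1)] by (simp add: field_simps)
    note qx = q_pos[OF t(1) x]
    have mz: "0 < m z" by (rule m_pos[OF z(1)])
    have "ln (m z) - c * (b - a) \<le> ln (q t x)" "ln (q t x) \<le> ln (m z) + c * (b - a)"
      using osc[OF t z(1) x] by (auto simp: qz)
    then have "exp (ln (m z) + - (c * (b - a))) \<le> exp (ln (q t x))"
       "exp (ln (q t x)) \<le> exp (ln (m z) + c * (b - a))"
      unfolding exp_le_cancel_iff by auto
    then have "m z * exp (- (c * (b - a))) \<le> q t x" "q t x \<le> m z * exp (c * (b - a))"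
      using qx mz by (simp_all only: exp_add exp_ln)
    moreover have "m0 * exp (- (c * (b - a))) \<le> m z * exp (- (c * (b - a)))"
      "m z * exp (c * (b - a)) \<le> m1 * exp (c * (b - a))"
      using m(3)[OF z(1)] by (auto intro!: mult_right_mono)
    ultimately show ?thesis by linarith
  qed
  show ?thesis
  proof (rule that[of "m0 * exp (- (c * (b - a)))" "m1 * exp (c * (b - a))"])
    have "- (c * (b - a)) \<le> c * (b - a)" using c0 ab by simp
    then show "m0 * exp (- (c * (b - a))) \<le> m1 * exp (c * (b - a))"
      using m by (intro mult_mono) auto
  qed (use m bounds in auto)
qed

text \<open>The nonlinear term becomes linear through the identity
  \<open>m / q s - m / q t = - m (q s - q t) / (q s q t)\<close>; the rest of the system is affine.\<close>

lemma bvp_quotient: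
  assumes s: "s \<ge> 0" and t: "t \<ge> 0" and st: "s \<noteq> t"
  shows "bvp a b (\<lambda>x. m x * inverse (q s x) * inverse (q t x)) n (\<lambda>_. 0) g1
           (\<lambda>x. (\<Phi> s x - \<Phi> t x) / (s - t)) (\<lambda>x. (q s x - q t x) / (s - t))"
  unfolding bvp_def
proof (intro conjI ballI)
  fix x assume x: "x \<in> {a..b}"
  show "((\<lambda>x. (\<Phi> s x - \<Phi> t x) / (s - t)) has_real_derivative
      0 - m x * inverse (q s x) * inverse (q t x) * ((q s x - q t x) / (s - t))) (at x within {a..b})"
    by (rule DERIV_cong[OF DERIV_cdivide[OF DERIV_diff[OF \<Phi>_deriv[OF s x] \<Phi>_deriv[OF t x]]]])
      (use q_pos[OF s x] q_pos[OF t x] st in \<open>simp add: field_simps\<close>)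
  show "((\<lambda>x. (q s x - q t x) / (s - t)) has_real_derivative
      g1 x - n x * ((\<Phi> s x - \<Phi> t x) / (s - t))) (at x within {a..b})"
    by (rule DERIV_cong[OF DERIV_cdivide[OF DERIV_diff[OF q_deriv[OF s x] q_deriv[OF t x]]]])
      (use st in \<open>simp add: field_simps\<close>)
qed (use \<Phi>_ends s t in auto)

abbreviation "slice t \<equiv> at t within {0::real..}"

lemma slice_sequence:
  assumes "t \<ge> 0"
  shows "filterlim (\<lambda>k. t + 1 / real (Suc k)) (slice t) sequentially"
proof -
  have "(\<lambda>k. t + 1 / real (Suc k)) \<longlonglongrightarrow> t + 0"
    by (intro tendsto_intros LIMSEQ_Suc lim_1_over_n)
  then show ?thesis
    using assms by (auto simp: filterlim_at intro!: always_eventually)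
qed

lemma eventually_slice: "t \<ge> 0 \<Longrightarrow> \<forall>\<^sub>F s in slice t. 0 \<le> s \<and> s \<le> t + 1 \<and> s \<noteq> t"
  unfolding eventually_at by (rule exI[of _ 1]) (auto simp: dist_real_def)

lemma n_bounds:
  obtains n0 n1 where "0 < n0" "n0 \<le> n1" "\<And>x. x \<in> {a..b} \<Longrightarrow> n0 \<le> n x \<and> n x \<le> n1"
  using continuous_on_Icc_pos_bounds[OF ab cont(2) n_pos] by metis

text \<open>Uniformity in \<open>s\<close> and \<open>t\<close> keeps the constant of the a priori bound fixed while \<open>s\<close> tends to
  \<open>t\<close>.\<close>

lemma \<beta>_bounds:
  obtains \<beta>0 \<beta>1 where "0 < \<beta>0" "\<beta>0 \<le> \<beta>1"
    "\<And>s t x. 0 \<le> s \<Longrightarrow> s \<le> \<tau> \<Longrightarrow> 0 \<le> t \<Longrightarrow> t \<le> \<tau> \<Longrightarrow> x \<in> {a..b} \<Longrightarrow>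
      \<beta>0 \<le> m x * inverse (q s x) * inverse (q t x) \<and> m x * inverse (q s x) * inverse (q t x) \<le> \<beta>1"
proof -
  obtain m0 m1 where m: "0 < m0" "m0 \<le> m1" "\<And>x. x \<in> {a..b} \<Longrightarrow> m0 \<le> m x \<and> m x \<le> m1"
    using continuous_on_Icc_pos_bounds[OF ab cont(1) m_pos] by metis
  obtain l u where q: "0 < l" "l \<le> u"
    "\<And>t x. 0 \<le> t \<Longrightarrow> t \<le> \<tau> \<Longrightarrow> x \<in> {a..b} \<Longrightarrow> l \<le> q t x \<and> q t x \<le> u"
    using q_bounds by blast
  have i: "0 < inverse u" "inverse u \<le> inverse l" using q by auto
  have iq: "inverse u \<le> inverse (q t x) \<and> inverse (q t x) \<le> inverse l"
    if "0 \<le> t" "t \<le> \<tau>" "x \<in> {a..b}" for t x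
    using q(3)[OF that] q(1) by (auto intro!: le_imp_inverse_le)
  show ?thesis
  proof (rule that[of "m0 * inverse u * inverse u" "m1 * inverse l * inverse l"])
    fix s t x assume s: "0 \<le> s" "s \<le> \<tau>" and t: "0 \<le> t" "t \<le> \<tau>" and x: "x \<in> {a..b}"
    show "m0 * inverse u * inverse u \<le> m x * inverse (q s x) * inverse (q t x) \<and>
        m x * inverse (q s x) * inverse (q t x) \<le> m1 * inverse l * inverse l"
      using iq[OF s x] iq[OF t x] i q m(1) m(3)[OF x] q_pos[OF s(1) x] q_pos[OF t(1) x]
      by (intro conjI mult_mono mult_nonneg_nonneg) (auto simp: less_imp_le)
    next
      show "m0 * inverse u * inverse u \<le> m1 * inverse l * inverse l"
        using i m q by (intro mult_mono mult_nonneg_nonneg) (auto simp: less_imp_le)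
  qed (use m i in auto)
qed

text \<open>The a priori bound for the difference quotients says that the flow is Lipschitz in time.\<close>

lemma flow_uniform_limit:
  assumes t: "t \<ge> 0"
  shows "uniform_limit {a..b} \<Phi> (\<Phi> t) (slice t)" "uniform_limit {a..b} q (q t) (slice t)"
proof -
  obtain \<beta>0 \<beta>1 where \<beta>: "0 < \<beta>0" "\<beta>0 \<le> \<beta>1" "\<And>s r x. 0 \<le> s \<Longrightarrow> s \<le> t + 1 \<Longrightarrow> 0 \<le> r \<Longrightarrow> r \<le> t + 1 \<Longrightarrow>
      x \<in> {a..b} \<Longrightarrow> \<beta>0 \<le> m x * inverse (q s x) * inverse (q r x) \<and>
        m x * inverse (q s x) * inverse (q r x) \<le> \<beta>1"
    using \<beta>_bounds by blast
  obtain n0 n1 where n: "0 < n0" "n0 \<le> n1" "\<And>x. x \<in> {a..b} \<Longrightarrow> n0 \<le> n x \<and> n x \<le> n1"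
    using n_bounds by blast
  obtain G where G: "G > 0" "\<And>x. x \<in> {a..b} \<Longrightarrow> \<bar>g1 x\<bar> \<le> G"
    using continuous_on_Icc_bounded[OF cont(4)] by metis
  obtain C where "C > 0" and C: "\<And>\<beta> n \<phi> \<gamma> D E \<delta> x. bvp a b \<beta> n \<phi> \<gamma> D E \<Longrightarrow>
       (\<And>x. x \<in> {a..b} \<Longrightarrow> \<beta>0 \<le> \<beta> x \<and> \<beta> x \<le> \<beta>1) \<Longrightarrow>
       (\<And>x. x \<in> {a..b} \<Longrightarrow> n0 \<le> n x \<and> n x \<le> n1) \<Longrightarrow>
       (\<And>x. x \<in> {a..b} \<Longrightarrow> \<bar>\<phi> x\<bar> \<le> \<delta>) \<Longrightarrow> (\<And>x. x \<in> {a..b} \<Longrightarrow> \<bar>\<gamma> x\<bar> \<le> \<delta>) \<Longrightarrow>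
       x \<in> {a..b} \<Longrightarrow> \<bar>D x\<bar> \<le> C * \<delta> \<and> \<bar>E x\<bar> \<le> C * \<delta>"
    by (rule bvp_bound[OF ab \<beta>(1,2) n(1,2)]) blast
  have lip: "\<bar>\<Phi> s x - \<Phi> t x\<bar> \<le> C * G * \<bar>s - t\<bar> \<and> \<bar>q s x - q t x\<bar> \<le> C * G * \<bar>s - t\<bar>"
    if s: "0 \<le> s" "s \<le> t + 1" "s \<noteq> t" and x: "x \<in> {a..b}" for s x
  proof -
    have "\<bar>(\<Phi> s x - \<Phi> t x) / (s - t)\<bar> \<le> C * G \<and> \<bar>(q s x - q t x) / (s - t)\<bar> \<le> C * G"
      by (rule C[OF bvp_quotient[OF s(1) t s(3)] _ n(3) _ G(2) x])
        (use \<beta>(3)[OF s(1,2) t] t G in auto)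
    then show ?thesis using s by (simp add: abs_divide pos_divide_le_eq)
  qed
  have small: "\<forall>\<^sub>F s in slice t. C * G * \<bar>s - t\<bar> < e" if "e > 0" for e
  proof -
    have "((\<lambda>s. C * G * \<bar>s - t\<bar>) \<longlongrightarrow> C * G * \<bar>t - t\<bar>) (slice t)" by (intro tendsto_intros)
    then show ?thesis using order_tendstoD(2)[of _ "C * G * \<bar>t - t\<bar>" "slice t" e] that by simp
  qed
  show "uniform_limit {a..b} \<Phi> (\<Phi> t) (slice t)"
  proof (rule uniform_limitI)
    fix e :: real assume "e > 0"
    from eventually_slice[OF t] small[OF this]
    show "\<forall>\<^sub>F s in slice t. \<forall>x\<in>{a..b}. dist (\<Phi> s x) (\<Phi> t x) < e"
      by eventually_elim (use lip in \<open>force simp: dist_real_def\<close>)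
  qed
  show "uniform_limit {a..b} q (q t) (slice t)"
  proof (rule uniform_limitI)
    fix e :: real assume "e > 0"
    from eventually_slice[OF t] small[OF this]
    show "\<forall>\<^sub>F s in slice t. \<forall>x\<in>{a..b}. dist (q s x) (q t x) < e"
      by eventually_elim (use lip in \<open>force simp: dist_real_def\<close>)
  qed
qed

lemma flow_jcont: "jcont a b \<Phi>" "jcont a b q"
  by (rule jcontI, erule \<Phi>_cont, erule flow_uniform_limit)
    (rule jcontI, erule q_cont, erule flow_uniform_limit)

lemma inverse_q_uniform_limit:
  assumes "t \<ge> 0"
  shows "uniform_limit {a..b} (\<lambda>s x. inverse (q s x)) (\<lambda>x. inverse (q t x)) (slice t)"
  by (rule uniform_limit_inverse_Icc[OF ab flow_uniform_limit(2)[OF assms] q_cont[OF assms]])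
    (rule q_pos[OF assms])

lemma inverse_q_cont: "t \<ge> 0 \<Longrightarrow> continuous_on {a..b} (\<lambda>x. inverse (q t x))"
  using q_pos by (intro continuous_on_inverse q_cont) force+

lemmas flow_cont = cont q_cont inverse_q_cont \<Phi>_cont

definition \<beta> :: "real \<Rightarrow> real \<Rightarrow> real" where
  "\<beta> t x = m x * inverse (q t x) * inverse (q t x)"

lemma \<beta>_cont: "t \<ge> 0 \<Longrightarrow> continuous_on {a..b} (\<beta> t)"
  unfolding \<beta>_def by (intro continuous_intros flow_cont)

text \<open>The two cases \<open>r s = t\<close> and \<open>r s = s\<close> cover the difference quotients of the nonlinear system,
  whose coefficient is \<open>m / (q s q t)\<close>, and the linear problems with coefficient \<open>\<beta> s\<close>.\<close>

lemma slice_bvp_data: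
  fixes r :: "real \<Rightarrow> real"
  assumes t: "t \<ge> 0" and r: "\<And>s. r s = s \<or> r s = t"
    and rl: "uniform_limit {a..b} (\<lambda>s x. inverse (q (r s) x)) (\<lambda>x. inverse (q t x)) (slice t)"
    and sol: "\<And>s. s \<ge> 0 \<Longrightarrow> s \<noteq> t \<Longrightarrow>
        bvp a b (\<lambda>x. m x * inverse (q s x) * inverse (q (r s) x)) n (\<phi>s s) (\<gamma>s s) (Ds s) (Es s)"
  obtains \<beta>0 \<beta>1 where "0 < \<beta>0" "\<beta>0 \<le> \<beta>1"
    "\<forall>\<^sub>F s in slice t. bvp a b (\<lambda>x. m x * inverse (q s x) * inverse (q (r s) x)) n (\<phi>s s) (\<gamma>s s) (Ds s) (Es s) \<and>
       (\<forall>x\<in>{a..b}. \<beta>0 \<le> m x * inverse (q s x) * inverse (q (r s) x) \<and>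
          m x * inverse (q s x) * inverse (q (r s) x) \<le> \<beta>1)"
    "uniform_limit {a..b} (\<lambda>s x. m x * inverse (q s x) * inverse (q (r s) x)) (\<beta> t) (slice t)"
proof -
  obtain \<beta>0 \<beta>1 where \<beta>: "0 < \<beta>0" "\<beta>0 \<le> \<beta>1" "\<And>s r x. 0 \<le> s \<Longrightarrow> s \<le> t + 1 \<Longrightarrow> 0 \<le> r \<Longrightarrow> r \<le> t + 1 \<Longrightarrow>
      x \<in> {a..b} \<Longrightarrow> \<beta>0 \<le> m x * inverse (q s x) * inverse (q r x) \<and>
        m x * inverse (q s x) * inverse (q r x) \<le> \<beta>1"
    using \<beta>_bounds by blast
  show ?thesis
  proof (rule that[OF \<beta>(1,2)])
    show "\<forall>\<^sub>F s in slice t. bvp a b (\<lambda>x. m x * inverse (q s x) * inverse (q (r s) x)) n (\<phi>s s) (\<gamma>s s) (Ds s) (Es s) \<and>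
       (\<forall>x\<in>{a..b}. \<beta>0 \<le> m x * inverse (q s x) * inverse (q (r s) x) \<and>
          m x * inverse (q s x) * inverse (q (r s) x) \<le> \<beta>1)"
      using eventually_slice[OF t]
    proof eventually_elim
      case (elim s)
      have "0 \<le> r s" "r s \<le> t + 1" using r[of s] elim t by auto
      then show ?case using sol[of s] \<beta>(3)[of s "r s"] elim by auto
    qed
    show "uniform_limit {a..b} (\<lambda>s x. m x * inverse (q s x) * inverse (q (r s) x)) (\<beta> t) (slice t)"
      unfolding \<beta>_def
      by (intro uniform_limit_mult_Icc uniform_limit_const rl inverse_q_uniform_limit t flow_cont continuous_intros)
  qed
qed

lemma slice_bvp_limit:
  fixes r :: "real \<Rightarrow> real"
  assumes t: "t \<ge> 0" and r: "\<And>s. r s = s \<or> r s = t"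
    and rl: "uniform_limit {a..b} (\<lambda>s x. inverse (q (r s) x)) (\<lambda>x. inverse (q t x)) (slice t)"
    and sol: "\<And>s. s \<ge> 0 \<Longrightarrow> s \<noteq> t \<Longrightarrow>
        bvp a b (\<lambda>x. m x * inverse (q s x) * inverse (q (r s) x)) n (\<phi>s s) (\<gamma>s s) (Ds s) (Es s)"
    and lim: "uniform_limit {a..b} \<phi>s \<phi> (slice t)" "uniform_limit {a..b} \<gamma>s \<gamma> (slice t)"
  shows "continuous_on {a..b} \<phi> \<Longrightarrow> continuous_on {a..b} \<gamma> \<Longrightarrow>
      \<exists>D E. bvp a b (\<beta> t) n \<phi> \<gamma> D E \<and> uniform_limit {a..b} Ds D (slice t) \<and>
           uniform_limit {a..b} Es E (slice t)"
    and "bvp a b (\<beta> t) n \<phi> \<gamma> D E \<Longrightarrow> uniform_limit {a..b} Ds D (slice t)"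
    and "bvp a b (\<beta> t) n \<phi> \<gamma> D E \<Longrightarrow> uniform_limit {a..b} Es E (slice t)"
proof -
  obtain \<beta>0 \<beta>1 where \<beta>: "0 < \<beta>0" "\<beta>0 \<le> \<beta>1"
    "\<forall>\<^sub>F s in slice t. bvp a b (\<lambda>x. m x * inverse (q s x) * inverse (q (r s) x)) n (\<phi>s s) (\<gamma>s s) (Ds s) (Es s) \<and>
       (\<forall>x\<in>{a..b}. \<beta>0 \<le> m x * inverse (q s x) * inverse (q (r s) x) \<and>
          m x * inverse (q s x) * inverse (q (r s) x) \<le> \<beta>1)"
    "uniform_limit {a..b} (\<lambda>s x. m x * inverse (q s x) * inverse (q (r s) x)) (\<beta> t) (slice t)"
    by (rule slice_bvp_data[OF t r rl sol])
  obtain n0 n1 where n: "0 < n0" "n0 \<le> n1" "\<And>x. x \<in> {a..b} \<Longrightarrow> n0 \<le> n x \<and> n x \<le> n1"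
    using n_bounds by blast
  show "continuous_on {a..b} \<phi> \<Longrightarrow> continuous_on {a..b} \<gamma> \<Longrightarrow>
      \<exists>D E. bvp a b (\<beta> t) n \<phi> \<gamma> D E \<and> uniform_limit {a..b} Ds D (slice t) \<and>
           uniform_limit {a..b} Es E (slice t)"
    by (rule bvp_limit[OF ab \<beta>(1,2) n \<beta>(3,4) lim \<beta>_cont[OF t] cont(2) _ _ slice_sequence[OF t]])
  show "bvp a b (\<beta> t) n \<phi> \<gamma> D E \<Longrightarrow> uniform_limit {a..b} Ds D (slice t)"
    by (rule bvp_stable(1)[OF ab \<beta>(1,2) n \<beta>(3,4) lim])
  show "bvp a b (\<beta> t) n \<phi> \<gamma> D E \<Longrightarrow> uniform_limit {a..b} Es E (slice t)"
    by (rule bvp_stable(2)[OF ab \<beta>(1,2) n \<beta>(3,4) lim])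
qed

lemma first_time_derivative:
  "\<exists>D E. \<forall>t\<ge>0. bvp a b (\<beta> t) n (\<lambda>_. 0) g1 (D t) (E t) \<and>
     uniform_limit {a..b} (\<lambda>s x. (\<Phi> s x - \<Phi> t x) / (s - t)) (D t) (slice t) \<and>
     uniform_limit {a..b} (\<lambda>s x. (q s x - q t x) / (s - t)) (E t) (slice t)"
proof -
  define P where "P t D E \<longleftrightarrow> bvp a b (\<beta> t) n (\<lambda>_. 0) g1 D E \<and>
     uniform_limit {a..b} (\<lambda>s x. (\<Phi> s x - \<Phi> t x) / (s - t)) D (slice t) \<and>
     uniform_limit {a..b} (\<lambda>s x. (q s x - q t x) / (s - t)) E (slice t)" for t D E
  have "\<exists>D E. bvp a b (\<beta> t) n (\<lambda>_. 0) g1 D E \<and>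
     uniform_limit {a..b} (\<lambda>s x. (\<Phi> s x - \<Phi> t x) / (s - t)) D (slice t) \<and>
     uniform_limit {a..b} (\<lambda>s x. (q s x - q t x) / (s - t)) E (slice t)" if t: "t \<ge> 0" for t
  proof (rule slice_bvp_limit(1)[where r = "\<lambda>_. t" and \<phi>s = "\<lambda>s x. 0" and \<gamma>s = "\<lambda>s. g1", OF t])
    show "bvp a b (\<lambda>x. m x * inverse (q s x) * inverse (q t x)) n (\<lambda>x. 0) g1
         (\<lambda>x. (\<Phi> s x - \<Phi> t x) / (s - t)) (\<lambda>x. (q s x - q t x) / (s - t))"
      if "s \<ge> 0" "s \<noteq> t" for s
      by (rule bvp_quotient[OF that(1) t that(2)])
  qed (auto intro!: uniform_limit_const cont)
  then have main: "\<forall>t\<ge>0. \<exists>D E. P t D E" unfolding P_def by blast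
  then have "\<exists>D E. \<forall>t\<ge>0. P t (D t) (E t)" by metis
  then show ?thesis unfolding P_def .
qed

text \<open>The velocity solves a problem of the same type whose coefficient \<open>\<beta> t\<close> moves with \<open>t\<close>, so the
  argument can be repeated once; the moving coefficient produces the forcing \<open>2 m E\<^sup>2 / q\<^sup>3\<close>.\<close>

lemma second_time_derivative:
  assumes DE: "\<And>t. t \<ge> 0 \<Longrightarrow> bvp a b (\<beta> t) n (\<lambda>_. 0) g1 (D t) (E t)"
    and Elim: "\<And>t. t \<ge> 0 \<Longrightarrow> uniform_limit {a..b} (\<lambda>s x. (q s x - q t x) / (s - t)) (E t) (slice t)"
  shows "\<exists>D2 E2. \<forall>t\<ge>0. bvp a b (\<beta> t) n (\<lambda>x. 2 * m x * (E t x)\<^sup>2 / (q t x) ^ 3) (\<lambda>_. 0) (D2 t) (E2 t) \<and>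
     uniform_limit {a..b} (\<lambda>s x. (D s x - D t x) / (s - t)) (D2 t) (slice t) \<and>
     uniform_limit {a..b} (\<lambda>s x. (E s x - E t x) / (s - t)) (E2 t) (slice t)"
proof -
  have main: "\<exists>D2 E2. bvp a b (\<beta> t) n (\<lambda>x. m x * inverse (q t x) * inverse (q t x) *
       (inverse (q t x) + inverse (q t x)) * E t x * E t x) (\<lambda>_. 0) D2 E2 \<and>
     uniform_limit {a..b} (\<lambda>s x. (D s x - D t x) / (s - t)) D2 (slice t) \<and>
     uniform_limit {a..b} (\<lambda>s x. (E s x - E t x) / (s - t)) E2 (slice t)" if t: "t \<ge> 0" for t
  proof -
    note cE = bvp_continuous(2)[OF DE[OF t]]
    define \<phi>s where "\<phi>s s x = - ((\<beta> s x - \<beta> t x) / (s - t)) * E t x" for s x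
    have "uniform_limit {a..b} (\<lambda>s x. m x * inverse (q s x) * inverse (q t x) *
       (inverse (q s x) + inverse (q t x)) * ((q s x - q t x) / (s - t)) * E t x)
      (\<lambda>x. m x * inverse (q t x) * inverse (q t x) * (inverse (q t x) + inverse (q t x)) * E t x * E t x) (slice t)"
      by (intro uniform_limit_mult_Icc uniform_limit_add uniform_limit_const inverse_q_uniform_limit
          Elim t flow_cont cE continuous_intros)
    moreover have "\<forall>\<^sub>F s in slice t. \<forall>x\<in>{a..b}. m x * inverse (q s x) * inverse (q t x) *
       (inverse (q s x) + inverse (q t x)) * ((q s x - q t x) / (s - t)) * E t x = \<phi>s s x"
      using eventually_slice[OF t]
    proof eventually_elim
      case (elim s)
      show ?case
      proof
        fix x assume x: "x \<in> {a..b}"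
        have i: "inverse (q s x) - inverse (q t x) = - (inverse (q s x) * inverse (q t x)) * (q s x - q t x)"
          using q_pos[of s x] q_pos[OF t x] elim x by (simp add: field_simps)
        have "\<beta> s x - \<beta> t x = m x * ((inverse (q s x) - inverse (q t x)) * (inverse (q s x) + inverse (q t x)))"
          by (simp add: \<beta>_def algebra_simps)
        also have "\<dots> = - (m x * inverse (q s x) * inverse (q t x) * (inverse (q s x) + inverse (q t x)) * (q s x - q t x))"
          unfolding i by (simp add: algebra_simps)
        finally show "m x * inverse (q s x) * inverse (q t x) *
           (inverse (q s x) + inverse (q t x)) * ((q s x - q t x) / (s - t)) * E t x = \<phi>s s x"
          unfolding \<phi>s_def by simp
      qed
    qed
    ultimately have lim: "uniform_limit {a..b} \<phi>s (\<lambda>x. m x * inverse (q t x) * inverse (q t x) *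
       (inverse (q t x) + inverse (q t x)) * E t x * E t x) (slice t)"
      by (subst uniform_limit_cong[symmetric]) auto
    show ?thesis
    proof (rule slice_bvp_limit(1)[where r = "\<lambda>s. s" and \<phi>s = \<phi>s and \<gamma>s = "\<lambda>s x. 0", OF t _ _ _ lim])
      fix s assume s: "s \<ge> 0" "s \<noteq> t"
      show "bvp a b (\<lambda>x. m x * inverse (q s x) * inverse (q s x)) n (\<phi>s s) (\<lambda>x. 0)
         (\<lambda>x. (D s x - D t x) / (s - t)) (\<lambda>x. (E s x - E t x) / (s - t))"
        unfolding bvp_def \<beta>_def[symmetric]
      proof (intro conjI ballI)
        fix x assume x: "x \<in> {a..b}"
        show "((\<lambda>x. (D s x - D t x) / (s - t)) has_real_derivative
            \<phi>s s x - \<beta> s x * ((E s x - E t x) / (s - t))) (at x within {a..b})"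
          by (rule DERIV_cong[OF DERIV_cdivide[OF DERIV_diff[OF bvpD(1)[OF DE[OF s(1)] x] bvpD(1)[OF DE[OF t] x]]]])
            (use s in \<open>simp add: \<phi>s_def divide_inverse algebra_simps\<close>)
        show "((\<lambda>x. (E s x - E t x) / (s - t)) has_real_derivative
            0 - n x * ((D s x - D t x) / (s - t))) (at x within {a..b})"
          by (rule DERIV_cong[OF DERIV_cdivide[OF DERIV_diff[OF bvpD(2)[OF DE[OF s(1)] x] bvpD(2)[OF DE[OF t] x]]]])
            (simp add: divide_inverse algebra_simps)
      qed (use bvpD(3,4)[OF DE[OF s(1)]] bvpD(3,4)[OF DE[OF t]] in auto)
    qed (intro uniform_limit_const inverse_q_uniform_limit t flow_cont cE continuous_intros | simp)+
  qed
  have eq: "(\<lambda>x. m x * inverse (q t x) * inverse (q t x) *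
       (inverse (q t x) + inverse (q t x)) * E t x * E t x) = (\<lambda>x. 2 * m x * (E t x)\<^sup>2 / (q t x) ^ 3)" for t
    by (rule ext) (simp add: divide_inverse power2_eq_square power3_eq_cube)
  define P where "P t D2 E2 \<longleftrightarrow> bvp a b (\<beta> t) n (\<lambda>x. 2 * m x * (E t x)\<^sup>2 / (q t x) ^ 3) (\<lambda>_. 0) D2 E2 \<and>
     uniform_limit {a..b} (\<lambda>s x. (D s x - D t x) / (s - t)) D2 (slice t) \<and>
     uniform_limit {a..b} (\<lambda>s x. (E s x - E t x) / (s - t)) E2 (slice t)" for t D2 E2
  have "\<forall>t\<ge>0. \<exists>D2 E2. P t D2 E2" using main unfolding P_def eq by blast
  then have "\<exists>D2 E2. \<forall>t\<ge>0. P t (D2 t) (E2 t)" by metis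
  then show ?thesis unfolding P_def .
qed

lemma uniform_limit_quotient_DERIV:
  assumes "uniform_limit {a..b} (\<lambda>s x. (f s x - f t x) / (s - t)) g (slice t)" "x \<in> {a..b}"
  shows "((\<lambda>s. f s x) has_real_derivative g x) (slice t)"
  using tendsto_uniform_limitI[OF assms] by (simp add: has_field_derivative_iff)

lemma flow_time_derivatives:
  obtains D E D2 E2 where
    "jcont a b D" "jcont a b E" "jcont a b D2" "jcont a b E2"
    "\<And>t. t \<ge> 0 \<Longrightarrow> bvp a b (\<beta> t) n (\<lambda>_. 0) g1 (D t) (E t)"
    "\<And>t. t \<ge> 0 \<Longrightarrow> bvp a b (\<beta> t) n (\<lambda>x. 2 * m x * (E t x)\<^sup>2 / (q t x) ^ 3) (\<lambda>_. 0) (D2 t) (E2 t)"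
    "\<And>t x. t \<ge> 0 \<Longrightarrow> x \<in> {a..b} \<Longrightarrow> ((\<lambda>s. \<Phi> s x) has_real_derivative D t x) (at t within {0..})"
    "\<And>t x. t \<ge> 0 \<Longrightarrow> x \<in> {a..b} \<Longrightarrow> ((\<lambda>s. q s x) has_real_derivative E t x) (at t within {0..})"
    "\<And>t x. t \<ge> 0 \<Longrightarrow> x \<in> {a..b} \<Longrightarrow> ((\<lambda>s. D s x) has_real_derivative D2 t x) (at t within {0..})"
    "\<And>t x. t \<ge> 0 \<Longrightarrow> x \<in> {a..b} \<Longrightarrow> ((\<lambda>s. E s x) has_real_derivative E2 t x) (at t within {0..})"
proof -
  from first_time_derivative obtain D E where
    DE: "\<forall>t\<ge>0. bvp a b (\<beta> t) n (\<lambda>_. 0) g1 (D t) (E t) \<and>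
     uniform_limit {a..b} (\<lambda>s x. (\<Phi> s x - \<Phi> t x) / (s - t)) (D t) (slice t) \<and>
     uniform_limit {a..b} (\<lambda>s x. (q s x - q t x) / (s - t)) (E t) (slice t)"
    by (elim exE)
  have 1: "bvp a b (\<beta> t) n (\<lambda>_. 0) g1 (D t) (E t)"
    "uniform_limit {a..b} (\<lambda>s x. (\<Phi> s x - \<Phi> t x) / (s - t)) (D t) (slice t)"
    "uniform_limit {a..b} (\<lambda>s x. (q s x - q t x) / (s - t)) (E t) (slice t)" if "t \<ge> 0" for t
    using DE that by simp_all
  have "\<exists>D2 E2. \<forall>t\<ge>0. bvp a b (\<beta> t) n (\<lambda>x. 2 * m x * (E t x)\<^sup>2 / (q t x) ^ 3) (\<lambda>_. 0) (D2 t) (E2 t) \<and>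
     uniform_limit {a..b} (\<lambda>s x. (D s x - D t x) / (s - t)) (D2 t) (slice t) \<and>
     uniform_limit {a..b} (\<lambda>s x. (E s x - E t x) / (s - t)) (E2 t) (slice t)"
    by (rule second_time_derivative) (fact 1)+
  then obtain D2 E2 where
    DE2: "\<forall>t\<ge>0. bvp a b (\<beta> t) n (\<lambda>x. 2 * m x * (E t x)\<^sup>2 / (q t x) ^ 3) (\<lambda>_. 0) (D2 t) (E2 t) \<and>
     uniform_limit {a..b} (\<lambda>s x. (D s x - D t x) / (s - t)) (D2 t) (slice t) \<and>
     uniform_limit {a..b} (\<lambda>s x. (E s x - E t x) / (s - t)) (E2 t) (slice t)"
    by (elim exE)
  have 2: "bvp a b (\<beta> t) n (\<lambda>x. 2 * m x * (E t x)\<^sup>2 / (q t x) ^ 3) (\<lambda>_. 0) (D2 t) (E2 t)"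
    "uniform_limit {a..b} (\<lambda>s x. (D s x - D t x) / (s - t)) (D2 t) (slice t)"
    "uniform_limit {a..b} (\<lambda>s x. (E s x - E t x) / (s - t)) (E2 t) (slice t)" if "t \<ge> 0" for t
    using DE2 that by simp_all
  have uD: "uniform_limit {a..b} D (D t) (slice t)" and uE: "uniform_limit {a..b} E (E t) (slice t)"
    if t: "t \<ge> 0" for t
  proof -
    have sol: "bvp a b (\<lambda>x. m x * inverse (q s x) * inverse (q s x)) n (\<lambda>_. 0) g1 (D s) (E s)"
      if "s \<ge> 0" for s
      unfolding \<beta>_def[symmetric] by (rule 1(1)[OF that])
    show "uniform_limit {a..b} D (D t) (slice t)"
      by (rule slice_bvp_limit(2)[where r = "\<lambda>s. s" and \<phi>s = "\<lambda>s x. 0" and \<gamma>s = "\<lambda>s. g1", OF t _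
        inverse_q_uniform_limit[OF t] sol uniform_limit_const uniform_limit_const 1(1)[OF t]]) simp
    show "uniform_limit {a..b} E (E t) (slice t)"
      by (rule slice_bvp_limit(3)[where r = "\<lambda>s. s" and \<phi>s = "\<lambda>s x. 0" and \<gamma>s = "\<lambda>s. g1", OF t _
        inverse_q_uniform_limit[OF t] sol uniform_limit_const uniform_limit_const 1(1)[OF t]]) simp
  qed
  note cE = bvp_continuous(2)[OF 1(1)]
  have uphi: "uniform_limit {a..b} (\<lambda>s x. 2 * m x * (E s x)\<^sup>2 / (q s x) ^ 3)
      (\<lambda>x. 2 * m x * (E t x)\<^sup>2 / (q t x) ^ 3) (slice t)" if t: "t \<ge> 0" for t
    unfolding divide_inverse power2_eq_square power3_eq_cube inverse_mult_distrib
    by (intro uniform_limit_mult_Icc uniform_limit_const inverse_q_uniform_limit uE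
        t flow_cont cE continuous_intros)
  have uD2: "uniform_limit {a..b} D2 (D2 t) (slice t)" and uE2: "uniform_limit {a..b} E2 (E2 t) (slice t)"
    if t: "t \<ge> 0" for t
  proof -
    have sol: "bvp a b (\<lambda>x. m x * inverse (q s x) * inverse (q s x)) n
        (\<lambda>x. 2 * m x * (E s x)\<^sup>2 / (q s x) ^ 3) (\<lambda>_. 0) (D2 s) (E2 s)" if "s \<ge> 0" for s
      unfolding \<beta>_def[symmetric] by (rule 2(1)[OF that])
    show "uniform_limit {a..b} D2 (D2 t) (slice t)"
      by (rule slice_bvp_limit(2)[where r = "\<lambda>s. s" and \<gamma>s = "\<lambda>s x. 0", OF t _
        inverse_q_uniform_limit[OF t] sol uphi[OF t] uniform_limit_const 2(1)[OF t]]) simp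
    show "uniform_limit {a..b} E2 (E2 t) (slice t)"
      by (rule slice_bvp_limit(3)[where r = "\<lambda>s. s" and \<gamma>s = "\<lambda>s x. 0", OF t _
        inverse_q_uniform_limit[OF t] sol uphi[OF t] uniform_limit_const 2(1)[OF t]]) simp
  qed
  show ?thesis
  proof (rule that[of D E D2 E2])
    show "jcont a b D" by (rule jcontI[OF bvp_continuous(1)[OF 1(1)] uD])
    show "jcont a b E" by (rule jcontI[OF bvp_continuous(2)[OF 1(1)] uE])
    show "jcont a b D2" by (rule jcontI[OF bvp_continuous(1)[OF 2(1)] uD2])
    show "jcont a b E2" by (rule jcontI[OF bvp_continuous(2)[OF 2(1)] uE2])
    show "((\<lambda>s. \<Phi> s x) has_real_derivative D t x) (slice t)" if "t \<ge> 0" "x \<in> {a..b}" for t x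
      by (rule uniform_limit_quotient_DERIV[where f = \<Phi> and g = "D t", OF 1(2)[OF that(1)] that(2)])
    show "((\<lambda>s. q s x) has_real_derivative E t x) (slice t)" if "t \<ge> 0" "x \<in> {a..b}" for t x
      by (rule uniform_limit_quotient_DERIV[where f = q and g = "E t", OF 1(3)[OF that(1)] that(2)])
    show "((\<lambda>s. D s x) has_real_derivative D2 t x) (slice t)" if "t \<ge> 0" "x \<in> {a..b}" for t x
      by (rule uniform_limit_quotient_DERIV[where f = D and g = "D2 t", OF 2(2)[OF that(1)] that(2)])
    show "((\<lambda>s. E s x) has_real_derivative E2 t x) (slice t)" if "t \<ge> 0" "x \<in> {a..b}" for t x
      by (rule uniform_limit_quotient_DERIV[where f = E and g = "E2 t", OF 2(3)[OF that(1)] that(2)])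
  qed (fact 1(1) 2(1))+
qed

end

section \<open>Differentiating implicitly defined functions\<close>

text \<open>The increment in space is written as a slope, convergent to the partial derivative, times
  \<open>T s - T t\<close>.  This makes the implicit function theorem and the chain rule limits of quotients that
  stay inside \<open>A \<times> [a,b]\<close>, also at time \<open>0\<close> and at the end points of the interval.\<close>

lemma MVT_slope:
  fixes f f' :: "real \<Rightarrow> real \<Rightarrow> real" and T :: "real \<Rightarrow> real"
  assumes d: "\<And>s z. s \<in> A \<Longrightarrow> z \<in> {a..b} \<Longrightarrow> (f s has_real_derivative f' s z) (at z within {a..b})"
    and c: "continuous_on (A \<times> {a..b}) (\<lambda>p. f' (fst p) (snd p))"
    and t: "t \<in> A" and T: "\<And>s. s \<in> A \<Longrightarrow> T s \<in> {a..b}"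
    and lim: "(T \<longlongrightarrow> T t) (at t within A)"
  obtains \<kappa> where "\<And>s. s \<in> A \<Longrightarrow> f s (T s) - f s (T t) = \<kappa> s * (T s - T t)"
    "(\<kappa> \<longlongrightarrow> f' t (T t)) (at t within A)"
proof -
  have "\<exists>z. z \<in> closed_segment (T t) (T s) \<and> z \<in> {a..b} \<and> f s (T s) - f s (T t) = f' s z * (T s - T t)"
    if s: "s \<in> A" for s
    using MVT_Icc[OF d[OF s] T[OF t] T[OF s]] by blast
  then obtain \<xi> where \<xi>: "\<And>s. s \<in> A \<Longrightarrow> \<xi> s \<in> closed_segment (T t) (T s)"
    "\<And>s. s \<in> A \<Longrightarrow> \<xi> s \<in> {a..b}"
    "\<And>s. s \<in> A \<Longrightarrow> f s (T s) - f s (T t) = f' s (\<xi> s) * (T s - T t)"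
    by metis
  have evA: "\<forall>\<^sub>F s in at t within A. s \<in> A" by (simp add: eventually_at_filter)
  have "((\<lambda>s. \<xi> s - T t) \<longlongrightarrow> 0) (at t within A)"
  proof (rule Lim_null_comparison)
    show "\<forall>\<^sub>F s in at t within A. norm (\<xi> s - T t) \<le> \<bar>T s - T t\<bar>"
      using evA
    proof eventually_elim
      case (elim s)
      show ?case using \<xi>(1)[OF elim] by (auto simp: closed_segment_eq_real_ivl split: if_splits)
    qed
    show "((\<lambda>s. \<bar>T s - T t\<bar>) \<longlongrightarrow> 0) (at t within A)"
      using tendsto_rabs[OF tendsto_diff[OF lim tendsto_const[of "T t"]]] by simp
  qed
  then have "(\<xi> \<longlongrightarrow> T t) (at t within A)" by (simp add: LIM_zero_iff)
  then have "((\<lambda>s. (s, \<xi> s)) \<longlongrightarrow> (t, T t)) (at t within A)" by (intro tendsto_intros)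
  moreover have "\<forall>\<^sub>F s in at t within A. (s, \<xi> s) \<in> A \<times> {a..b}"
    using evA by eventually_elim (use \<xi>(2) in auto)
  moreover have "(t, T t) \<in> A \<times> {a..b}" using t T[OF t] by auto
  ultimately have "((\<lambda>s. f' (fst (s, \<xi> s)) (snd (s, \<xi> s))) \<longlongrightarrow> f' (fst (t, T t)) (snd (t, T t))) (at t within A)"
    by (intro continuous_on_tendsto_compose[OF c])
  then show ?thesis using that[of "\<lambda>s. f' s (\<xi> s)"] \<xi>(3) by simp
qed

lemma implicit_DERIV:
  fixes f f' :: "real \<Rightarrow> real \<Rightarrow> real" and T g :: "real \<Rightarrow> real"
  assumes d: "\<And>s z. s \<in> A \<Longrightarrow> z \<in> {a..b} \<Longrightarrow> (f s has_real_derivative f' s z) (at z within {a..b})"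
    and c: "continuous_on (A \<times> {a..b}) (\<lambda>p. f' (fst p) (snd p))"
    and t: "t \<in> A" and T: "\<And>s. s \<in> A \<Longrightarrow> T s \<in> {a..b}"
    and lim: "(T \<longlongrightarrow> T t) (at t within A)"
    and pos: "f' t (T t) > 0"
    and eq: "\<And>s. s \<in> A \<Longrightarrow> f s (T s) = g s"
    and dg: "((\<lambda>s. g s - f s (T t)) has_real_derivative e) (at t within A)"
  shows "(T has_real_derivative e / f' t (T t)) (at t within A)"
proof -
  obtain \<kappa> where \<kappa>: "\<And>s. s \<in> A \<Longrightarrow> f s (T s) - f s (T t) = \<kappa> s * (T s - T t)"
    "(\<kappa> \<longlongrightarrow> f' t (T t)) (at t within A)"
    using MVT_slope[OF d c t T lim] by blast
  have "((\<lambda>s. (g s - f s (T t) - (g t - f t (T t))) / (s - t)) \<longlongrightarrow> e) (at t within A)"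
    using dg by (simp add: has_field_derivative_iff)
  from tendsto_divide[OF this \<kappa>(2)] pos
  have l: "((\<lambda>s. (g s - f s (T t) - (g t - f t (T t))) / (s - t) / \<kappa> s) \<longlongrightarrow> e / f' t (T t)) (at t within A)"
    by simp
  have "\<forall>\<^sub>F s in at t within A. \<kappa> s > 0" using order_tendstoD(1)[OF \<kappa>(2) pos] .
  moreover have "\<forall>\<^sub>F s in at t within A. s \<in> A" by (simp add: eventually_at_filter)
  ultimately have "\<forall>\<^sub>F s in at t within A.
      (g s - f s (T t) - (g t - f t (T t))) / (s - t) / \<kappa> s = (T s - T t) / (s - t)"
  proof eventually_elim
    case (elim s)
    have "g s - f s (T t) - (g t - f t (T t)) = \<kappa> s * (T s - T t)"
      using \<kappa>(1)[OF elim(2)] eq[OF elim(2)] eq[OF t] by simp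
    then show ?case using elim(1) by simp
  qed
  from Lim_transform_eventually[OF l this] show ?thesis by (simp add: has_field_derivative_iff)
qed

lemma chain_DERIV:
  fixes f f' :: "real \<Rightarrow> real \<Rightarrow> real" and T :: "real \<Rightarrow> real"
  assumes d: "\<And>s z. s \<in> A \<Longrightarrow> z \<in> {a..b} \<Longrightarrow> (f s has_real_derivative f' s z) (at z within {a..b})"
    and c: "continuous_on (A \<times> {a..b}) (\<lambda>p. f' (fst p) (snd p))"
    and t: "t \<in> A" and T: "\<And>s. s \<in> A \<Longrightarrow> T s \<in> {a..b}"
    and dT: "(T has_real_derivative T') (at t within A)"
    and df: "((\<lambda>s. f s (T t)) has_real_derivative e) (at t within A)"
  shows "((\<lambda>s. f s (T s)) has_real_derivative e + f' t (T t) * T') (at t within A)"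
proof -
  have lim: "(T \<longlongrightarrow> T t) (at t within A)"
    using DERIV_continuous[OF dT] by (simp add: continuous_within)
  obtain \<kappa> where \<kappa>: "\<And>s. s \<in> A \<Longrightarrow> f s (T s) - f s (T t) = \<kappa> s * (T s - T t)"
    "(\<kappa> \<longlongrightarrow> f' t (T t)) (at t within A)"
    using MVT_slope[OF d c t T lim] by blast
  have l: "((\<lambda>s. (f s (T t) - f t (T t)) / (s - t) + \<kappa> s * ((T s - T t) / (s - t))) \<longlongrightarrow>
      e + f' t (T t) * T') (at t within A)"
    using df dT by (intro tendsto_intros \<kappa>(2)) (simp_all add: has_field_derivative_iff)
  have "\<forall>\<^sub>F s in at t within A. s \<in> A" by (simp add: eventually_at_filter)
  then have "\<forall>\<^sub>F s in at t within A.
      (f s (T t) - f t (T t)) / (s - t) + \<kappa> s * ((T s - T t) / (s - t)) =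
      (f s (T s) - f t (T t)) / (s - t)"
  proof eventually_elim
    case (elim s)
    have "f s (T t) - f t (T t) + \<kappa> s * (T s - T t) = f s (T s) - f t (T t)"
      using \<kappa>(1)[OF elim] by simp
    then show ?case by (simp only: times_divide_eq_right add_divide_distrib[symmetric])
  qed
  from Lim_transform_eventually[OF l this] show ?thesis by (simp add: has_field_derivative_iff)
qed

text \<open>By the fundamental theorem of calculus \<open>f\<close> is \<open>f a\<close> plus a primitive of \<open>g\<close>, and the latter is
  differentiable up to the end points.\<close>

lemma DERIV_extend_Icc:
  fixes f g :: "real \<Rightarrow> real"
  assumes ab: "a < b" and f: "continuous_on {a..b} f" and g: "continuous_on {a..b} g"
    and d: "\<And>x. x \<in> {a<..<b} \<Longrightarrow> (f has_real_derivative g x) (at x)" and x: "x \<in> {a..b}"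
  shows "(f has_real_derivative g x) (at x within {a..b})"
proof -
  have i: "(g has_integral f y - f a) {a..y}" if y: "y \<in> {a..b}" for y
    using y by (intro fundamental_theorem_of_calculus_interior continuous_on_subset[OF f])
      (auto simp: has_real_derivative_iff_has_vector_derivative[symmetric] intro!: d)
  have "((\<lambda>y. integral {a..y} g) has_real_derivative g x) (at x within {a..b})"
    using integral_has_vector_derivative[OF g x]
    by (simp add: has_real_derivative_iff_has_vector_derivative)
  then have "((\<lambda>y. f a + integral {a..y} g) has_real_derivative g x) (at x within {a..b})"
    using DERIV_add[OF DERIV_const] by fastforce
  then show ?thesis
    by (rule DERIV_cong_within_Icc[rotated 2]) (use integral_unique[OF i] x in auto)
qed

section \<open>From the Lagrangian flow to the Eulerian equations\<close>

text \<open>Bootstrapping: each of the two equations gains one space derivative, as long as the coefficients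
  allow it.\<close>

lemma bvp_regular:
  assumes j: "jcont a b D" "jcont a b E"
    and bvp: "\<And>t. t \<ge> 0 \<Longrightarrow> bvp a b (B t) n (\<phi> t) (\<gamma> t) (D t) (E t)"
    and B: "Ck_family a b (Suc l) B" and \<phi>: "Ck_family a b (Suc l) \<phi>"
    and n: "Ck_family a b l (\<lambda>_. n)" and \<gamma>: "Ck_family a b l \<gamma>"
  shows "Ck_family a b (l + 2) D" "Ck_family a b (l + 1) E"
proof -
  have step: "Ck_family a b (i + 1) E \<and> Ck_family a b (i + 2) D" if D: "Ck_family a b i D" and i: "i \<le> l" for i
  proof -
    have h: "Ck_family a b i (\<lambda>t x. \<gamma> t x - n x * D t x)"
      by (intro Ck_family_diff Ck_family_mult D Ck_family_mono[OF \<gamma> i] Ck_family_mono[OF n i])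
    have E: "Ck_family a b (Suc i) E"
      by (rule Ck_family_SucI[OF j(2) bvpD(2)[OF bvp] h])
    have i': "Suc i \<le> Suc l" using i by simp
    have h: "Ck_family a b (Suc i) (\<lambda>t x. \<phi> t x - B t x * E t x)"
      by (intro Ck_family_diff Ck_family_mult E Ck_family_mono[OF B i'] Ck_family_mono[OF \<phi> i'])
    have "Ck_family a b (Suc (Suc i)) D"
      by (rule Ck_family_SucI[OF j(1) bvpD(1)[OF bvp] h])
    then show ?thesis using E by simp
  qed
  have "i \<le> l \<Longrightarrow> Ck_family a b i D" for i
  proof (induction i)
    case (Suc i)
    then show ?case using step[of i] Ck_family_mono[of a b "i + 2" D "Suc i"] by simp
  qed (simp add: j)
  then show "Ck_family a b (l + 2) D" "Ck_family a b (l + 1) E" using step[of l] by auto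
qed

text \<open>The data of the theorem: \<open>g0\<close> and \<open>g1\<close> are \<open>\<partial>\<^sub>xm + n x\<close> and \<open>n u\<^sub>0 - \<partial>\<^sub>x(m \<partial>\<^sub>xu\<^sub>0)\<close>, given through
  the derivatives of \<open>m\<close> and \<open>m v0\<close> so that initial values can be read off from uniqueness.\<close>

locale igr_flow = lagrangian_flow +
  fixes \<alpha> :: real and k :: nat and u0 v0 :: "real \<Rightarrow> real"
  assumes \<alpha>: "\<alpha> > 0" and n_eq: "n = (\<lambda>x. m x / \<alpha>)"
    and m_Ck: "Ck_family a b (k + 1) (\<lambda>_. m)"
    and g_Ck: "Ck_family a b k (\<lambda>_. g0)" "Ck_family a b k (\<lambda>_. g1)"
    and m_deriv: "\<And>x. x \<in> {a..b} \<Longrightarrow> (m has_real_derivative g0 x - n x * x) (at x within {a..b})"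
    and u0_deriv: "\<And>x. x \<in> {a..b} \<Longrightarrow> (u0 has_real_derivative v0 x) (at x within {a..b})"
    and mv0_deriv: "\<And>x. x \<in> {a..b} \<Longrightarrow>
          ((\<lambda>x. m x * v0 x) has_real_derivative n x * u0 x - g1 x) (at x within {a..b})"
    and u0_ends: "u0 a = 0" "u0 b = 0"
begin

lemma n_Ck: "Ck_family a b (k + 1) (\<lambda>_. n)"
  unfolding n_eq using Ck_family_mult[OF m_Ck Ck_family_const[of a b "k+1" "1 / \<alpha>"]] by simp

lemma flow_Ck: "Ck_family a b (k + 2) \<Phi>" "Ck_family a b (k + 1) q"
proof -
  have step: "Ck_family a b (i + 1) q \<and> Ck_family a b (i + 2) \<Phi>" if P: "Ck_family a b i \<Phi>" and i: "i \<le> k" for i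
  proof -
    have i1: "i \<le> k + 1" and i2: "Suc i \<le> k + 1" using i by auto
    have h: "Ck_family a b i (\<lambda>t x. g0 x + t * g1 x - n x * \<Phi> t x)"
      by (intro Ck_family_diff Ck_family_add Ck_family_mult P Ck_family_mono[OF g_Ck(1) i]
          Ck_family_mono[OF g_Ck(2) i] Ck_family_mono[OF n_Ck i1] Ck_family_time continuous_intros)
    have Q: "Ck_family a b (Suc i) q"
      by (rule Ck_family_SucI[OF flow_jcont(2) q_deriv h])
    have h: "Ck_family a b (Suc i) (\<lambda>t x. m x / q t x)"
      using q_pos by (intro Ck_family_divide Q Ck_family_mono[OF m_Ck i2]) force
    have "Ck_family a b (Suc (Suc i)) \<Phi>"
      by (rule Ck_family_SucI[OF flow_jcont(1) \<Phi>_deriv h])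
    then show ?thesis using Q by simp
  qed
  have "i \<le> k \<Longrightarrow> Ck_family a b i \<Phi>" for i
  proof (induction i)
    case (Suc i)
    then show ?case using step[of i] Ck_family_mono[of a b "i + 2" \<Phi> "Suc i"] by simp
  qed (simp add: flow_jcont)
  then show "Ck_family a b (k + 2) \<Phi>" "Ck_family a b (k + 1) q" using step[of k] by auto
qed

definition T :: "real \<Rightarrow> real \<Rightarrow> real" where
  "T t = the_inv_into {a..b} (\<Phi> t)"

lemma \<Phi>_bij: "t \<ge> 0 \<Longrightarrow> bij_betw (\<Phi> t) {a..b} {a..b}"
proof (rule bij_betw_imageI)
  assume t: "t \<ge> 0"
  show "inj_on (\<Phi> t) {a..b}"
    by (rule linorder_inj_onI') (use \<Phi>_less[OF t] in fastforce)
  show "\<Phi> t ` {a..b} = {a..b}"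
  proof
    show "\<Phi> t ` {a..b} \<subseteq> {a..b}" using \<Phi>_range[OF t] by auto
    show "{a..b} \<subseteq> \<Phi> t ` {a..b}"
    proof
      fix y assume "y \<in> {a..b}"
      then show "y \<in> \<Phi> t ` {a..b}"
        using IVT'[of "\<Phi> t" a y b] \<Phi>_cont[OF t] \<Phi>_ends[OF t] ab by fastforce
    qed
  qed
qed

lemma T_range: "t \<ge> 0 \<Longrightarrow> x \<in> {a..b} \<Longrightarrow> T t x \<in> {a..b}"
  and \<Phi>_T: "t \<ge> 0 \<Longrightarrow> x \<in> {a..b} \<Longrightarrow> \<Phi> t (T t x) = x"
  using \<Phi>_bij[of t] the_inv_into_into[of "\<Phi> t" "{a..b}" x "{a..b}"] f_the_inv_into_f[of "\<Phi> t" "{a..b}" x]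
  by (auto simp: T_def bij_betw_def)

lemma T_ends: assumes "t \<ge> 0" shows "T t a = a" "T t b = b"
proof -
  have i: "inj_on (\<Phi> t) {a..b}" using \<Phi>_bij[OF assms] by (simp add: bij_betw_def)
  show "T t a = a" "T t b = b"
    using the_inv_into_f_f[OF i ends(1)] the_inv_into_f_f[OF i ends(2)] \<Phi>_ends[OF assms]
    by (simp_all add: T_def)
qed

text \<open>The slopes of \<open>\<Phi> t\<close> are bounded below, which makes the inverse depend continuously on
  both variables.\<close>

lemma \<Phi>_expanding:
  obtains c where "c > 0" "\<And>t x y. 0 \<le> t \<Longrightarrow> t \<le> \<tau> \<Longrightarrow> x \<in> {a..b} \<Longrightarrow> y \<in> {a..b} \<Longrightarrow>
     c * \<bar>x - y\<bar> \<le> \<bar>\<Phi> t x - \<Phi> t y\<bar>"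
proof -
  obtain m0 m1 where m: "0 < m0" "m0 \<le> m1" "\<And>x. x \<in> {a..b} \<Longrightarrow> m0 \<le> m x \<and> m x \<le> m1"
    using continuous_on_Icc_pos_bounds[OF ab cont(1) m_pos] by metis
  obtain l u where q: "0 < l" "l \<le> u"
    "\<And>t x. 0 \<le> t \<Longrightarrow> t \<le> \<tau> \<Longrightarrow> x \<in> {a..b} \<Longrightarrow> l \<le> q t x \<and> q t x \<le> u"
    using q_bounds by blast
  show ?thesis
  proof (rule that[of "m0 / u"])
    fix t x y assume t: "0 \<le> t" "t \<le> \<tau>" and x: "x \<in> {a..b}" and y: "y \<in> {a..b}"
    obtain z where z: "z \<in> {a..b}" "\<Phi> t x - \<Phi> t y = m z / q t z * (x - y)"
      by (rule MVT_Icc[OF \<Phi>_deriv[OF t(1)] y x])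
    have "m0 / u \<le> m z / q t z" using m(1) m(3)[OF z(1)] q(1) q(3)[OF t z(1)] by (intro frac_le) auto
    then have "m0 / u * \<bar>x - y\<bar> \<le> m z / q t z * \<bar>x - y\<bar>" by (rule mult_right_mono) simp
    also have "\<dots> = \<bar>m z / q t z * (x - y)\<bar>"
      using m_pos[OF z(1)] q_pos[OF t(1) z(1)] by (simp add: abs_mult)
    finally show "m0 / u * \<bar>x - y\<bar> \<le> \<bar>\<Phi> t x - \<Phi> t y\<bar>" using z(2) by simp
  qed (use m q in auto)
qed

lemma T_jcont: "jcont a b T"
proof (rule jcontI)
  fix t :: real assume t: "t \<ge> 0"
  obtain c where c: "c > 0" "\<And>s x y. 0 \<le> s \<Longrightarrow> s \<le> t + 1 \<Longrightarrow> x \<in> {a..b} \<Longrightarrow> y \<in> {a..b} \<Longrightarrow>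
     c * \<bar>x - y\<bar> \<le> \<bar>\<Phi> s x - \<Phi> s y\<bar>"
    using \<Phi>_expanding by blast
  have i: "inj_on (\<Phi> t) {a..b}" and im: "\<Phi> t ` {a..b} = {a..b}"
    using \<Phi>_bij[OF t] by (auto simp: bij_betw_def)
  have "continuous_on (\<Phi> t ` {a..b}) (T t)"
    by (rule continuous_on_inv[OF \<Phi>_cont[OF t] compact_Icc]) (simp add: T_def the_inv_into_f_f[OF i])
  then show "continuous_on {a..b} (T t)" unfolding im .
  show "uniform_limit {a..b} T (T t) (slice t)"
  proof (rule uniform_limitI)
    fix e :: real assume e: "e > 0"
    have "\<forall>\<^sub>F s in slice t. \<forall>x\<in>{a..b}. dist (\<Phi> s x) (\<Phi> t x) < c * e"
      by (rule uniform_limitD[OF flow_uniform_limit(1)[OF t]]) (use c e in simp)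
    with eventually_slice[OF t]
    show "\<forall>\<^sub>F s in slice t. \<forall>x\<in>{a..b}. dist (T s x) (T t x) < e"
    proof eventually_elim
      case (elim s)
      show ?case
      proof
        fix x assume x: "x \<in> {a..b}"
        have s: "0 \<le> s" "s \<le> t + 1" using elim by auto
        note r = T_range[OF s(1) x] T_range[OF t x]
        have "c * \<bar>T s x - T t x\<bar> \<le> \<bar>\<Phi> s (T s x) - \<Phi> s (T t x)\<bar>" by (rule c(2)[OF s r])
        also have "\<dots> = dist (\<Phi> s (T t x)) (\<Phi> t (T t x))"
          using \<Phi>_T[OF s(1) x] \<Phi>_T[OF t x] by (simp add: dist_real_def abs_minus_commute)
        also have "\<dots> < c * e" using elim(2) r(2) by blast
        finally show "dist (T s x) (T t x) < e" using c(1) by (simp add: dist_real_def)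
      qed
    qed
  qed
qed

end

context igr_flow
begin

lemma jcontD: "jcont a b U \<Longrightarrow> continuous_on ({0..} \<times> {a..b}) (\<lambda>p. U (fst p) (snd p))"
  by (simp add: jcont_def)

lemma \<Phi>x_jcont: "jcont a b (\<lambda>t x. m x / q t x)"
  using q_pos by (intro jcont_divide jcont_space cont flow_jcont) force

lemma T_x_deriv:
  assumes t: "t \<ge> 0" and x: "x \<in> {a..b}"
  shows "(T t has_real_derivative q t (T t x) / m (T t x)) (at x within {a..b})"
proof -
  note r = T_range[OF t x]
  have "(T t has_real_derivative 1 / (m (T t x) / q t (T t x))) (at x within {a..b})"
  proof (rule implicit_DERIV[where f = "\<lambda>_. \<Phi> t" and f' = "\<lambda>_ y. m y / q t y" and g = "\<lambda>x. x"])
    show "continuous_on ({a..b} \<times> {a..b}) (\<lambda>p. m (snd p) / q t (snd p))"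
      by (rule continuous_on_compose2[OF jcont_slice[OF \<Phi>x_jcont t], of _ snd]) (auto intro!: continuous_intros)
    show "(T t \<longlongrightarrow> T t x) (at x within {a..b})"
      using jcont_slice[OF T_jcont t] x by (auto simp: continuous_on_def)
    show "((\<lambda>y. y - \<Phi> t (T t x)) has_real_derivative 1) (at x within {a..b})"
      by (auto intro!: derivative_eq_intros)
  qed (use t x r T_range \<Phi>_T \<Phi>_deriv m_pos q_pos in auto)
  then show ?thesis by simp
qed

lemma T_t_deriv:
  assumes t: "t \<ge> 0" and x: "x \<in> {a..b}"
    and D: "((\<lambda>s. \<Phi> s (T t x)) has_real_derivative d) (slice t)"
  shows "((\<lambda>s. T s x) has_real_derivative - d * q t (T t x) / m (T t x)) (slice t)"
proof -
  note r = T_range[OF t x]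
  have "((\<lambda>s. T s x) has_real_derivative - d / (m (T t x) / q t (T t x))) (slice t)"
  proof (rule implicit_DERIV[where f = \<Phi> and f' = "\<lambda>s y. m y / q s y" and g = "\<lambda>_. x"])
    show "continuous_on ({0..} \<times> {a..b}) (\<lambda>p. m (snd p) / q (fst p) (snd p))"
      by (rule jcontD[OF \<Phi>x_jcont])
    show "((\<lambda>s. T s x) \<longlongrightarrow> T t x) (slice t)"
      by (rule tendsto_uniform_limitI[OF jcont_uniform_limit[OF T_jcont t] x])
    show "((\<lambda>s. x - \<Phi> s (T t x)) has_real_derivative - d) (slice t)"
      using DERIV_diff[OF DERIV_const D] by simp
  qed (use t x r T_range \<Phi>_T \<Phi>_deriv m_pos q_pos in auto)
  then show ?thesis by simp
qed

lemma T_Ck: "Ck_family a b (k + 2) T"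
proof -
  have "i \<le> k + 2 \<Longrightarrow> Ck_family a b i T" for i
  proof (induction i)
    case (Suc i)
    then have T: "Ck_family a b i T" and i: "i \<le> k + 1" by auto
    have "Ck_family a b i (\<lambda>t x. q t (T t x) / m (T t x))"
    proof (rule Ck_family_divide)
      show "Ck_family a b i (\<lambda>t x. q t (T t x))"
        by (rule Ck_family_compose[OF Ck_family_mono[OF flow_Ck(2) i] T T_range])
      show "Ck_family a b i (\<lambda>t x. m (T t x))"
        by (rule Ck_family_compose[OF Ck_family_mono[OF m_Ck i] T T_range])
      show "m (T t x) \<noteq> 0" if "t \<ge> 0" "x \<in> {a..b}" for t x
        using m_pos[OF T_range[OF that]] by simp
    qed
    then show ?case by (rule Ck_family_SucI[OF T_jcont T_x_deriv, rotated 2])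
  qed (simp add: T_jcont)
  then show ?thesis by simp
qed

text \<open>The identity with density \<open>m\<close> solves the system for \<open>t = 0\<close>, because \<open>m' = g0 - n x\<close>; the
  difference to any other solution solves the homogeneous problem with \<open>\<beta> = 1 / q\<close>.\<close>

lemma initial_flow:
  assumes "x \<in> {a..b}"
  shows "\<Phi> 0 x = x" "q 0 x = m x"
proof -
  have b: "bvp a b (\<lambda>x. inverse (q 0 x)) n (\<lambda>_. 0) (\<lambda>_. 0) (\<lambda>x. \<Phi> 0 x - x) (\<lambda>x. q 0 x - m x)"
    unfolding bvp_def
  proof (intro conjI ballI)
    fix x assume x: "x \<in> {a..b}"
    show "((\<lambda>x. \<Phi> 0 x - x) has_real_derivative 0 - inverse (q 0 x) * (q 0 x - m x)) (at x within {a..b})"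
      by (rule DERIV_cong[OF DERIV_diff[OF \<Phi>_deriv[OF order_refl x] DERIV_ident]])
        (use q_pos[OF order_refl x] in \<open>simp add: field_simps\<close>)
    show "((\<lambda>x. q 0 x - m x) has_real_derivative 0 - n x * (\<Phi> 0 x - x)) (at x within {a..b})"
      by (rule DERIV_cong[OF DERIV_diff[OF q_deriv[OF order_refl x] m_deriv[OF x]]])
        (simp add: algebra_simps)
  qed (auto simp: \<Phi>_ends)
  have p: "0 < inverse (q 0 x)" if "x \<in> {a..b}" for x using q_pos[OF order_refl that] by simp
  show "\<Phi> 0 x = x" "q 0 x = m x"
    using bvp_unique[OF ab b assms inverse_q_cont[OF order_refl] cont(2) p n_pos] by auto
qed

text \<open>The pair \<open>u0\<close>, \<open>- m v0\<close> solves the problem for the velocity at time \<open>0\<close>, where \<open>q = m\<close>.\<close>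

lemma initial_velocity:
  assumes D: "bvp a b (\<beta> 0) n (\<lambda>_. 0) g1 D E" and x: "x \<in> {a..b}"
  shows "D x = u0 x"
proof -
  have b: "bvp a b (\<lambda>x. inverse (m x)) n (\<lambda>_. 0) (\<lambda>_. 0) (\<lambda>x. D x - u0 x) (\<lambda>x. E x + m x * v0 x)"
    unfolding bvp_def
  proof (intro conjI ballI)
    fix x assume x: "x \<in> {a..b}"
    show "((\<lambda>x. D x - u0 x) has_real_derivative 0 - inverse (m x) * (E x + m x * v0 x)) (at x within {a..b})"
      by (rule DERIV_cong[OF DERIV_diff[OF bvpD(1)[OF D x] u0_deriv[OF x]]])
        (use m_pos[OF x] in \<open>simp add: \<beta>_def initial_flow[OF x] field_simps\<close>)
    show "((\<lambda>x. E x + m x * v0 x) has_real_derivative 0 - n x * (D x - u0 x)) (at x within {a..b})"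
      by (rule DERIV_cong[OF DERIV_add[OF bvpD(2)[OF D x] mv0_deriv[OF x]]])
        (simp add: algebra_simps)
  qed (auto simp: bvpD(3,4)[OF D] u0_ends)
  have p: "0 < inverse (m x)" if "x \<in> {a..b}" for x using m_pos[OF that] by simp
  have c: "continuous_on {a..b} (\<lambda>x. inverse (m x))"
    using m_pos by (intro continuous_on_inverse cont) force
  show ?thesis using bvp_unique(1)[OF ab b x c cont(2) p n_pos] by simp
qed

text \<open>For the difference \<open>Z\<close> of two solutions, \<open>Z' / r\<close> and \<open>- Z\<close> solve the homogeneous boundary value
  problem with coefficients \<open>1 / (\<alpha> r)\<close> and \<open>r\<close>.\<close>

lemma pressure_unique:
  assumes r: "continuous_on {a..b} r" "\<And>x. x \<in> {a..b} \<Longrightarrow> r x > 0"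
    and S: "IGR_pressure a b \<alpha> r v S" and S': "IGR_pressure a b \<alpha> r v S'" and x: "x \<in> {a..b}"
  shows "S x = S' x"
proof -
  let ?P = "pd {a..b}"
  have C: "S differentiable_on {a..b}" "?P S differentiable_on {a..b}" if "IGR_pressure a b \<alpha> r v S" for S
    using that by (auto simp: IGR_pressure_def Ck_on_def numeral_2_eq_2 less_Suc_eq)
  note dS = has_field_derivative_pd[OF ab C(1)[OF S]] has_field_derivative_pd[OF ab C(1)[OF S']]
  note cS = differentiable_imp_continuous_on[OF C(1)[OF S]] differentiable_imp_continuous_on[OF C(1)[OF S']]
  note cP = differentiable_imp_continuous_on[OF C(2)[OF S]] differentiable_imp_continuous_on[OF C(2)[OF S']]
  define G where "G x = inverse (r x) * ?P S x - inverse (r x) * ?P S' x" for x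
  have ir: "continuous_on {a..b} (\<lambda>x. inverse (r x))"
    using r by (intro continuous_on_inverse) force+
  have b: "bvp a b (\<lambda>x. inverse (\<alpha> * r x)) r (\<lambda>_. 0) (\<lambda>_. 0) G (\<lambda>x. S' x - S x)"
    unfolding bvp_def
  proof (intro conjI ballI)
    fix x assume x: "x \<in> {a..b}"
    show "((\<lambda>x. S' x - S x) has_real_derivative 0 - r x * G x) (at x within {a..b})"
      by (rule DERIV_cong[OF DERIV_diff[OF dS(2)[OF x] dS(1)[OF x]]])
        (use r(2)[OF x] in \<open>simp add: G_def field_simps\<close>)
    have cont_rhs: "continuous_on {a..b} (\<lambda>x. 0 - inverse (\<alpha> * r x) * (S' x - S x))"
      unfolding inverse_mult_distrib by (intro continuous_intros ir cS)
    have cont_G: "continuous_on {a..b} G"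
      unfolding G_def[abs_def] by (intro continuous_intros ir cP)
    show "(G has_real_derivative 0 - inverse (\<alpha> * r x) * (S' x - S x)) (at x within {a..b})"
    proof (rule DERIV_extend_Icc[OF ab cont_G cont_rhs _ x])
      fix y assume y: "y \<in> {a<..<b}"
      obtain v1 q1 where 1: "(v has_real_derivative v1) (at y)"
        "((\<lambda>y. inverse (r y) * ?P S y) has_real_derivative q1) (at y)"
        "inverse (r y) * S y - \<alpha> * q1 = 2 * \<alpha> * v1\<^sup>2"
        using S y unfolding IGR_pressure_def by blast
      obtain v2 q2 where 2: "(v has_real_derivative v2) (at y)"
        "((\<lambda>y. inverse (r y) * ?P S' y) has_real_derivative q2) (at y)"
        "inverse (r y) * S' y - \<alpha> * q2 = 2 * \<alpha> * v2\<^sup>2"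
        using S' y unfolding IGR_pressure_def by blast
      have "v1 = v2" by (rule DERIV_unique[OF 1(1) 2(1)])
      then have "\<alpha> * (q1 - q2) = - (inverse (r y) * (S' y - S y))"
        using 1(3) 2(3) by (simp add: algebra_simps)
      also have "\<dots> = \<alpha> * (0 - inverse (\<alpha> * r y) * (S' y - S y))"
        using \<alpha> by simp
      finally have "q1 - q2 = 0 - inverse (\<alpha> * r y) * (S' y - S y)"
        using \<alpha> by (simp only: mult_left_cancel[OF less_imp_neq[OF \<alpha>, symmetric]])
      then show "(G has_real_derivative 0 - inverse (\<alpha> * r y) * (S' y - S y)) (at y)"
        using DERIV_diff[OF 1(2) 2(2)] unfolding G_def[abs_def] by simp
    qed
  qed (use S S' in \<open>auto simp: G_def IGR_pressure_def\<close>)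
  have "continuous_on {a..b} (\<lambda>x. inverse (\<alpha> * r x))"
    unfolding inverse_mult_distrib by (intro continuous_intros ir)
  from bvp_unique(2)[OF ab b x this r(1) _ r(2)] show ?thesis using r(2) \<alpha> by simp
qed

text \<open>All Eulerian quantities are Lagrangian ones composed with \<open>T t\<close>, the inverse of \<open>\<Phi> t\<close>:
  \<open>u = \<partial>\<^sub>t\<Phi>\<close>, \<open>\<rho> = q\<close> and the pressure is \<open>\<alpha> \<partial>\<^sub>t\<^sub>tq\<close>.  Differentiating the Euler--Lagrange equation, which
  is affine in time, twice gives \<open>\<alpha> (\<partial>\<^sub>t\<^sub>tq)' = - m \<partial>\<^sub>t\<^sub>t\<Phi>\<close>, the momentum equation.  The constitutive
  relation \<open>q = m / \<Phi>'\<close> differentiated twice is the elliptic equation for the pressure.\<close>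

theorem eulerian:
  assumes u: "\<And>t x. t \<ge> 0 \<Longrightarrow> x \<in> {a..b} \<Longrightarrow> u t x = pd {0..} (\<lambda>s. \<Phi> s (T t x)) t"
    and \<rho>: "\<And>t x. t \<ge> 0 \<Longrightarrow> x \<in> {a..b} \<Longrightarrow> \<rho> t x = q t (T t x)"
  shows "C0_curve {a..b} (k + 2) u" "C1_curve {a..b} (k + 1) u"
    "C0_curve {a..b} (k + 1) \<rho>" "C1_curve {a..b} k \<rho>"
    "\<And>t y. t \<ge> 0 \<Longrightarrow> y \<in> {a..b} \<Longrightarrow> (\<lambda>s. \<Phi> s y) differentiable (at t within {0..})"
    "\<exists>\<Sigma>. IGR_solution a b \<alpha> u0 m u \<rho> \<Sigma> \<and>
        (\<forall>t\<ge>0. \<forall>S. IGR_pressure a b \<alpha> (\<rho> t) (u t) S \<longrightarrow> (\<forall>x\<in>{a..b}. S x = \<Sigma> t x))"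
proof -
  obtain D E D2 E2 where j: "jcont a b D" "jcont a b E" "jcont a b D2" "jcont a b E2"
    and b1: "\<And>t. t \<ge> 0 \<Longrightarrow> bvp a b (\<beta> t) n (\<lambda>_. 0) g1 (D t) (E t)"
    and b2: "\<And>t. t \<ge> 0 \<Longrightarrow> bvp a b (\<beta> t) n (\<lambda>x. 2 * m x * (E t x)\<^sup>2 / (q t x) ^ 3) (\<lambda>_. 0) (D2 t) (E2 t)"
    and dt: "\<And>t x. t \<ge> 0 \<Longrightarrow> x \<in> {a..b} \<Longrightarrow> ((\<lambda>s. \<Phi> s x) has_real_derivative D t x) (slice t)"
      "\<And>t x. t \<ge> 0 \<Longrightarrow> x \<in> {a..b} \<Longrightarrow> ((\<lambda>s. q s x) has_real_derivative E t x) (slice t)"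
      "\<And>t x. t \<ge> 0 \<Longrightarrow> x \<in> {a..b} \<Longrightarrow> ((\<lambda>s. D s x) has_real_derivative D2 t x) (slice t)"
      "\<And>t x. t \<ge> 0 \<Longrightarrow> x \<in> {a..b} \<Longrightarrow> ((\<lambda>s. E s x) has_real_derivative E2 t x) (slice t)"
  proof (rule flow_time_derivatives, goal_cases)
    case (1 D E D2 E2)
    show ?case by (rule 1(1)) (fact 1)+
  qed
  show "(\<lambda>s. \<Phi> s y) differentiable (at t within {0..})" if "t \<ge> 0" "y \<in> {a..b}" for t y
    using dt(1)[OF that] real_differentiable_def by blast
  have i1: "k \<le> k + 1" "k + 1 \<le> k + 2" "k \<le> k + 2" by auto
  have q0: "q t x \<noteq> 0" if "t \<ge> 0" "x \<in> {a..b}" for t x using q_pos[OF that] by simp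
  \<comment> \<open>The coefficient \<open>\<beta>\<close> is one derivative better than \<open>g1\<close>, so \<open>bvp_regular\<close> applies with \<open>l = k\<close> to both
     time derivatives; \<open>E2\<close> gains one more derivative because its equation has no forcing.\<close>
  have iq: "Ck_family a b (k + 1) (\<lambda>t x. inverse (q t x))"
    by (rule Ck_family_inverse[OF flow_Ck(2) q0])
  have \<beta>: "Ck_family a b (Suc k) \<beta>"
    unfolding \<beta>_def[abs_def] using Ck_family_mult[OF Ck_family_mult[OF m_Ck iq] iq] by simp
  note D_Ck = bvp_regular[OF j(1,2) b1 \<beta> Ck_family_const Ck_family_mono[OF n_Ck i1(1)] g_Ck(2)]
  have "Ck_family a b (k + 1) (\<lambda>t x. 2 * m x * (E t x * E t x) * (inverse (q t x) * inverse (q t x) * inverse (q t x)))"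
    by (intro Ck_family_mult Ck_family_const m_Ck iq D_Ck)
  then have \<phi>: "Ck_family a b (Suc k) (\<lambda>t x. 2 * m x * (E t x)\<^sup>2 / (q t x) ^ 3)"
    by (simp add: divide_inverse power2_eq_square power3_eq_cube)
  note D2_Ck = bvp_regular[OF j(3,4) b2 \<beta> \<phi> Ck_family_mono[OF n_Ck i1(1)] Ck_family_const]
  have "Ck_family a b (k + 1) (\<lambda>t x. 0 - n x * D2 t x)"
    by (intro Ck_family_diff Ck_family_mult Ck_family_const n_Ck
        Ck_family_mono[OF D2_Ck(1) i1(2)])
  then have E2_Ck: "Ck_family a b (k + 2) E2"
    using Ck_family_SucI[OF j(4) bvpD(2)[OF b2]] by simp
  \<comment> \<open>\<open>y t x\<close> is the label of the particle that is at \<open>x\<close> at time \<open>t\<close>.  The derivatives below are what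
     the chain rule gives with \<open>\<partial>\<^sub>xy = q / m\<close> and \<open>\<partial>\<^sub>ty = - D q / m\<close>.\<close>
  define y where "y t x = T t x" for t x
  have y: "y t x \<in> {a..b}" if "t \<ge> 0" "x \<in> {a..b}" for t x
    unfolding y_def by (rule T_range[OF that])
  have my: "m (y t x) > 0" and qy: "q t (y t x) > 0" if "t \<ge> 0" "x \<in> {a..b}" for t x
    using m_pos[OF y[OF that]] q_pos[OF that(1) y[OF that]] by auto
  have comp: "Ck_family a b l (\<lambda>t x. U t (y t x))" if "Ck_family a b l U" "l \<le> k + 2" for U l
    unfolding y_def by (rule Ck_family_compose[OF that(1) Ck_family_mono[OF T_Ck that(2)] T_range])
  have u_eq: "u t x = D t (y t x)" if "t \<ge> 0" "x \<in> {a..b}" for t x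
  proof -
    have "at t within {0..} \<noteq> bot"
      using slice_sequence[OF that(1)] by (auto simp: filterlim_def bot_unique filtermap_bot_iff)
    then show ?thesis
      using u[OF that] vector_derivative_within[of t "{0..}" "\<lambda>s. \<Phi> s (T t x)" "D t (T t x)"]
        dt(1)[OF that(1) T_range[OF that]]
      by (simp add: pd_def y_def has_real_derivative_iff_has_vector_derivative)
  qed
  define ux where "ux t x = - E t (y t x) / q t (y t x)" for t x
  define \<rho>x where "\<rho>x t x = (g0 (y t x) + t * g1 (y t x) - n (y t x) * \<Phi> t (y t x)) * (q t (y t x) / m (y t x))" for t x
  define ut where "ut t x = D2 t (y t x) - ux t x * D t (y t x)" for t x
  define \<rho>t where "\<rho>t t x = E t (y t x) - \<rho>x t x * D t (y t x)" for t x
  have y_x: "((\<lambda>x. y t x) has_real_derivative q t (y t x) / m (y t x)) (at x within {a..b})"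
    if "t \<ge> 0" "x \<in> {a..b}" for t x
    unfolding y_def by (rule T_x_deriv[OF that])
  have y_t: "((\<lambda>s. y s x) has_real_derivative - D t (y t x) * q t (y t x) / m (y t x)) (slice t)"
    if "t \<ge> 0" "x \<in> {a..b}" for t x
    unfolding y_def by (rule T_t_deriv[OF that dt(1)[OF that(1) T_range[OF that]]])
  have u_x': "((\<lambda>x. D t (y t x)) has_real_derivative ux t x) (at x within {a..b})"
    if tx: "t \<ge> 0" "x \<in> {a..b}" for t x
    by (rule DERIV_cong[OF DERIV_chain_Icc[OF bvpD(1)[OF b1[OF tx(1)] y[OF tx]] y_x[OF tx] y[OF tx(1)]]])
      (use my[OF tx] qy[OF tx] in \<open>simp_all add: ux_def \<beta>_def field_simps\<close>)
  have \<rho>_x': "((\<lambda>x. q t (y t x)) has_real_derivative \<rho>x t x) (at x within {a..b})"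
    if tx: "t \<ge> 0" "x \<in> {a..b}" for t x
    unfolding \<rho>x_def
    by (rule DERIV_chain_Icc[OF q_deriv[OF tx(1) y[OF tx]] y_x[OF tx] y[OF tx(1)]])
  have D2_x: "((\<lambda>x. D2 t (y t x)) has_real_derivative
      2 * (ux t x)\<^sup>2 - E2 t (y t x) / q t (y t x)) (at x within {a..b})"
    if tx: "t \<ge> 0" "x \<in> {a..b}" for t x
    by (rule DERIV_cong[OF DERIV_chain_Icc[OF bvpD(1)[OF b2[OF tx(1)] y[OF tx]] y_x[OF tx] y[OF tx(1)]]])
      (use my[OF tx] qy[OF tx] in \<open>simp_all add: ux_def \<beta>_def field_simps power2_eq_square power3_eq_cube\<close>)
  have u_t': "((\<lambda>s. D s (y s x)) has_real_derivative ut t x) (slice t)" if tx: "t \<ge> 0" "x \<in> {a..b}" for t x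
  proof -
    have c: "continuous_on ({0..} \<times> {a..b}) (\<lambda>p. 0 - \<beta> (fst p) (snd p) * E (fst p) (snd p))"
      by (intro continuous_intros jcontD[OF j(2)] jcontD[OF Ck_family_jcont[OF \<beta>]])
    have "((\<lambda>s. D s (y s x)) has_real_derivative D2 t (y t x) + (0 - \<beta> t (y t x) * E t (y t x)) *
        (- D t (y t x) * q t (y t x) / m (y t x))) (slice t)"
      by (rule chain_DERIV[where f = D and f' = "\<lambda>t x. 0 - \<beta> t x * E t x" and T = "\<lambda>s. y s x",
            OF bvpD(1)[OF b1] c _ y y_t[OF tx] dt(3)[OF tx(1) y[OF tx]]])
        (use tx in auto)
    then show ?thesis
      by (rule DERIV_cong) (use my[OF tx] qy[OF tx] in \<open>simp add: ut_def ux_def \<beta>_def field_simps\<close>)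
  qed
  have \<rho>_t': "((\<lambda>s. q s (y s x)) has_real_derivative \<rho>t t x) (slice t)" if tx: "t \<ge> 0" "x \<in> {a..b}" for t x
  proof -
    have c: "continuous_on ({0..} \<times> {a..b})
        (\<lambda>p. g0 (snd p) + fst p * g1 (snd p) - n (snd p) * \<Phi> (fst p) (snd p))"
      by (intro continuous_intros jcontD[OF flow_jcont(1)] jcontD[OF jcont_space] cont)
    have "((\<lambda>s. q s (y s x)) has_real_derivative E t (y t x) +
        (g0 (y t x) + t * g1 (y t x) - n (y t x) * \<Phi> t (y t x)) * (- D t (y t x) * q t (y t x) / m (y t x))) (slice t)"
      by (rule chain_DERIV[where f = q and f' = "\<lambda>t x. g0 x + t * g1 x - n x * \<Phi> t x" and T = "\<lambda>s. y s x",
            OF q_deriv c _ y y_t[OF tx] dt(2)[OF tx(1) y[OF tx]]])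
        (use tx in auto)
    then show ?thesis
      by (rule DERIV_cong) (simp add: \<rho>t_def \<rho>x_def)
  qed
  \<comment> \<open>The transport terms \<open>ux * D\<close> and \<open>\<rho>x * D\<close> are what costs one space derivative.\<close>
  have u_Ck: "Ck_family a b (k + 2) u"
    by (rule Ck_family_cong[OF u_eq[symmetric] comp[OF D_Ck(1) order_refl]])
  have \<rho>_eq: "\<rho> t x = q t (y t x)" if "t \<ge> 0" "x \<in> {a..b}" for t x
    unfolding y_def by (rule \<rho>[OF that])
  have \<rho>_Ck: "Ck_family a b (k + 1) \<rho>"
    by (rule Ck_family_cong[OF \<rho>_eq[symmetric] comp[OF flow_Ck(2) i1(2)]])
  have u_x: "(u t has_real_derivative ux t x) (at x within {a..b})" if tx: "t \<ge> 0" "x \<in> {a..b}" for t x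
    by (rule DERIV_cong_within_Icc[OF u_eq[OF tx(1), symmetric] tx(2) u_x'[OF tx]])
  have \<rho>_x: "(\<rho> t has_real_derivative \<rho>x t x) (at x within {a..b})" if tx: "t \<ge> 0" "x \<in> {a..b}" for t x
    by (rule DERIV_cong_within_Icc[OF \<rho>_eq[OF tx(1), symmetric] tx(2) \<rho>_x'[OF tx]])
  have u_t: "((\<lambda>s. u s x) has_real_derivative ut t x) (slice t)" if tx: "t \<ge> 0" "x \<in> {a..b}" for t x
    by (rule DERIV_cong_within_Icc[OF u_eq[OF _ tx(2), symmetric] _ u_t'[OF tx]]) (use tx in auto)
  have \<rho>_t: "((\<lambda>s. \<rho> s x) has_real_derivative \<rho>t t x) (slice t)" if tx: "t \<ge> 0" "x \<in> {a..b}" for t x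
    by (rule DERIV_cong_within_Icc[OF \<rho>_eq[OF _ tx(2), symmetric] _ \<rho>_t'[OF tx]]) (use tx in auto)
  have ux_Ck: "Ck_family a b (k + 1) ux"
    using Ck_family_deriv[OF ab _ u_x, of "k + 1"] u_Ck by simp
  have \<rho>x_Ck: "Ck_family a b k \<rho>x"
    using Ck_family_deriv[OF ab _ \<rho>_x, of k] \<rho>_Ck by simp
  have D_comp: "Ck_family a b (k + 2) (\<lambda>t x. D t (y t x))" by (rule comp[OF D_Ck(1) order_refl])
  have ut_Ck: "Ck_family a b (k + 1) ut"
    unfolding ut_def[abs_def]
    by (intro Ck_family_diff Ck_family_mult ux_Ck Ck_family_mono[OF D_comp i1(2)]
        Ck_family_mono[OF comp[OF D2_Ck(1) order_refl] i1(2)])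
  have \<rho>t_Ck: "Ck_family a b k \<rho>t"
    unfolding \<rho>t_def[abs_def]
    by (intro Ck_family_diff Ck_family_mult \<rho>x_Ck Ck_family_mono[OF D_comp i1(3)]
        Ck_family_mono[OF comp[OF D_Ck(2) i1(2)] i1(1)])
  show "C0_curve {a..b} (k + 2) u" by (rule Ck_family_imp_C0_curve[OF ab u_Ck])
  show "C1_curve {a..b} (k + 1) u"
    by (rule Ck_family_imp_C1_curve[OF ab Ck_family_mono[OF u_Ck i1(2)] ut_Ck u_t])
  show "C0_curve {a..b} (k + 1) \<rho>" by (rule Ck_family_imp_C0_curve[OF ab \<rho>_Ck])
  show "C1_curve {a..b} k \<rho>"
    by (rule Ck_family_imp_C1_curve[OF ab Ck_family_mono[OF \<rho>_Ck i1(1)] \<rho>t_Ck \<rho>_t])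
  define \<Sigma> where "\<Sigma> t x = \<alpha> * E2 t (y t x)" for t x
  have \<Sigma>_Ck: "Ck_family a b (k + 2) \<Sigma>"
    unfolding \<Sigma>_def[abs_def] by (intro Ck_family_mult Ck_family_const comp[OF E2_Ck order_refl])
  have \<Sigma>_x: "(\<Sigma> t has_real_derivative - q t (y t x) * D2 t (y t x)) (at x within {a..b})"
    if tx: "t \<ge> 0" "x \<in> {a..b}" for t x
    unfolding \<Sigma>_def
    by (rule DERIV_cong[OF DERIV_cmult[OF
            DERIV_chain_Icc[OF bvpD(2)[OF b2[OF tx(1)] y[OF tx]] y_x[OF tx] y[OF tx(1)]]]])
      (use my[OF tx] \<alpha> in \<open>simp_all add: n_eq field_simps\<close>)
  have inner: "(f has_real_derivative f') (at x)"
    if "(f has_real_derivative f') (at x within {a..b})" "x \<in> {a<..<b}" for f f' x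
    using that by (simp add: at_within_Icc_at)
  have pressure: "IGR_pressure a b \<alpha> (\<rho> t) (u t) (\<Sigma> t)" if t: "t \<ge> 0" for t
    unfolding IGR_pressure_def
  proof (intro conjI ballI)
    show "Ck_on {a..b} 2 (\<Sigma> t)"
      by (rule Ck_family_imp_Ck_on[OF ab Ck_family_mono[OF \<Sigma>_Ck] t]) simp
    show "pd {a..b} (\<Sigma> t) a = 0" "pd {a..b} (\<Sigma> t) b = 0"
      using pd_eqI[OF ab ends(1) \<Sigma>_x[OF t ends(1)]] pd_eqI[OF ab ends(2) \<Sigma>_x[OF t ends(2)]]
        bvpD(3,4)[OF b2[OF t]] T_ends[OF t] by (simp_all add: y_def)
    fix x assume x: "x \<in> {a<..<b}"
    then have xi: "x \<in> {a..b}" by auto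
    have h1: "((\<lambda>z. - D2 t (y t z)) has_real_derivative
        - (2 * (ux t x)\<^sup>2 - E2 t (y t x) / q t (y t x))) (at x within {a..b})"
      by (rule DERIV_minus[OF D2_x[OF t xi]])
    have h2: "- D2 t (y t z) = inverse (\<rho> t z) * pd {a..b} (\<Sigma> t) z" if z: "z \<in> {a..b}" for z
      using qy[OF t z] by (simp add: \<rho>_eq[OF t z] pd_eqI[OF ab z \<Sigma>_x[OF t z]])
    have "((\<lambda>z. inverse (\<rho> t z) * pd {a..b} (\<Sigma> t) z) has_real_derivative
        - (2 * (ux t x)\<^sup>2 - E2 t (y t x) / q t (y t x))) (at x within {a..b})"
      by (rule DERIV_cong_within_Icc[OF h2 xi h1])
    moreover have "inverse (\<rho> t x) * \<Sigma> t x - \<alpha> * - (2 * (ux t x)\<^sup>2 - E2 t (y t x) / q t (y t x))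
        = 2 * \<alpha> * (ux t x)\<^sup>2"
      by (simp add: \<rho>_eq[OF t xi] \<Sigma>_def divide_inverse algebra_simps)
    ultimately show "\<exists>v' q. (u t has_real_derivative v') (at x) \<and>
        ((\<lambda>y. inverse (\<rho> t y) * pd {a..b} (\<Sigma> t) y) has_real_derivative q) (at x) \<and>
        inverse (\<rho> t x) * \<Sigma> t x - \<alpha> * q = 2 * \<alpha> * v'\<^sup>2"
      using inner[OF u_x[OF t xi] x] inner x by blast
  qed
  have continuity: "\<rho>t t x + (\<rho>x t x * u t x + ux t x * \<rho> t x) = 0" if tx: "t \<ge> 0" "x \<in> {a..b}" for t x
    using qy[OF tx] by (simp add: \<rho>t_def ux_def u_eq[OF tx] \<rho>_eq[OF tx])
  have "IGR_solution a b \<alpha> u0 m u \<rho> \<Sigma>"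
    unfolding IGR_solution_def
  proof (intro conjI allI impI ballI)
    fix t :: real assume t: "t \<ge> 0"
    show "IGR_pressure a b \<alpha> (\<rho> t) (u t) (\<Sigma> t)" by (rule pressure[OF t])
    show "u t a = 0" "u t b = 0"
      using bvpD(3,4)[OF b1[OF t]] T_ends[OF t] u_eq[OF t ends(1)] u_eq[OF t ends(2)]
      by (simp_all add: y_def)
    fix x assume x: "x \<in> {a<..<b}"
    then have xi: "x \<in> {a..b}" by auto
    note d = u_x[OF t xi] \<rho>_x[OF t xi] u_t[OF t xi] \<rho>_t[OF t xi] \<Sigma>_x[OF t xi]
    have "((\<lambda>y. \<rho> t y * u t y) has_real_derivative \<rho>x t x * u t x + ux t x * \<rho> t x) (at x)"
      by (rule inner[OF DERIV_mult[OF d(2,1)] x])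
    then show "\<exists>p q. ((\<lambda>s. \<rho> s x) has_real_derivative p) (at t within {0..}) \<and>
               ((\<lambda>y. \<rho> t y * u t y) has_real_derivative q) (at x) \<and> p + q = 0"
      using d(4) continuity[OF t xi] by blast
    have 1: "((\<lambda>s. \<rho> s x * u s x) has_real_derivative \<rho>t t x * u t x + ut t x * \<rho> t x) (slice t)"
      by (rule DERIV_mult[OF d(4,3)])
    have 2: "((\<lambda>y. \<rho> t y * (u t y * u t y) + \<Sigma> t y) has_real_derivative
        (\<rho>x t x * (u t x * u t x) + (ux t x * u t x + ux t x * u t x) * \<rho> t x)
        + - q t (y t x) * D2 t (y t x)) (at x)"
      by (rule inner[OF DERIV_add[OF DERIV_mult[OF d(2) DERIV_mult[OF d(1) d(1)]] d(5)] x])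
    have "\<rho>t t x * u t x + ut t x * \<rho> t x + ((\<rho>x t x * (u t x * u t x) + (ux t x * u t x + ux t x * u t x) * \<rho> t x)
        + - q t (y t x) * D2 t (y t x))
      = u t x * (\<rho>t t x + (\<rho>x t x * u t x + ux t x * \<rho> t x))"
      by (simp add: ut_def u_eq[OF t xi] \<rho>_eq[OF t xi] algebra_simps)
    also have "\<dots> = 0" using continuity[OF t xi] by simp
    finally show "\<exists>p q. ((\<lambda>s. \<rho> s x * u s x) has_real_derivative p) (at t within {0..}) \<and>
               ((\<lambda>y. \<rho> t y * (u t y)\<^sup>2 + \<Sigma> t y) has_real_derivative q) (at x) \<and> p + q = 0"
      using 1 2 unfolding power2_eq_square by blast
  next
    fix x assume x: "x \<in> {a..b}"
    have i: "inj_on (\<Phi> 0) {a..b}" using \<Phi>_bij[OF order_refl] by (simp add: bij_betw_def)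
    have "T 0 x = x"
      using the_inv_into_f_f[OF i x] initial_flow(1)[OF x] by (simp add: T_def)
    then show "u 0 x = u0 x" "\<rho> 0 x = m x"
      using u_eq[OF order_refl x] \<rho>_eq[OF order_refl x] initial_flow(2)[OF x]
        initial_velocity[OF b1[OF order_refl] x] by (simp_all add: y_def)
  qed
  moreover have "S x = \<Sigma> t x" if t: "t \<ge> 0" and S: "IGR_pressure a b \<alpha> (\<rho> t) (u t) S" and x: "x \<in> {a..b}"
    for t S x
    by (rule pressure_unique[OF jcont_slice[OF Ck_family_jcont[OF \<rho>_Ck] t] _ S pressure[OF t] x])
      (use qy[OF t] \<rho>_eq[OF t] in simp)
  ultimately show "\<exists>\<Sigma>. IGR_solution a b \<alpha> u0 m u \<rho> \<Sigma> \<and>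
        (\<forall>t\<ge>0. \<forall>S. IGR_pressure a b \<alpha> (\<rho> t) (u t) S \<longrightarrow> (\<forall>x\<in>{a..b}. S x = \<Sigma> t x))"
    by blast
qed

end

section \<open>Entropy of measures with a density\<close>

lemma mult_ln_ge_minus_one: "- 1 \<le> x * ln x" if "x \<ge> 0" for x :: real
proof (cases "x = 0")
  case False
  then have x: "x > 0" using that by simp
  have "ln (1 / x) \<le> 1 / x - 1" by (rule ln_le_minus_one) (use x in simp)
  then have "x * ln (1 / x) \<le> x * (1 / x - 1)" using x by (intro mult_left_mono) auto
  then show ?thesis using x by (simp add: ln_div algebra_simps)
qed simp

lemma Ent_density:
  fixes r :: "real \<Rightarrow> real"
  assumes [measurable]: "r \<in> borel_measurable borel" and r: "\<And>x. 0 \<le> r x"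
    and int: "integrable lborel (\<lambda>x. r x * ln (r x))"
  shows "Ent (density lborel (\<lambda>x. ennreal (r x))) = ereal (\<integral>x. r x * ln (r x) \<partial>lborel)"
proof -
  let ?N = "density lborel (\<lambda>x. ennreal (r x))"
  have ac: "absolutely_continuous lborel ?N"
    by (intro absolutely_continuousI_density) measurable
  have "AE x in lborel. ennreal (r x) = RN_deriv lborel ?N x"
    by (rule sigma_finite_measure.RN_deriv_unique[OF sigma_finite_lborel]) auto
  then have ae: "AE x in lborel. enn2real (RN_deriv lborel ?N x) = r x"
    by eventually_elim (metis enn2real_ennreal r)
  have 1: "(\<integral>\<^sup>+x. ennreal (enn2real (RN_deriv lborel ?N x) * ln (enn2real (RN_deriv lborel ?N x))) \<partial>lborel)
      = (\<integral>\<^sup>+x. ennreal (r x * ln (r x)) \<partial>lborel)"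
    by (rule nn_integral_cong_AE) (use ae in \<open>eventually_elim, simp\<close>)
  have 2: "(\<integral>\<^sup>+x. ennreal (- (enn2real (RN_deriv lborel ?N x) * ln (enn2real (RN_deriv lborel ?N x)))) \<partial>lborel)
      = (\<integral>\<^sup>+x. ennreal (- (r x * ln (r x))) \<partial>lborel)"
    by (rule nn_integral_cong_AE) (use ae in \<open>eventually_elim, simp\<close>)
  obtain p n where pn: "0 \<le> p" "0 \<le> n" "(\<integral>\<^sup>+x. ennreal (r x * ln (r x)) \<partial>lborel) = ennreal p"
    "(\<integral>\<^sup>+x. ennreal (- (r x * ln (r x))) \<partial>lborel) = ennreal n"
    "(\<lambda>x. r x * ln (r x)) \<in> borel_measurable lborel"
    "(\<integral>x. r x * ln (r x) \<partial>lborel) = p - n"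
    by (rule integrableE[OF int])
  show ?thesis
    using ac pn by (simp add: Ent_def Let_def 1 2 enn2ereal_ennreal)
qed

text \<open>On a bounded interval the negative part of \<open>r ln r\<close> is integrable, since \<open>r ln r \<ge> -1\<close>; so a
  finite entropy controls the positive part too.\<close>

lemma Ent_finite_density:
  assumes ab: "a < b" and fin: "finite_measure \<nu>" and sets[measurable_cong]: "sets \<nu> = sets borel"
    and supp: "emeasure \<nu> (- {a..b}) = 0" and Ent: "Ent \<nu> < \<infinity>"
  obtains r where "r \<in> borel_measurable borel" "\<And>x. 0 \<le> r x" "\<And>x. x \<notin> {a..b} \<Longrightarrow> r x = 0"
    "\<nu> = density lborel (\<lambda>x. ennreal (r x))" "integrable lborel (\<lambda>x. r x * ln (r x))"
proof -
  interpret \<nu>: finite_measure \<nu> by (rule fin)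
  have ac: "absolutely_continuous lborel \<nu>"
    using Ent by (auto simp: Ent_def split: if_splits)
  have dens: "density lborel (RN_deriv lborel \<nu>) = \<nu>"
    by (rule sigma_finite_measure.density_RN_deriv[OF sigma_finite_lborel ac]) (simp add: sets)
  have fin_ae: "AE x in lborel. RN_deriv lborel \<nu> x \<noteq> \<infinity>"
    by (rule sigma_finite_measure.RN_deriv_finite[OF sigma_finite_lborel \<nu>.sigma_finite_measure_axioms ac]) (simp add: sets)
  have "emeasure (density lborel (RN_deriv lborel \<nu>)) (- {a..b}) = 0" using supp dens by simp
  then have "(\<integral>\<^sup>+x. RN_deriv lborel \<nu> x * indicator (- {a..b}) x \<partial>lborel) = 0"
    by (subst (asm) emeasure_density) auto
  then have out: "AE x in lborel. RN_deriv lborel \<nu> x * indicator (- {a..b}) x = 0"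
    by (subst (asm) nn_integral_0_iff_AE) auto
  define r where "r x = indicator {a..b} x * enn2real (RN_deriv lborel \<nu> x)" for x
  have [measurable]: "r \<in> borel_measurable borel" unfolding r_def[abs_def] by measurable
  have r0: "0 \<le> r x" for x by (simp add: r_def)
  have ae: "AE x in lborel. ennreal (r x) = RN_deriv lborel \<nu> x"
    using fin_ae out
    by eventually_elim (auto simp: r_def indicator_def less_top split: if_splits)
  have \<nu>: "\<nu> = density lborel (\<lambda>x. ennreal (r x))"
    using density_cong[OF _ _ ae] dens by simp
  have ae': "AE x in lborel. enn2real (RN_deriv lborel \<nu> x) = r x"
    using ae by eventually_elim (metis enn2real_ennreal r0)
  define P where "P = (\<integral>\<^sup>+x. ennreal (r x * ln (r x)) \<partial>lborel)"
  define N where "N = (\<integral>\<^sup>+x. ennreal (- (r x * ln (r x))) \<partial>lborel)"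
  have 1: "(\<integral>\<^sup>+x. ennreal (enn2real (RN_deriv lborel \<nu> x) * ln (enn2real (RN_deriv lborel \<nu> x))) \<partial>lborel) = P"
    unfolding P_def by (rule nn_integral_cong_AE) (use ae' in \<open>eventually_elim, simp\<close>)
  have 2: "(\<integral>\<^sup>+x. ennreal (- (enn2real (RN_deriv lborel \<nu> x) * ln (enn2real (RN_deriv lborel \<nu> x)))) \<partial>lborel) = N"
    unfolding N_def by (rule nn_integral_cong_AE) (use ae' in \<open>eventually_elim, simp\<close>)
  have "N \<le> (\<integral>\<^sup>+x. indicator {a..b} x \<partial>lborel)"
    unfolding N_def
  proof (rule nn_integral_mono)
    fix x
    show "ennreal (- (r x * ln (r x))) \<le> indicator {a..b} x"
      using mult_ln_ge_minus_one[OF r0[of x]] ennreal_leI[of "- (r x * ln (r x))" 1]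
      by (cases "x \<in> {a..b}") (auto simp: r_def)
  qed
  also have "\<dots> = ennreal (b - a)" using ab by simp
  finally have N: "N < \<infinity>" by (simp add: le_less_trans)
  have "enn2ereal P - enn2ereal N < \<infinity>"
    using Ent ac by (simp add: Ent_def Let_def 1 2)
  then have P: "P < \<infinity>" using N by (cases P; cases N) (auto simp: enn2ereal_ennreal)
  have int: "integrable lborel (\<lambda>x. r x * ln (r x))"
    unfolding real_integrable_def using P N by (auto simp: P_def N_def)
  show ?thesis by (rule that[OF _ r0 _ \<nu> int]) (simp_all add: r_def)
qed

text \<open>Entropy under a diffeomorphism \<open>g\<close> of \<open>[a,b]\<close>: the density becomes \<open>(r / g') \<circ> g\<^sup>-\<^sup>1\<close>, so the
  entropy drops by \<open>\<integral> ln g' d\<nu>\<close>.\<close>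

lemma Ent_distr_diffeo:
  fixes r g g' :: "real \<Rightarrow> real"
  assumes ab: "a < b" and [measurable]: "r \<in> borel_measurable borel" and r: "\<And>x. 0 \<le> r x"
    and supp: "\<And>x. x \<notin> {a..b} \<Longrightarrow> r x = 0"
    and int: "integrable lborel (\<lambda>x. r x * ln (r x))" "integrable lborel r"
    and g[measurable]: "g \<in> borel_measurable borel"
    and dg: "\<And>x. x \<in> {a..b} \<Longrightarrow> (g has_real_derivative g' x) (at x)"
    and cg': "continuous_on {a..b} g'" and pos: "\<And>x. x \<in> {a..b} \<Longrightarrow> 0 < g' x"
    and ends: "g a = a" "g b = b"
  shows "Ent (distr (density lborel (\<lambda>x. ennreal (r x))) lborel g) =
     ereal ((\<integral>x. r x * ln (r x) \<partial>lborel) - (\<integral>x. r x * ln (g' x) \<partial>lborel))"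
    and "integrable lborel (\<lambda>x. r x * ln (g' x))"
proof -
  let ?\<nu> = "density lborel (\<lambda>x. ennreal (r x))"
  have dg': "(g has_real_derivative g' x) (at x within {a..b})" if "x \<in> {a..b}" for x
    by (rule has_field_derivative_at_within[OF dg[OF that]])
  have less: "g x < g y" if xy: "x \<in> {a..b}" "y \<in> {a..b}" "x < y" for x y
  proof -
    obtain z where z: "z \<in> {a..b}" "g y - g x = g' z * (y - x)" by (rule MVT_Icc[OF dg' xy(1,2)])
    have "0 < g' z * (y - x)" using pos[OF z(1)] xy by simp
    then show ?thesis using z(2) by simp
  qed
  have cg: "continuous_on {a..b} g" by (rule DERIV_continuous_on[OF dg'])
  have inj: "inj_on g {a..b}" by (rule linorder_inj_onI') (use less in fastforce)
  have le: "g x \<le> g y" if "x \<in> {a..b}" "y \<in> {a..b}" "x \<le> y" for x y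
    using less[OF that(1,2)] that(3) by (cases "x = y") auto
  have range: "g x \<in> {a..b}" if "x \<in> {a..b}" for x
    using le[of a x] le[of x b] that ends ab by auto
  have im: "g ` {a..b} = {a..b}"
  proof (intro equalityI subsetI)
    fix y assume "y \<in> {a..b}"
    then show "y \<in> g ` {a..b}" using IVT'[of g a y b] cg ends ab by fastforce
  qed (use range in auto)
  define h where "h z = (if z \<in> {a..b} then the_inv_into {a..b} g z else a)" for z
  define G where "G z = (if z \<in> {a..b} then g' z else 1)" for z
  have hg: "h (g x) = x" if "x \<in> {a..b}" for x
    using the_inv_into_f_f[OF inj that] range[OF that] by (simp add: h_def)
  have "continuous_on (g ` {a..b}) (the_inv_into {a..b} g)"
    by (rule continuous_on_inv[OF cg compact_Icc]) (simp add: the_inv_into_f_f[OF inj])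
  then have [measurable]: "h \<in> borel_measurable borel"
    unfolding h_def[abs_def] im by (intro borel_measurable_continuous_on_if) auto
  have [measurable]: "G \<in> borel_measurable borel"
    unfolding G_def[abs_def] by (intro borel_measurable_continuous_on_if cg') auto
  have G0: "G x > 0" for x using pos by (simp add: G_def)
  define s where "s z = indicator {a..b} z * (r (h z) / G (h z))" for z
  have [measurable]: "s \<in> borel_measurable borel" unfolding s_def[abs_def] by measurable
  have s0: "0 \<le> s z" for z using r G0 by (simp add: s_def less_imp_le)
  have sg: "s (g x) = r x / g' x" if "x \<in> {a..b}" for x
    using hg[OF that] range[OF that] that by (simp add: s_def G_def)
  have distr: "distr ?\<nu> lborel g = density lborel (\<lambda>x. ennreal (s x))"
  proof (rule measure_eqI)
    fix A assume "A \<in> sets (distr ?\<nu> lborel g)"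
    then have A[measurable]: "A \<in> sets borel" by simp
    have "emeasure (distr ?\<nu> lborel g) A = (\<integral>\<^sup>+x. ennreal (r x) * indicator (g -` A) x \<partial>lborel)"
      by (subst emeasure_distr, simp, simp, subst emeasure_density)
        (auto simp: measurable_sets_borel[OF g A])
    also have "\<dots> = (\<integral>\<^sup>+x. ennreal ((s (g x) * indicator A (g x)) * g' x * indicator {a..b} x) \<partial>lborel)"
    proof (rule nn_integral_cong)
      fix x
      show "ennreal (r x) * indicator (g -` A) x =
          ennreal ((s (g x) * indicator A (g x)) * g' x * indicator {a..b} x)"
      proof (cases "x \<in> {a..b}")
        case True
        then show ?thesis using sg[OF True] pos[OF True] by (simp add: indicator_def)
      next
        case False
        then show ?thesis using supp[OF False] by simp
      qed
    qed
    also have "\<dots> = (\<integral>\<^sup>+z. ennreal (s z * indicator A z * indicator {g a..g b} z) \<partial>lborel)"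
      by (rule nn_integral_substitution[symmetric])
        (use dg cg' pos ab in \<open>auto simp: less_imp_le set_borel_measurable_def\<close>)
    also have "\<dots> = (\<integral>\<^sup>+z. ennreal (s z) * indicator A z \<partial>lborel)"
      by (rule nn_integral_cong) (auto simp: s_def ends indicator_def)
    also have "\<dots> = emeasure (density lborel (\<lambda>x. ennreal (s x))) A"
      by (subst emeasure_density) auto
    finally show "emeasure (distr ?\<nu> lborel g) A = emeasure (density lborel (\<lambda>x. ennreal (s x))) A" .
  qed simp
  define L where "L x = indicator {a..b} x * ln (g' x)" for x
  have [measurable]: "L \<in> borel_measurable borel"
  proof -
    have "continuous_on {a..b} (\<lambda>x. ln (g' x))"
      using pos by (intro continuous_on_ln cg') force
    then show ?thesis unfolding L_def[abs_def]
      using borel_measurable_continuous_on_indicator[of "{a..b}" "\<lambda>x. ln (g' x)"] by simp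
  qed
  have cl: "continuous_on {a..b} (\<lambda>x. ln (g' x))" using pos by (intro continuous_on_ln cg') force
  obtain B where B: "B > 0" "\<And>x. x \<in> {a..b} \<Longrightarrow> \<bar>ln (g' x)\<bar> \<le> B"
    using continuous_on_Icc_bounded[OF cl] by blast
  have iL: "integrable lborel (\<lambda>x. r x * L x)"
  proof (rule Bochner_Integration.integrable_bound[of _ "\<lambda>x. B * r x"])
    show "AE x in lborel. norm (r x * L x) \<le> norm (B * r x)"
    proof (rule AE_I2)
      fix x
      have "\<bar>L x\<bar> \<le> B" using B by (auto simp: L_def indicator_def)
      then have "\<bar>r x\<bar> * \<bar>L x\<bar> \<le> \<bar>r x\<bar> * B" by (rule mult_left_mono) simp
      then show "norm (r x * L x) \<le> norm (B * r x)" using B(1) by (simp add: abs_mult mult.commute)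
    qed
  qed (use int in auto)
  have rL: "(\<lambda>x. r x * L x) = (\<lambda>x. r x * ln (g' x))"
    using supp by (auto simp: L_def indicator_def fun_eq_iff)
  show iG: "integrable lborel (\<lambda>x. r x * ln (g' x))" using iL by (simp add: rL)
  have eq: "(\<lambda>x. r x * ln (s (g x))) = (\<lambda>x. r x * ln (r x) - r x * ln (g' x))"
  proof
    fix x
    consider "r x = 0" | "r x > 0" "x \<in> {a..b}" using r[of x] supp[of x] by force
    then show "r x * ln (s (g x)) = r x * ln (r x) - r x * ln (g' x)"
    proof cases
      case 2
      then show ?thesis using sg[OF 2(2)] pos[OF 2(2)] by (simp add: ln_div algebra_simps)
    qed simp
  qed
  have "integrable lborel (\<lambda>x. r x * ln (s (g x)))" unfolding eq using int(1) iG by auto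
  then have i\<nu>: "integrable ?\<nu> (\<lambda>x. ln (s (g x)))"
    by (subst integrable_density) (use r in auto)
  then have "integrable (distr ?\<nu> lborel g) (\<lambda>z. ln (s z))"
    by (subst integrable_distr_eq) auto
  then have int_s: "integrable lborel (\<lambda>z. s z * ln (s z))"
    unfolding distr by (subst (asm) integrable_density) (use s0 in auto)
  have "(\<integral>z. s z * ln (s z) \<partial>lborel) = (\<integral>z. ln (s z) \<partial>distr ?\<nu> lborel g)"
    unfolding distr by (subst integral_density) (use s0 in auto)
  also have "\<dots> = (\<integral>x. ln (s (g x)) \<partial>?\<nu>)" by (rule integral_distr) auto
  also have "\<dots> = (\<integral>x. r x * ln (s (g x)) \<partial>lborel)" by (subst integral_density) (use r in auto)
  also have "\<dots> = (\<integral>x. r x * ln (r x) \<partial>lborel) - (\<integral>x. r x * ln (g' x) \<partial>lborel)"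
    unfolding eq using int(1) iG by simp
  finally show "Ent (distr ?\<nu> lborel g) =
     ereal ((\<integral>x. r x * ln (r x) \<partial>lborel) - (\<integral>x. r x * ln (g' x) \<partial>lborel))"
    unfolding distr by (simp add: Ent_density[OF _ s0 int_s])
qed

section \<open>First variation along outer diffeomorphisms\<close>

locale transport_problem =
  fixes a b \<alpha> :: real and m :: "real \<Rightarrow> real" and \<mu> :: "real measure"
  assumes ab: "a < b" and \<alpha>: "\<alpha> > 0"
    and m_cont: "continuous_on {a..b} m" and m_pos: "\<And>x. x \<in> {a..b} \<Longrightarrow> m x > 0"
    and \<mu>: "\<mu> = density (restrict_space lborel {a..b}) (\<lambda>x. ennreal (m x))"
    and prob: "prob_space \<mu>"
begin

abbreviation L :: "real measure" where "L \<equiv> restrict_space lborel {a..b}"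

lemma space_L [simp]: "space L = {a..b}"
  by (simp add: space_restrict_space)

lemma finite_L: "finite_measure L"
  by (rule finite_measureI) (use ab in \<open>simp add: emeasure_restrict_space\<close>)

lemma measurable_L_iff: "f \<in> borel_measurable L \<longleftrightarrow> f \<in> borel_measurable (restrict_space borel {a..b})"
  for f :: "real \<Rightarrow> real"
proof -
  have "(borel_measurable L :: (real \<Rightarrow> real) set) = borel_measurable (restrict_space borel {a..b})"
    by (rule measurable_cong_sets, rule sets_restrict_space_cong) simp_all
  then show ?thesis by simp
qed

lemma measurable_L [measurable (raw)]: "f \<in> borel_measurable borel \<Longrightarrow> f \<in> borel_measurable L" for f :: "real \<Rightarrow> real"
  by (simp add: measurable_restrict_space1)

lemma measurable_L_continuous: "continuous_on {a..b} f \<Longrightarrow> f \<in> borel_measurable L" for f :: "real \<Rightarrow> real"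
  unfolding measurable_L_iff by (rule borel_measurable_continuous_on_restrict)

lemma measurable_m [measurable]: "m \<in> borel_measurable L"
  by (rule measurable_L_continuous[OF m_cont])

lemma sets_\<mu> [measurable_cong, simp]: "sets \<mu> = sets L"
  by (simp add: \<mu>)

lemma space_\<mu> [simp]: "space \<mu> = {a..b}"
  by (simp add: \<mu>)

lemma integral_\<mu>:
  fixes f :: "real \<Rightarrow> real"
  assumes "f \<in> borel_measurable L"
  shows "(\<integral>x. f x \<partial>\<mu>) = (\<integral>x. m x * f x \<partial>L)"
  unfolding \<mu> using m_pos assms
  by (subst integral_density) (auto intro!: AE_I2 simp: less_imp_le)

lemma integral_L: "(\<integral>x. f x \<partial>L) = (LINT x:{a..b}|lborel. f x)" for f :: "real \<Rightarrow> real"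
  by (simp add: integral_restrict_space set_lebesgue_integral_def)

lemma integrable_L_bounded:
  fixes f :: "real \<Rightarrow> real"
  assumes "f \<in> borel_measurable L" "\<And>x. x \<in> {a..b} \<Longrightarrow> \<bar>f x\<bar> \<le> B"
  shows "integrable L f"
  by (rule finite_measure.integrable_const_bound[OF finite_L AE_I2 assms(1)])
    (use assms(2) in simp)

lemma integrable_\<mu>_bounded:
  fixes f :: "real \<Rightarrow> real"
  assumes "f \<in> borel_measurable L" "\<And>x. x \<in> {a..b} \<Longrightarrow> \<bar>f x\<bar> \<le> B"
  shows "integrable \<mu> f"
proof -
  interpret prob_space \<mu> by (rule prob)
  show ?thesis using assms by (intro integrable_const_bound[of _ B]) auto
qed

lemma integrable_L_continuous: "continuous_on {a..b} f \<Longrightarrow> integrable L f" for f :: "real \<Rightarrow> real"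
  using continuous_on_Icc_bounded[of a b f] integrable_L_bounded[OF measurable_L_continuous] by metis

lemma integral_L_continuous:
  fixes f :: "real \<Rightarrow> real"
  assumes "continuous_on {a..b} f"
  shows "(\<integral>x. f x \<partial>L) = integral {a..b} f"
  unfolding integral_L
  by (rule set_borel_integral_eq_integral(2)[OF borel_integrable_atLeastAtMost'[OF assms]])

lemma hellyD:
  assumes "\<Phi> \<in> helly_space a b"
  shows "x \<in> {a..b} \<Longrightarrow> \<Phi> x \<in> {a..b}" "\<Phi> \<in> borel_measurable L"
    "x \<in> {a..b} \<Longrightarrow> y \<in> {a..b} \<Longrightarrow> x \<le> y \<Longrightarrow> \<Phi> x \<le> \<Phi> y" "\<Phi> a = a" "\<Phi> b = b"
  using assms unfolding measurable_L_iff
  by (auto simp: helly_space_def monotone_on_def Pi_iff intro!: borel_measurable_mono_on_fnc)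

lemma push_forward:
  assumes "\<Phi> \<in> helly_space a b"
  shows "finite_measure (distr \<mu> lborel \<Phi>)" "emeasure (distr \<mu> lborel \<Phi>) (- {a..b}) = 0"
proof -
  note [measurable] = hellyD(2)[OF assms]
  interpret prob_space \<mu> by (rule prob)
  show "finite_measure (distr \<mu> lborel \<Phi>)" by (rule finite_measure_distr) simp
  have "\<Phi> -` (- {a..b}) \<inter> space \<mu> = {}" using hellyD(1)[OF assms] by auto
  then show "emeasure (distr \<mu> lborel \<Phi>) (- {a..b}) = 0" by (subst emeasure_distr) auto
qed

lemma id_helly: "(\<lambda>x. x) \<in> helly_space a b"
  using ab by (auto simp: helly_space_def monotone_on_def)

lemma Ent_identity: "Ent (distr \<mu> lborel (\<lambda>x. x)) < \<infinity>"
proof -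
  define r where "r x = indicator {a..b} x * m x" for x
  have [measurable]: "r \<in> borel_measurable borel"
    unfolding r_def[abs_def] using borel_measurable_continuous_on_indicator[OF _ m_cont] by simp
  have r0: "0 \<le> r x" for x using m_pos by (auto simp: r_def indicator_def less_imp_le)
  have "distr \<mu> lborel (\<lambda>x. x) = density lborel (\<lambda>x. ennreal (r x))"
  proof (rule measure_eqI)
    fix A assume "A \<in> sets (distr \<mu> lborel (\<lambda>x. x))"
    then have A[measurable]: "A \<in> sets borel" by simp
    have "A \<inter> {a..b} \<in> sets L" by (subst sets_restrict_space_iff) auto
    then have "emeasure (distr \<mu> lborel (\<lambda>x. x)) A = (\<integral>\<^sup>+x. ennreal (m x) * indicator (A \<inter> {a..b}) x \<partial>L)"
      by (subst emeasure_distr, simp, simp) (simp add: \<mu> emeasure_density)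
    also have "\<dots> = (\<integral>\<^sup>+x. ennreal (r x) * indicator A x \<partial>lborel)"
      by (subst nn_integral_restrict_space) (auto intro!: nn_integral_cong simp: r_def indicator_def)
    finally show "emeasure (distr \<mu> lborel (\<lambda>x. x)) A = emeasure (density lborel (\<lambda>x. ennreal (r x))) A"
      by (simp add: emeasure_density)
  qed simp
  moreover have "integrable lborel (\<lambda>x. r x * ln (r x))"
  proof -
    have "continuous_on {a..b} (\<lambda>x. m x * ln (m x))"
      using m_pos by (intro continuous_intros m_cont) force
    then have "integrable lborel (\<lambda>x. indicator {a..b} x * (m x * ln (m x)))"
      using borel_integrable_atLeastAtMost'[of a b "\<lambda>x. m x * ln (m x)"]
      by (simp add: set_integrable_def)
    moreover have "(\<lambda>x. indicator {a..b} x * (m x * ln (m x))) = (\<lambda>x. r x * ln (r x))"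
      by (auto simp: r_def indicator_def)
    ultimately show ?thesis by simp
  qed
  ultimately show ?thesis using Ent_density[OF _ r0] by simp
qed

lemma minimizer_entropy_finite:
  assumes "is_minimizer_in (helly_space a b) (F_functional \<alpha> f \<mu>) \<Phi>"
  shows "Ent (distr \<mu> lborel \<Phi>) < \<infinity>"
proof (rule ccontr)
  assume "\<not> Ent (distr \<mu> lborel \<Phi>) < \<infinity>"
  then have "Ent (distr \<mu> lborel \<Phi>) = \<infinity>" by simp
  then have "F_functional \<alpha> f \<mu> \<Phi> = \<infinity>" using \<alpha> by (simp add: F_functional_def)
  moreover have "F_functional \<alpha> f \<mu> \<Phi> \<le> F_functional \<alpha> f \<mu> (\<lambda>x. x)"
    using assms id_helly by (simp add: is_minimizer_in_def)
  moreover have "F_functional \<alpha> f \<mu> (\<lambda>x. x) < \<infinity>"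
    using Ent_identity \<alpha> unfolding F_functional_def
    by (cases "Ent (distr \<mu> lborel (\<lambda>x. x))") auto
  ultimately show False by simp
qed

text \<open>Competitors \<open>g \<circ> \<Phi>\<close> with a diffeomorphism \<open>g\<close> of \<open>[a,b]\<close> change the entropy in an explicit
  way, whatever the regularity of \<open>\<Phi>\<close>.  This is why the Euler--Lagrange equation is available
  before anything is known about \<open>\<Phi>\<close>.\<close>

lemma outer_competitor:
  assumes min: "is_minimizer_in (helly_space a b) (F_functional \<alpha> f \<mu>) \<Phi>"
    and g[measurable]: "g \<in> borel_measurable borel" and g'[measurable]: "g' \<in> borel_measurable borel"
    and dg: "\<And>x. x \<in> {a..b} \<Longrightarrow> (g has_real_derivative g' x) (at x)"
    and cg': "continuous_on {a..b} g'" and pos: "\<And>x. x \<in> {a..b} \<Longrightarrow> 0 < g' x"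
    and ends: "g a = a" "g b = b"
  shows "(\<lambda>x. g (\<Phi> x)) \<in> helly_space a b"
    and "(\<integral>x. (\<Phi> x - x)\<^sup>2 / 2 \<partial>\<mu>) + \<alpha> * (\<integral>x. ln (g' (\<Phi> x)) \<partial>\<mu>) - f \<Phi>
      \<le> (\<integral>x. (g (\<Phi> x) - x)\<^sup>2 / 2 \<partial>\<mu>) - f (\<lambda>x. g (\<Phi> x))"
proof -
  have \<Phi>: "\<Phi> \<in> helly_space a b" using min by (simp add: is_minimizer_in_def)
  note [measurable] = hellyD(2)[OF \<Phi>]
  have le: "g x \<le> g y" if xy: "x \<in> {a..b}" "y \<in> {a..b}" "x \<le> y" for x y
  proof -
    obtain z where z: "z \<in> {a..b}" "g y - g x = g' z * (y - x)"
      by (rule MVT_Icc[OF has_field_derivative_at_within[OF dg] xy(1,2)])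
    have "0 \<le> g' z * (y - x)" using pos[OF z(1)] xy by simp
    then show ?thesis using z(2) by simp
  qed
  have range: "g x \<in> {a..b}" if "x \<in> {a..b}" for x
    using le[of a x] le[of x b] that ends ab by auto
  show h: "(\<lambda>x. g (\<Phi> x)) \<in> helly_space a b"
    using hellyD[OF \<Phi>] range le ends by (auto simp: helly_space_def monotone_on_def)
  let ?\<nu> = "distr \<mu> lborel \<Phi>"
  obtain r where r[measurable]: "r \<in> borel_measurable borel" and r0: "\<And>x. 0 \<le> r x"
    and supp: "\<And>x. x \<notin> {a..b} \<Longrightarrow> r x = 0"
    and \<nu>: "?\<nu> = density lborel (\<lambda>x. ennreal (r x))" and int: "integrable lborel (\<lambda>x. r x * ln (r x))"
    by (rule Ent_finite_density[OF ab push_forward(1)[OF \<Phi>] _ push_forward(2)[OF \<Phi>] minimizer_entropy_finite[OF min]])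
      auto
  have ir: "integrable lborel r"
  proof -
    interpret \<nu>: finite_measure ?\<nu> by (rule push_forward(1)[OF \<Phi>])
    have "integrable ?\<nu> (\<lambda>x. 1 :: real)" by simp
    then show ?thesis unfolding \<nu> by (subst (asm) integrable_density) (use r0 in auto)
  qed
  have "distr \<mu> lborel (\<lambda>x. g (\<Phi> x)) = distr ?\<nu> lborel g"
    by (subst distr_distr) (auto simp: o_def)
  then have Eg: "Ent (distr \<mu> lborel (\<lambda>x. g (\<Phi> x))) =
     ereal ((\<integral>x. r x * ln (r x) \<partial>lborel) - (\<integral>x. r x * ln (g' x) \<partial>lborel))"
    using Ent_distr_diffeo(1)[OF ab r r0 supp int ir g dg cg' pos ends] by (simp add: \<nu>)
  have E\<Phi>: "Ent ?\<nu> = ereal (\<integral>x. r x * ln (r x) \<partial>lborel)"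
    unfolding \<nu> by (rule Ent_density[OF r r0 int])
  have "(\<integral>x. r x * ln (g' x) \<partial>lborel) = (\<integral>x. ln (g' x) \<partial>?\<nu>)"
    unfolding \<nu> by (subst integral_density) (use r0 in auto)
  also have "\<dots> = (\<integral>x. ln (g' (\<Phi> x)) \<partial>\<mu>)" by (rule integral_distr) auto
  finally have I: "(\<integral>x. r x * ln (g' x) \<partial>lborel) = (\<integral>x. ln (g' (\<Phi> x)) \<partial>\<mu>)" .
  have "F_functional \<alpha> f \<mu> \<Phi> \<le> F_functional \<alpha> f \<mu> (\<lambda>x. g (\<Phi> x))"
    using min h by (simp add: is_minimizer_in_def)
  then show "(\<integral>x. (\<Phi> x - x)\<^sup>2 / 2 \<partial>\<mu>) + \<alpha> * (\<integral>x. ln (g' (\<Phi> x)) \<partial>\<mu>) - f \<Phi>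
      \<le> (\<integral>x. (g (\<Phi> x) - x)\<^sup>2 / 2 \<partial>\<mu>) - f (\<lambda>x. g (\<Phi> x))"
    unfolding F_functional_def Eg E\<Phi> I by (simp add: algebra_simps)
qed

text \<open>The primitive is taken from the left of \<open>a\<close> on, so that it has two-sided derivatives at the end
  points, as the change of variables formula for integrals requires.\<close>

lemma antiderivative_near_Icc:
  assumes p: "continuous_on UNIV p"
  obtains \<eta> where "\<eta> \<in> borel_measurable borel"
    "\<And>y. y \<in> {a..b} \<Longrightarrow> (\<eta> has_real_derivative p y) (at y)"
    "\<And>y. y \<in> {a..b} \<Longrightarrow> \<eta> y = integral {a..y} p"
proof -
  define c d where "c = a - 1" and "d = b + 1"
  define I where "I y = integral {c..y} p - integral {c..a} p" for y
  have pc: "continuous_on {u..v} p" for u v by (rule continuous_on_subset[OF p]) simp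
  have dI: "(I has_real_derivative p y) (at y within {c..d})" if "y \<in> {c..d}" for y
    unfolding I_def
    using DERIV_diff[OF integral_has_vector_derivative[OF pc that, folded has_real_derivative_iff_has_vector_derivative]
        DERIV_const] by simp
  have cI: "continuous_on {c..d} I" by (rule DERIV_continuous_on[OF dI])
  define \<eta> where "\<eta> y = (if y \<in> {c..d} then I y else 0)" for y
  show ?thesis
  proof (rule that[of \<eta>])
    show "\<eta> \<in> borel_measurable borel"
      unfolding \<eta>_def[abs_def] by (intro borel_measurable_continuous_on_if cI) auto
    fix y assume y: "y \<in> {a..b}"
    then have y': "y \<in> {c<..<d}" by (simp add: c_def d_def)
    have "(I has_real_derivative p y) (at y)"
      using dI[of y] y' by (simp add: at_within_Icc_at)
    then show "(\<eta> has_real_derivative p y) (at y)"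
      by (rule has_field_derivative_transform_within_open[of _ _ _ "{c<..<d}"])
        (use y' in \<open>auto simp: \<eta>_def\<close>)
    have "integral {c..a} p + integral {a..y} p = integral {c..y} p"
      using y by (intro Henstock_Kurzweil_Integration.integral_combine integrable_continuous_interval pc)
        (auto simp: c_def)
    then show "\<eta> y = integral {a..y} p" using y' by (simp add: \<eta>_def I_def)
  qed
qed

text \<open>For \<open>g = id + \<epsilon> \<eta>\<close> with \<open>\<eta>' = p\<close> the kinetic and linear terms are polynomials in \<open>\<epsilon>\<close>, and
  \<open>ln (1 + z) \<ge> z - 2 z\<^sup>2\<close> bounds the entropy term.  As \<open>\<epsilon>\<close> may have both signs, the linear terms
  balance.\<close>

lemma first_variation:
  assumes min: "is_minimizer_in (helly_space a b) (F_functional \<alpha> f \<mu>) \<Phi>"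
    and f: "\<And>\<Psi>. \<Psi> \<in> helly_space a b \<Longrightarrow> f \<Psi> = (\<integral>x. \<Psi> x * G x \<partial>L) + B"
    and G: "continuous_on {a..b} G"
    and p: "continuous_on UNIV p" and p0: "integral {a..b} p = 0"
  shows "(\<integral>x. integral {a..\<Phi> x} p * (m x * (\<Phi> x - x) - G x) \<partial>L) = \<alpha> * (\<integral>x. p (\<Phi> x) \<partial>\<mu>)"
proof -
  have \<Phi>: "\<Phi> \<in> helly_space a b" using min by (simp add: is_minimizer_in_def)
  note [measurable] = hellyD(2)[OF \<Phi>]
  note \<Phi>r = hellyD(1)[OF \<Phi>]
  obtain \<eta> where \<eta>[measurable]: "\<eta> \<in> borel_measurable borel"
    and d\<eta>: "\<And>y. y \<in> {a..b} \<Longrightarrow> (\<eta> has_real_derivative p y) (at y)"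
    and \<eta>I: "\<And>y. y \<in> {a..b} \<Longrightarrow> \<eta> y = integral {a..y} p"
    using antiderivative_near_Icc[OF p] by blast
  have [measurable]: "p \<in> borel_measurable borel" by (rule borel_measurable_continuous_onI[OF p])
  have [measurable]: "G \<in> borel_measurable L" by (rule measurable_L_continuous[OF G])
  have c\<eta>: "continuous_on {a..b} \<eta>"
    by (rule DERIV_continuous_on[OF has_field_derivative_at_within[OF d\<eta>]])
  have cp: "continuous_on {a..b} p" by (rule continuous_on_subset[OF p]) simp
  obtain P where P: "P > 0" "\<And>y. y \<in> {a..b} \<Longrightarrow> \<bar>p y\<bar> \<le> P" using continuous_on_Icc_bounded[OF cp] by metis
  obtain N where N: "N > 0" "\<And>y. y \<in> {a..b} \<Longrightarrow> \<bar>\<eta> y\<bar> \<le> N" using continuous_on_Icc_bounded[OF c\<eta>] by metis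
  obtain GB where GB: "GB > 0" "\<And>y. y \<in> {a..b} \<Longrightarrow> \<bar>G y\<bar> \<le> GB" using continuous_on_Icc_bounded[OF G] by metis
  define X where "X = (\<integral>x. \<eta> (\<Phi> x) * (\<Phi> x - x) \<partial>\<mu>) - (\<integral>x. \<eta> (\<Phi> x) * G x \<partial>L)"
  define Y where "Y = (\<integral>x. (\<eta> (\<Phi> x))\<^sup>2 / 2 \<partial>\<mu>)"
  define Z where "Z = (\<integral>x. p (\<Phi> x) \<partial>\<mu>)"
  have dist: "\<bar>\<Phi> x - x\<bar> \<le> b - a" if "x \<in> {a..b}" for x using \<Phi>r[OF that] that by auto
  have int_p: "integrable \<mu> (\<lambda>x. p (\<Phi> x))"
    by (rule integrable_\<mu>_bounded[of _ P]) (use P \<Phi>r in auto)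
  have int_\<eta>: "integrable \<mu> (\<lambda>x. \<eta> (\<Phi> x) * (\<Phi> x - x))"
  proof (rule integrable_\<mu>_bounded[of _ "N * (b - a)"])
    show "\<bar>\<eta> (\<Phi> x) * (\<Phi> x - x)\<bar> \<le> N * (b - a)" if "x \<in> {a..b}" for x
      unfolding abs_mult using N(1) N(2)[OF \<Phi>r[OF that]] dist[OF that] by (intro mult_mono) auto
  qed simp
  have int_\<eta>2: "integrable \<mu> (\<lambda>x. (\<eta> (\<Phi> x))\<^sup>2 / 2)"
  proof (rule integrable_\<mu>_bounded[of _ "N\<^sup>2 / 2"])
    show "\<bar>(\<eta> (\<Phi> x))\<^sup>2 / 2\<bar> \<le> N\<^sup>2 / 2" if "x \<in> {a..b}" for x
      using power_mono[OF N(2)[OF \<Phi>r[OF that]], of 2] by simp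
  qed simp
  have int_d: "integrable \<mu> (\<lambda>x. (\<Phi> x - x)\<^sup>2 / 2)"
  proof (rule integrable_\<mu>_bounded[of _ "(b - a)\<^sup>2 / 2"])
    show "\<bar>(\<Phi> x - x)\<^sup>2 / 2\<bar> \<le> (b - a)\<^sup>2 / 2" if "x \<in> {a..b}" for x
      using power_mono[OF dist[OF that], of 2] by simp
  qed simp
  have int_G: "integrable L (\<lambda>x. \<eta> (\<Phi> x) * G x)" "integrable L (\<lambda>x. \<Phi> x * G x)"
  proof -
    show "integrable L (\<lambda>x. \<eta> (\<Phi> x) * G x)"
    proof (rule integrable_L_bounded[of _ "N * GB"])
      show "\<bar>\<eta> (\<Phi> x) * G x\<bar> \<le> N * GB" if "x \<in> {a..b}" for x
        unfolding abs_mult using N(1) N(2)[OF \<Phi>r[OF that]] GB(2)[OF that] by (intro mult_mono) auto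
    qed simp
    show "integrable L (\<lambda>x. \<Phi> x * G x)"
    proof (rule integrable_L_bounded[of _ "(\<bar>a\<bar> + \<bar>b\<bar>) * GB"])
      show "\<bar>\<Phi> x * G x\<bar> \<le> (\<bar>a\<bar> + \<bar>b\<bar>) * GB" if "x \<in> {a..b}" for x
        unfolding abs_mult using \<Phi>r[OF that] GB(2)[OF that] by (intro mult_mono) auto
    qed simp
  qed
  have key: "\<epsilon> * (\<alpha> * Z - X) \<le> \<epsilon>\<^sup>2 * (Y + 2 * \<alpha> * P\<^sup>2)" if \<epsilon>: "\<bar>\<epsilon>\<bar> \<le> 1 / (2 * P)" for \<epsilon>
  proof -
    have small: "\<bar>\<epsilon> * p y\<bar> \<le> 1 / 2" if "y \<in> {a..b}" for y
    proof -
      have "\<bar>\<epsilon> * p y\<bar> \<le> 1 / (2 * P) * P"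
        unfolding abs_mult using \<epsilon> P(1) P(2)[OF that] by (intro mult_mono) auto
      then show ?thesis using P(1) by simp
    qed
    define g where "g y = y + \<epsilon> * \<eta> y" for y
    define g' where "g' y = 1 + \<epsilon> * p y" for y
    have g[measurable]: "g \<in> borel_measurable borel" "g' \<in> borel_measurable borel"
      unfolding g_def[abs_def] g'_def[abs_def] by measurable
    have dg: "(g has_real_derivative g' y) (at y)" if "y \<in> {a..b}" for y
      unfolding g_def[abs_def] g'_def using d\<eta>[OF that] by (auto intro!: derivative_eq_intros)
    have cg': "continuous_on {a..b} g'" unfolding g'_def[abs_def] by (intro continuous_intros cp)
    have pos: "0 < g' y" if "y \<in> {a..b}" for y
      using small[OF that] unfolding g'_def by linarith
    have ends: "g a = a" "g b = b" using \<eta>I[of a] \<eta>I[of b] ab p0 by (auto simp: g_def)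
    note comp = outer_competitor[OF min g dg cg' pos ends]
    have sq: "(\<integral>x. (g (\<Phi> x) - x)\<^sup>2 / 2 \<partial>\<mu>)
        = (\<integral>x. (\<Phi> x - x)\<^sup>2 / 2 \<partial>\<mu>) + \<epsilon> * (\<integral>x. \<eta> (\<Phi> x) * (\<Phi> x - x) \<partial>\<mu>) + \<epsilon>\<^sup>2 * Y"
    proof -
      have lin3: "(\<integral>x. A x + \<epsilon> * B x + \<epsilon>\<^sup>2 * C x \<partial>\<mu>) = (\<integral>x. A x \<partial>\<mu>) + \<epsilon> * (\<integral>x. B x \<partial>\<mu>) + \<epsilon>\<^sup>2 * (\<integral>x. C x \<partial>\<mu>)"
        if "integrable \<mu> A" "integrable \<mu> B" "integrable \<mu> C" for A B C :: "real \<Rightarrow> real"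
        using that by simp
      have "(\<lambda>x. (g (\<Phi> x) - x)\<^sup>2 / 2) =
        (\<lambda>x. (\<Phi> x - x)\<^sup>2 / 2 + \<epsilon> * (\<eta> (\<Phi> x) * (\<Phi> x - x)) + \<epsilon>\<^sup>2 * ((\<eta> (\<Phi> x))\<^sup>2 / 2))"
        by (auto simp: g_def power2_eq_square field_simps)
      then show ?thesis unfolding Y_def lin3[OF int_d int_\<eta> int_\<eta>2, symmetric] by (rule arg_cong)
    qed
    have lin: "f (\<lambda>x. g (\<Phi> x)) = f \<Phi> + \<epsilon> * (\<integral>x. \<eta> (\<Phi> x) * G x \<partial>L)"
    proof -
      have "(\<lambda>x. g (\<Phi> x) * G x) = (\<lambda>x. \<Phi> x * G x + \<epsilon> * (\<eta> (\<Phi> x) * G x))"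
        by (auto simp: g_def algebra_simps)
      then have "(\<integral>x. g (\<Phi> x) * G x \<partial>L) = (\<integral>x. \<Phi> x * G x \<partial>L) + \<epsilon> * (\<integral>x. \<eta> (\<Phi> x) * G x \<partial>L)"
        using int_G by simp
      then show ?thesis using f[OF comp(1)] f[OF \<Phi>] by simp
    qed
    have ln_lower: "\<epsilon> * p (\<Phi> x) - 2 * \<epsilon>\<^sup>2 * P\<^sup>2 \<le> ln (g' (\<Phi> x))" if x: "x \<in> {a..b}" for x
    proof -
      have "\<bar>ln (1 + \<epsilon> * p (\<Phi> x)) - \<epsilon> * p (\<Phi> x)\<bar> \<le> 2 * (\<epsilon> * p (\<Phi> x))\<^sup>2"
        by (rule abs_ln_one_plus_x_minus_x_bound[OF small[OF \<Phi>r[OF x]]])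
      moreover have "(\<epsilon> * p (\<Phi> x))\<^sup>2 \<le> \<epsilon>\<^sup>2 * P\<^sup>2"
        unfolding power_mult_distrib
        using power_mono[OF P(2)[OF \<Phi>r[OF x]], of 2] by (intro mult_left_mono) auto
      ultimately show ?thesis unfolding g'_def by linarith
    qed
    interpret prob_space \<mu> by (rule prob)
    have cl: "continuous_on {a..b} (\<lambda>y. ln (g' y))" using pos by (intro continuous_on_ln cg') force
    obtain LB where LB: "\<And>y. y \<in> {a..b} \<Longrightarrow> \<bar>ln (g' y)\<bar> \<le> LB" using continuous_on_Icc_bounded[OF cl] by metis
    have "\<epsilon> * Z - 2 * \<epsilon>\<^sup>2 * P\<^sup>2 = (\<integral>x. \<epsilon> * p (\<Phi> x) - 2 * \<epsilon>\<^sup>2 * P\<^sup>2 \<partial>\<mu>)"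
      using int_p prob_space by (simp add: Z_def)
    also have "\<dots> \<le> (\<integral>x. ln (g' (\<Phi> x)) \<partial>\<mu>)"
      by (rule integral_mono)
        (use int_p ln_lower LB \<Phi>r in \<open>auto intro!: integrable_\<mu>_bounded[of _ LB]\<close>)
    finally have "\<alpha> * (\<epsilon> * Z - 2 * \<epsilon>\<^sup>2 * P\<^sup>2) \<le> \<alpha> * (\<integral>x. ln (g' (\<Phi> x)) \<partial>\<mu>)"
      using \<alpha> by simp
    also have "\<dots> \<le> \<epsilon> * X + \<epsilon>\<^sup>2 * Y"
      using comp(2) unfolding sq lin X_def by (simp add: algebra_simps)
    finally show ?thesis by (simp add: algebra_simps)
  qed
  have "\<alpha> * Z - X = 0"
  proof (rule ccontr)
    assume ne: "\<alpha> * Z - X \<noteq> 0"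
    define V where "V = \<bar>Y + 2 * \<alpha> * P\<^sup>2\<bar> + 1"
    define \<delta> where "\<delta> = min (1 / (2 * P)) (\<bar>\<alpha> * Z - X\<bar> / (2 * V))"
    have V: "V > 0" by (simp add: V_def add_nonneg_pos)
    have \<delta>: "\<delta> > 0" "\<delta> \<le> 1 / (2 * P)" "\<delta> \<le> \<bar>\<alpha> * Z - X\<bar> / (2 * V)" using ne P V by (auto simp: \<delta>_def)
    define \<epsilon> where "\<epsilon> = sgn (\<alpha> * Z - X) * \<delta>"
    have e: "\<epsilon> * (\<alpha> * Z - X) = \<delta> * \<bar>\<alpha> * Z - X\<bar>" "\<epsilon>\<^sup>2 = \<delta>\<^sup>2" "\<bar>\<epsilon>\<bar> = \<delta>"
      using ne \<delta>(1) by (auto simp: \<epsilon>_def sgn_if abs_if)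
    have "\<delta> * \<bar>\<alpha> * Z - X\<bar> \<le> \<delta>\<^sup>2 * (Y + 2 * \<alpha> * P\<^sup>2)"
      using key[of \<epsilon>] e \<delta> by simp
    also have "\<dots> \<le> \<delta>\<^sup>2 * V" by (intro mult_left_mono) (auto simp: V_def)
    finally have "\<bar>\<alpha> * Z - X\<bar> \<le> \<delta> * V" using \<delta>(1) by (simp add: power2_eq_square)
    also have "\<dots> \<le> \<bar>\<alpha> * Z - X\<bar> / (2 * V) * V" using \<delta>(3) V by (intro mult_right_mono) auto
    also have "\<dots> = \<bar>\<alpha> * Z - X\<bar> / 2" using V by simp
    finally show False using ne by simp
  qed
  moreover have "X = (\<integral>x. integral {a..\<Phi> x} p * (m x * (\<Phi> x - x) - G x) \<partial>L)"
  proof -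
    have i: "integrable L (\<lambda>x. m x * (\<eta> (\<Phi> x) * (\<Phi> x - x)))"
      using int_\<eta> m_pos unfolding \<mu>
      by (subst (asm) integrable_density) (auto intro!: AE_I2 simp: less_imp_le)
    have "X = (\<integral>x. m x * (\<eta> (\<Phi> x) * (\<Phi> x - x)) - \<eta> (\<Phi> x) * G x \<partial>L)"
      unfolding X_def using i int_G by (subst integral_\<mu>) auto
    also have "\<dots> = (\<integral>x. integral {a..\<Phi> x} p * (m x * (\<Phi> x - x) - G x) \<partial>L)"
      by (rule Bochner_Integration.integral_cong) (use \<eta>I \<Phi>r in \<open>auto simp: algebra_simps\<close>)
    finally show ?thesis .
  qed
  ultimately show ?thesis by (simp add: Z_def)
qed

end

section \<open>The Euler--Lagrange equation and regularity of minimizers\<close>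

text \<open>Gronwall's argument for \<open>g = (f - f y0)\<^sup>2\<close>: on the right of \<open>y0\<close> the function \<open>g e\<^sup>-\<^sup>2\<^sup>c\<^sup>y\<close> decreases, on
  the left \<open>g e\<^sup>2\<^sup>c\<^sup>y\<close> increases, and both vanish at \<open>y0\<close>.\<close>

lemma gronwall_constant:
  fixes f f' :: "real \<Rightarrow> real"
  assumes d: "\<And>y. y \<in> {a..b} \<Longrightarrow> (f has_real_derivative f' y) (at y within {a..b})"
    and y0: "y0 \<in> {a..b}" and y: "y \<in> {a..b}"
    and le: "\<And>y. y \<in> {a..b} \<Longrightarrow> \<bar>f' y\<bar> \<le> c * \<bar>f y - f y0\<bar>"
  shows "f y = f y0"
proof -
  define g where "g z = (f z - f y0)\<^sup>2" for z
  have dg: "(g has_real_derivative 2 * (f z - f y0) * f' z) (at z within {a..b})" if "z \<in> {a..b}" for z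
    unfolding g_def[abs_def] using d[OF that] by (auto intro!: derivative_eq_intros)
  have bound: "\<bar>2 * (f z - f y0) * f' z\<bar> \<le> 2 * c * g z" if "z \<in> {a..b}" for z
  proof -
    have "2 * \<bar>f z - f y0\<bar> * \<bar>f' z\<bar> \<le> 2 * \<bar>f z - f y0\<bar> * (c * \<bar>f z - f y0\<bar>)"
      using le[OF that] by (intro mult_left_mono) auto
    also have "\<dots> = 2 * c * g z" by (simp add: g_def power2_eq_square)
    finally show ?thesis by (simp only: abs_mult abs_numeral)
  qed
  have dm: "((\<lambda>z. g z * exp (- (2 * c) * z)) has_real_derivative
      (2 * (f z - f y0) * f' z - 2 * c * g z) * exp (- (2 * c) * z)) (at z within {a..b})" if "z \<in> {a..b}" for z
    using dg[OF that] by (auto intro!: derivative_eq_intros simp: algebra_simps)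
  have dp: "((\<lambda>z. g z * exp (2 * c * z)) has_real_derivative
      (2 * (f z - f y0) * f' z + 2 * c * g z) * exp (2 * c * z)) (at z within {a..b})" if "z \<in> {a..b}" for z
    using dg[OF that] by (auto intro!: derivative_eq_intros simp: algebra_simps)
  have g0: "g y0 = 0" by (simp add: g_def)
  have "g y \<le> 0"
  proof (cases "y0 \<le> y")
    case True
    obtain z where z: "z \<in> {a..b}" "g y * exp (- (2 * c) * y) - g y0 * exp (- (2 * c) * y0)
        = (2 * (f z - f y0) * f' z - 2 * c * g z) * exp (- (2 * c) * z) * (y - y0)"
      by (rule MVT_Icc[OF dm y0 y])
    have "(2 * (f z - f y0) * f' z - 2 * c * g z) * exp (- (2 * c) * z) * (y - y0) \<le> 0"
      using abs_le_D1[OF bound[OF z(1)]] True by (intro mult_nonpos_nonneg) auto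
    then have "g y * exp (- (2 * c) * y) \<le> 0" using z(2) g0 by simp
    then show ?thesis by (simp add: mult_le_0_iff not_le[symmetric])
  next
    case False
    obtain z where z: "z \<in> {a..b}" "g y0 * exp (2 * c * y0) - g y * exp (2 * c * y)
        = (2 * (f z - f y0) * f' z + 2 * c * g z) * exp (2 * c * z) * (y0 - y)"
      by (rule MVT_Icc[OF dp y y0])
    have "0 \<le> (2 * (f z - f y0) * f' z + 2 * c * g z) * exp (2 * c * z) * (y0 - y)"
      using abs_le_D2[OF bound[OF z(1)]] False by (intro mult_nonneg_nonneg) auto
    then have "g y * exp (2 * c * y) \<le> 0" using z(2) g0 by simp
    then show ?thesis by (simp add: mult_le_0_iff not_le[symmetric])
  qed
  then show ?thesis by (simp add: g_def)
qed

context transport_problem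
begin

definition primitive :: "(real \<Rightarrow> real) \<Rightarrow> real \<Rightarrow> real" where
  "primitive f \<tau> = (\<integral>x. indicator {..\<tau>} x * f x \<partial>L)"

lemma integrable_indicator_mult:
  fixes f :: "real \<Rightarrow> real"
  assumes "f \<in> borel_measurable L" "\<And>x. x \<in> {a..b} \<Longrightarrow> \<bar>f x\<bar> \<le> B" "A \<in> sets borel"
  shows "integrable L (\<lambda>x. indicator A x * f x)"
proof (rule integrable_L_bounded)
  have "(indicator A :: real \<Rightarrow> real) \<in> borel_measurable L" using assms(3) by measurable
  then show "(\<lambda>x. indicator A x * f x) \<in> borel_measurable L" using assms(1) by measurable
  show "\<bar>indicator A x * f x\<bar> \<le> \<bar>B\<bar>" if "x \<in> {a..b}" for x
    using assms(2)[OF that] by (auto simp: indicator_def)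
qed

lemma primitive_diff:
  assumes "f \<in> borel_measurable L" "\<And>x. x \<in> {a..b} \<Longrightarrow> \<bar>f x\<bar> \<le> B" "s \<le> t"
  shows "primitive f t - primitive f s = (\<integral>x. indicator {s<..t} x * f x \<partial>L)"
proof -
  have "primitive f t - primitive f s = (\<integral>x. indicator {..t} x * f x - indicator {..s} x * f x \<partial>L)"
    unfolding primitive_def
    by (rule Bochner_Integration.integral_diff[symmetric]) (rule integrable_indicator_mult[OF assms(1,2)], assumption, simp)+
  also have "(\<lambda>x. indicator {..t} x * f x - indicator {..s} x * f x) = (\<lambda>x. indicator {s<..t} x * f x)"
    using assms(3) by (auto simp: indicator_def fun_eq_iff)
  finally show ?thesis .
qed

lemma integral_indicator_L:
  fixes c :: real
  assumes "a \<le> s" "s \<le> t" "t \<le> b"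
  shows "(\<integral>x. indicator {s<..t} x * c \<partial>L) = (t - s) * c"
proof -
  have "(\<integral>x. indicator {s<..t} x * c \<partial>L) = (\<integral>x. indicator {s<..t} x * c \<partial>lborel)"
    unfolding integral_L set_lebesgue_integral_def using assms
    by (intro Bochner_Integration.integral_cong) (auto simp: indicator_def)
  also have "\<dots> = (t - s) * c" using assms by simp
  finally show ?thesis .
qed

lemma primitive_bounds:
  assumes f: "f \<in> borel_measurable L" and lu: "\<And>x. x \<in> {a..b} \<Longrightarrow> l \<le> f x \<and> f x \<le> u"
    and st: "a \<le> s" "s \<le> t" "t \<le> b"
  shows "(t - s) * l \<le> primitive f t - primitive f s" "primitive f t - primitive f s \<le> (t - s) * u"
proof -
  have B: "\<bar>f x\<bar> \<le> \<bar>l\<bar> + \<bar>u\<bar>" if "x \<in> {a..b}" for x using lu[OF that] by auto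
  have eq: "primitive f t - primitive f s = (\<integral>x. indicator {s<..t} x * f x \<partial>L)"
    by (rule primitive_diff[OF f B st(2)])
  note i = integrable_indicator_mult[OF f B, of "{s<..t}"] integrable_indicator_mult[of "\<lambda>_. c" "\<bar>c\<bar>" "{s<..t}" for c]
  have "(\<integral>x. indicator {s<..t} x * l \<partial>L) \<le> (\<integral>x. indicator {s<..t} x * f x \<partial>L)"
    using lu by (intro integral_mono i) (auto intro!: mult_left_mono)
  then show "(t - s) * l \<le> primitive f t - primitive f s"
    unfolding eq integral_indicator_L[OF st] .
  have "(\<integral>x. indicator {s<..t} x * f x \<partial>L) \<le> (\<integral>x. indicator {s<..t} x * u \<partial>L)"
    using lu by (intro integral_mono i) (auto intro!: mult_left_mono)
  then show "primitive f t - primitive f s \<le> (t - s) * u"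
    unfolding eq integral_indicator_L[OF st] .
qed

lemma primitive_lipschitz:
  assumes f: "f \<in> borel_measurable L" and B: "\<And>x. x \<in> {a..b} \<Longrightarrow> \<bar>f x\<bar> \<le> B"
    and st: "s \<in> {a..b}" "t \<in> {a..b}"
  shows "\<bar>primitive f t - primitive f s\<bar> \<le> B * \<bar>t - s\<bar>"
proof -
  have *: "\<bar>primitive f t - primitive f s\<bar> \<le> B * \<bar>t - s\<bar>" if "s \<le> t" "s \<in> {a..b}" "t \<in> {a..b}" for s t
  proof -
    have lu: "- B \<le> f x \<and> f x \<le> B" if "x \<in> {a..b}" for x using B[OF that] by auto
    show ?thesis using primitive_bounds[OF f lu, of s t] that by (auto simp: abs_le_iff algebra_simps)
  qed
  show ?thesis using *[of s t] *[of t s] st by (cases "s \<le> t") (auto simp: abs_minus_commute)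
qed

lemma primitive_continuous:
  assumes f: "continuous_on {a..b} f" and t: "\<tau> \<in> {a..b}"
  shows "primitive f \<tau> = integral {a..\<tau>} f"
proof -
  have "primitive f \<tau> = (LINT x:{a..\<tau>}|lborel. f x)"
    unfolding primitive_def integral_L set_lebesgue_integral_def using t
    by (intro Bochner_Integration.integral_cong) (auto simp: indicator_def)
  also have "\<dots> = integral {a..\<tau>} f"
    using t by (intro set_borel_integral_eq_integral(2) borel_integrable_atLeastAtMost' continuous_on_subset[OF f]) auto
  finally show ?thesis .
qed

lemma primitive_DERIV:
  assumes f: "continuous_on {a..b} f" and t: "\<tau> \<in> {a..b}"
  shows "(primitive f has_real_derivative f \<tau>) (at \<tau> within {a..b})"
  by (rule DERIV_cong_within_Icc[OF _ t, of "\<lambda>\<tau>. integral {a..\<tau>} f"])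
    (use integral_has_vector_derivative[OF f t] primitive_continuous[OF f]
      in \<open>auto simp: has_real_derivative_iff_has_vector_derivative\<close>)

lemma AE_L_neq: "AE x in L. x \<noteq> c"
  by (subst AE_restrict_space_iff) (use AE_lborel_singleton[of c] in \<open>auto elim: eventually_mono\<close>)

end

locale transport_minimizer = transport_problem +
  fixes G \<Phi> :: "real \<Rightarrow> real"
  assumes G: "continuous_on {a..b} G" and \<Phi>: "\<Phi> \<in> helly_space a b"
    and variation: "\<And>p. continuous_on UNIV p \<Longrightarrow> integral {a..b} p = 0 \<Longrightarrow>
      (\<integral>x. integral {a..\<Phi> x} p * (m x * (\<Phi> x - x) - G x) \<partial>L) = \<alpha> * (\<integral>x. p (\<Phi> x) \<partial>\<mu>)"
begin

lemmas \<Phi>_range = hellyD(1)[OF \<Phi>] and \<Phi>_measurable [measurable] = hellyD(2)[OF \<Phi>]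
  and \<Phi>_mono = hellyD(3)[OF \<Phi>] and \<Phi>_ends = hellyD(4,5)[OF \<Phi>]

text \<open>Exchanging the integrals on the left side of the first variation replaces \<open>h\<close> by \<open>K\<close>, integrated
  against \<open>p\<close>.  \<open>R\<close> turns out to be the density of the push-forward of \<open>\<mu>\<close>, \<open>S\<close> is its distribution
  function and \<open>T\<close> the generalized inverse of \<open>\<Phi>\<close>.\<close>

definition h :: "real \<Rightarrow> real" where "h x = m x * (\<Phi> x - x) - G x"

definition K :: "real \<Rightarrow> real" where "K z = (\<integral>x. indicator {z<..} (\<Phi> x) * h x \<partial>L)"

definition R :: "real \<Rightarrow> real" where
  "R z = (K z - (\<integral>z. K z \<partial>L) / (b - a)) / \<alpha> + 1 / (b - a)"

definition T :: "real \<Rightarrow> real" where "T y = Sup {x \<in> {a..b}. \<Phi> x \<le> y}"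

definition S :: "real \<Rightarrow> real" where "S y = primitive R y"

lemma h_measurable [measurable]: "h \<in> borel_measurable L"
proof -
  have [measurable]: "G \<in> borel_measurable L" by (rule measurable_L_continuous[OF G])
  show ?thesis unfolding h_def[abs_def] by measurable
qed

lemma h_bounded: obtains B where "B > 0" "\<And>x. x \<in> {a..b} \<Longrightarrow> \<bar>h x\<bar> \<le> B"
proof -
  obtain GB where GB: "GB > 0" "\<And>y. y \<in> {a..b} \<Longrightarrow> \<bar>G y\<bar> \<le> GB" using continuous_on_Icc_bounded[OF G] by metis
  obtain M where M: "M > 0" "\<And>y. y \<in> {a..b} \<Longrightarrow> \<bar>m y\<bar> \<le> M" using continuous_on_Icc_bounded[OF m_cont] by metis
  show ?thesis
  proof (rule that[of "M * (b - a) + GB"])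
    show "\<bar>h x\<bar> \<le> M * (b - a) + GB" if x: "x \<in> {a..b}" for x
    proof -
      have "\<bar>\<Phi> x - x\<bar> \<le> b - a" using \<Phi>_range[OF x] x by auto
      then have "\<bar>m x * (\<Phi> x - x)\<bar> \<le> M * (b - a)"
        unfolding abs_mult using M(1) M(2)[OF x] by (intro mult_mono) auto
      then show ?thesis using GB(2)[OF x] unfolding h_def by linarith
    qed
  qed (use M GB ab in \<open>simp add: add_pos_pos\<close>)
qed

lemma integrable_\<Phi>_indicator:
  fixes f :: "real \<Rightarrow> real"
  assumes "A \<in> sets borel" "f \<in> borel_measurable L" "\<And>x. x \<in> {a..b} \<Longrightarrow> \<bar>f x\<bar> \<le> B"
  shows "integrable L (\<lambda>x. indicator A (\<Phi> x) * f x)"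
proof (rule integrable_L_bounded)
  have [measurable]: "(indicator A :: real \<Rightarrow> real) \<in> borel_measurable borel" using assms(1) by measurable
  show "(\<lambda>x. indicator A (\<Phi> x) * f x) \<in> borel_measurable L" using assms(2) by measurable
  show "\<bar>indicator A (\<Phi> x) * f x\<bar> \<le> \<bar>B\<bar>" if "x \<in> {a..b}" for x
    using assms(3)[OF that] by (auto simp: indicator_def)
qed

text \<open>By monotonicity sublevel sets of \<open>\<Phi>\<close> are initial segments.  Whether the right end belongs to
  them depends on the continuity of \<open>\<Phi>\<close> there, so nothing is said about the point \<open>T y\<close>.\<close>

lemma sublevel:
  assumes y: "y \<in> {a..b}"
  shows "T y \<in> {a..b}" "x \<in> {a..b} \<Longrightarrow> \<Phi> x \<le> y \<Longrightarrow> x \<le> T y" "x \<in> {a..b} \<Longrightarrow> x < T y \<Longrightarrow> \<Phi> x \<le> y"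
proof -
  let ?A = "{x \<in> {a..b}. \<Phi> x \<le> y}"
  have a: "a \<in> ?A" using ab y \<Phi>_ends by auto
  have bdd: "bdd_above ?A" by (rule bdd_aboveI[of _ b]) auto
  show up: "x \<le> T y" if "x \<in> {a..b}" "\<Phi> x \<le> y" for x
    unfolding T_def by (rule cSup_upper) (use that bdd in auto)
  have "T y \<le> b" unfolding T_def by (rule cSup_least) (use a in auto)
  then show "T y \<in> {a..b}" using up[of a] a by auto
  show "\<Phi> x \<le> y" if x: "x \<in> {a..b}" "x < T y"
  proof -
    obtain x' where x': "x' \<in> ?A" "x < x'"
      using less_cSupD[of ?A x] a x(2) unfolding T_def by blast
    then show ?thesis using \<Phi>_mono[OF x(1), of x'] by auto
  qed
qed

lemma integral_sublevel:
  assumes y: "y \<in> {a..b}" and f[measurable]: "f \<in> borel_measurable L"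
  shows "(\<integral>x. indicator {..y} (\<Phi> x) * f x \<partial>L) = primitive f (T y)"
  unfolding primitive_def
proof (rule integral_cong_AE)
  have "AE x in L. x \<in> {a..b}" by (rule AE_I2) simp
  with AE_L_neq[of "T y"]
  show "AE x in L. indicator {..y} (\<Phi> x) * f x = indicator {..T y} x * f x"
  proof eventually_elim
    case (elim x)
    then show ?case using sublevel(2,3)[OF y, of x] by (auto simp: indicator_def)
  qed
qed measurable

lemma K_eq:
  assumes z: "z \<in> {a..b}"
  shows "K z = (\<integral>x. h x \<partial>L) - primitive h (T z)"
proof -
  obtain B where B: "\<And>x. x \<in> {a..b} \<Longrightarrow> \<bar>h x\<bar> \<le> B" using h_bounded by blast
  have i: "integrable L h" by (rule integrable_L_bounded[OF _ B]) simp_all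
  have "K z = (\<integral>x. h x - indicator {..z} (\<Phi> x) * h x \<partial>L)"
    unfolding K_def by (rule Bochner_Integration.integral_cong) (auto simp: indicator_def)
  also have "\<dots> = (\<integral>x. h x \<partial>L) - (\<integral>x. indicator {..z} (\<Phi> x) * h x \<partial>L)"
    using i integrable_\<Phi>_indicator[OF _ h_measurable B, of "{..z}"] by simp
  finally show ?thesis unfolding integral_sublevel[OF z h_measurable] .
qed

lemma sigma_finite_L: "sigma_finite_measure L"
  using finite_L by (simp add: finite_measure_def)

lemma pair_measurable [measurable (raw)]:
  fixes f :: "real \<Rightarrow> real"
  assumes "f \<in> borel_measurable L"
  shows "(\<lambda>p. f (fst p)) \<in> borel_measurable (L \<Otimes>\<^sub>M L)" "(\<lambda>p. f (snd p)) \<in> borel_measurable (L \<Otimes>\<^sub>M L)"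
  by (rule measurable_compose[OF measurable_fst assms], rule measurable_compose[OF measurable_snd assms])

lemma identity_measurable: "(\<lambda>x. x) \<in> borel_measurable L"
  by (rule measurable_L) simp

lemma K_measurable [measurable]: "K \<in> borel_measurable L"
  unfolding K_def[abs_def]
proof (rule sigma_finite_measure.borel_measurable_lebesgue_integral[OF sigma_finite_L])
  note [measurable] = pair_measurable(1)[OF identity_measurable] pair_measurable(2)[OF \<Phi>_measurable]
    pair_measurable(2)[OF h_measurable]
  have "(\<lambda>p. (if fst p < \<Phi> (snd p) then 1 else 0) * h (snd p)) \<in> borel_measurable (L \<Otimes>\<^sub>M L)"
    by measurable
  then show "(\<lambda>(z, x). indicator {z<..} (\<Phi> x) * h x) \<in> borel_measurable (L \<Otimes>\<^sub>M L)"
    by (simp add: indicator_def case_prod_unfold)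
qed

lemma K_bounded: obtains B where "\<And>x. x \<in> {a..b} \<Longrightarrow> \<bar>K x\<bar> \<le> B"
proof -
  obtain B where B: "B > 0" "\<And>x. x \<in> {a..b} \<Longrightarrow> \<bar>h x\<bar> \<le> B" using h_bounded by blast
  have i: "integrable L h" by (rule integrable_L_bounded[OF _ B(2)]) simp_all
  have a: "a \<in> {a..b}" using ab by simp
  show ?thesis
  proof (rule that[of "\<bar>\<integral>x. h x \<partial>L\<bar> + \<bar>primitive h a\<bar> + B * (b - a)"])
    fix z assume z: "z \<in> {a..b}"
    have "\<bar>primitive h (T z) - primitive h a\<bar> \<le> B * \<bar>T z - a\<bar>"
      by (rule primitive_lipschitz[OF h_measurable B(2) a sublevel(1)[OF z]])
    also have "\<dots> \<le> B * (b - a)" using sublevel(1)[OF z] B(1) by (intro mult_left_mono) auto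
    finally show "\<bar>K z\<bar> \<le> \<bar>\<integral>x. h x \<partial>L\<bar> + \<bar>primitive h a\<bar> + B * (b - a)"
      unfolding K_eq[OF z] by linarith
  qed
qed

lemma R_measurable [measurable]: "R \<in> borel_measurable L"
  unfolding R_def[abs_def] by measurable

lemma R_bounded: obtains B where "\<And>x. x \<in> {a..b} \<Longrightarrow> \<bar>R x\<bar> \<le> B"
proof -
  obtain B where B: "\<And>x. x \<in> {a..b} \<Longrightarrow> \<bar>K x\<bar> \<le> B" using K_bounded by blast
  show ?thesis
  proof (rule that[of "(B + \<bar>(\<integral>z. K z \<partial>L) / (b - a)\<bar>) / \<alpha> + \<bar>1 / (b - a)\<bar>"])
    fix z assume z: "z \<in> {a..b}"
    have "\<bar>K z - (\<integral>z. K z \<partial>L) / (b - a)\<bar> \<le> B + \<bar>(\<integral>z. K z \<partial>L) / (b - a)\<bar>"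
      using B[OF z] by linarith
    then have "\<bar>(K z - (\<integral>z. K z \<partial>L) / (b - a)) / \<alpha>\<bar> \<le> (B + \<bar>(\<integral>z. K z \<partial>L) / (b - a)\<bar>) / \<alpha>"
      using \<alpha> by (simp add: abs_divide divide_right_mono)
    then show "\<bar>R z\<bar> \<le> (B + \<bar>(\<integral>z. K z \<partial>L) / (b - a)\<bar>) / \<alpha> + \<bar>1 / (b - a)\<bar>"
      unfolding R_def by linarith
  qed
qed

text \<open>The first variation for the mean-free part of \<open>p\<close>, with the order of integration exchanged.  The
  constants in \<open>R\<close> account for the mean of \<open>p\<close>.\<close>

lemma R_density:
  assumes p: "continuous_on UNIV p"
  shows "(\<integral>z. p z * R z \<partial>L) = (\<integral>x. p (\<Phi> x) \<partial>\<mu>)"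
proof -
  have [measurable]: "p \<in> borel_measurable borel" by (rule borel_measurable_continuous_onI[OF p])
  have cp: "continuous_on {u..v} p" for u v by (rule continuous_on_subset[OF p]) simp
  obtain P where P: "P > 0" "\<And>y. y \<in> {a..b} \<Longrightarrow> \<bar>p y\<bar> \<le> P" using continuous_on_Icc_bounded[OF cp] by metis
  obtain B where B: "B > 0" "\<And>x. x \<in> {a..b} \<Longrightarrow> \<bar>h x\<bar> \<le> B" using h_bounded by blast
  obtain KB where KB: "\<And>x. x \<in> {a..b} \<Longrightarrow> \<bar>K x\<bar> \<le> KB" using K_bounded by blast
  define c where "c = integral {a..b} p / (b - a)"
  define p' where "p' z = p z - c" for z
  have p': "continuous_on UNIV p'" unfolding p'_def[abs_def] by (intro continuous_intros p)
  have cp': "continuous_on {u..v} p'" for u v by (rule continuous_on_subset[OF p']) simp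
  have [measurable]: "p' \<in> borel_measurable borel" by (rule borel_measurable_continuous_onI[OF p'])
  have "((\<lambda>z. p z - c) has_integral integral {a..b} p - (b - a) * c) {a..b}"
    using has_integral_diff[OF integrable_integral[OF integrable_continuous_interval[OF cp]]
        has_integral_const_real[of c a b]] ab by simp
  then have p'0: "integral {a..b} p' = 0"
    using ab unfolding p'_def[abs_def] by (intro integral_unique) (simp add: c_def)
  have prim: "integral {a..y} p' = (\<integral>z. indicator {..<y} z * p' z \<partial>L)" if y: "y \<in> {a..b}" for y
  proof -
    have "integral {a..y} p' = primitive p' y" by (rule primitive_continuous[OF cp' y, symmetric])
    also have "\<dots> = (\<integral>z. indicator {..<y} z * p' z \<partial>L)"
      unfolding primitive_def
      by (rule integral_cong_AE) (use AE_L_neq[of y] in \<open>auto simp: indicator_def elim!: eventually_mono\<close>)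
    finally show ?thesis .
  qed
  interpret LL: pair_sigma_finite L L
    using sigma_finite_L by (simp add: pair_sigma_finite_def)
  have ip: "integrable L p" "integrable L p'" by (rule integrable_L_continuous[OF cp], rule integrable_L_continuous[OF cp'])
  have ih: "integrable L h" by (rule integrable_L_bounded[OF _ B(2)]) simp_all
  have iK: "integrable L K" by (rule integrable_L_bounded[OF _ KB]) simp_all
  have ipK: "integrable L (\<lambda>z. p z * K z)"
  proof (rule integrable_L_bounded)
    show "\<bar>p z * K z\<bar> \<le> P * \<bar>KB\<bar>" if "z \<in> {a..b}" for z
      unfolding abs_mult using P(1) P(2)[OF that] KB[OF that] by (intro mult_mono) auto
  qed measurable
  define k where "k z x = (if z < \<Phi> x then p' z * h x else 0)" for z x
  note [measurable] = pair_measurable(1)[OF identity_measurable] pair_measurable(2)[OF \<Phi>_measurable]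
    pair_measurable(2)[OF h_measurable] pair_measurable(1)[OF measurable_L, of p']
  have k_meas: "case_prod k \<in> borel_measurable (L \<Otimes>\<^sub>M L)"
    unfolding k_def case_prod_unfold by measurable
  have dom: "integrable (L \<Otimes>\<^sub>M L) (\<lambda>(z, x). p' z * h x)"
  proof (rule LL.Fubini_integrable)
    show "(\<lambda>(z, x). p' z * h x) \<in> borel_measurable (L \<Otimes>\<^sub>M L)"
      unfolding case_prod_unfold by measurable
    show "integrable L (\<lambda>z. \<integral>x. norm (case (z, x) of (z, x) \<Rightarrow> p' z * h x) \<partial>L)"
      using ip by (simp add: abs_mult)
    show "AE z in L. integrable L (\<lambda>x. case (z, x) of (z, x) \<Rightarrow> p' z * h x)"
      using ih by simp
  qed
  have ik: "integrable (L \<Otimes>\<^sub>M L) (case_prod k)"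
    by (rule Bochner_Integration.integrable_bound[OF dom k_meas]) (auto simp: k_def)
  have "\<alpha> * (\<integral>x. p' (\<Phi> x) \<partial>\<mu>) = (\<integral>x. integral {a..\<Phi> x} p' * h x \<partial>L)"
    using variation[OF p' p'0] by (simp add: h_def)
  also have "\<dots> = (\<integral>x. (\<integral>z. k z x \<partial>L) \<partial>L)"
  proof (rule Bochner_Integration.integral_cong)
    fix x assume "x \<in> space L"
    then have x: "x \<in> {a..b}" by simp
    have "(\<integral>z. k z x \<partial>L) = (\<integral>z. (indicator {..<\<Phi> x} z * p' z) * h x \<partial>L)"
      by (rule Bochner_Integration.integral_cong) (auto simp: k_def indicator_def)
    then show "integral {a..\<Phi> x} p' * h x = (\<integral>z. k z x \<partial>L)"
      by (simp add: prim[OF \<Phi>_range[OF x]])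
  qed simp
  also have "\<dots> = (\<integral>z. (\<integral>x. k z x \<partial>L) \<partial>L)" by (rule LL.Fubini_integral[OF ik])
  also have "\<dots> = (\<integral>z. p z * K z - c * K z \<partial>L)"
  proof (rule Bochner_Integration.integral_cong)
    fix z
    have "(\<integral>x. k z x \<partial>L) = (\<integral>x. p' z * (indicator {z<..} (\<Phi> x) * h x) \<partial>L)"
      by (rule Bochner_Integration.integral_cong) (auto simp: k_def indicator_def)
    also have "\<dots> = p' z * K z" unfolding K_def by simp
    finally show "(\<integral>x. k z x \<partial>L) = p z * K z - c * K z" by (simp add: p'_def algebra_simps)
  qed simp
  also have "\<dots> = (\<integral>z. p z * K z \<partial>L) - c * (\<integral>z. K z \<partial>L)" using ipK iK by simp
  finally have 1: "\<alpha> * (\<integral>x. p' (\<Phi> x) \<partial>\<mu>) = (\<integral>z. p z * K z \<partial>L) - c * (\<integral>z. K z \<partial>L)" .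
  interpret prob_space \<mu> by (rule prob)
  have "integrable \<mu> (\<lambda>x. p (\<Phi> x))"
    by (rule integrable_\<mu>_bounded[of _ P]) (use P \<Phi>_range in auto)
  then have 2: "(\<integral>x. p' (\<Phi> x) \<partial>\<mu>) = (\<integral>x. p (\<Phi> x) \<partial>\<mu>) - c"
    using prob_space by (simp add: p'_def)
  have 3: "(\<integral>z. p z \<partial>L) = c * (b - a)"
    using ab integral_L_continuous[OF cp] by (simp add: c_def)
  define e where "e = (\<integral>z. K z \<partial>L) / (b - a)"
  have "(\<integral>z. p z * R z \<partial>L) = (\<integral>z. (p z * K z) / \<alpha> + (1 / (b - a) - e / \<alpha>) * p z \<partial>L)"
    by (rule Bochner_Integration.integral_cong)
      (simp_all add: R_def e_def[symmetric] algebra_simps diff_divide_distrib)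
  also have "\<dots> = (\<integral>z. p z * K z \<partial>L) / \<alpha> + (1 / (b - a) - e / \<alpha>) * (c * (b - a))"
    using ipK ip by (simp add: 3)
  also have "\<dots> = ((\<integral>z. p z * K z \<partial>L) - c * (\<integral>z. K z \<partial>L)) / \<alpha> + c"
  proof -
    have "(1 / d - J / d / \<alpha>) * (c * d) = c - c * J / \<alpha>" if "d \<noteq> 0" for d J
      using that \<alpha> by (simp add: field_simps)
    from this[of "b - a" "\<integral>z. K z \<partial>L"] show ?thesis using ab by (simp add: e_def diff_divide_distrib)
  qed
  also have "\<dots> = (\<integral>x. p (\<Phi> x) \<partial>\<mu>)" using 1 2 \<alpha> by (simp add: field_simps)
  finally show ?thesis .
qed

text \<open>Testing with continuous approximations of the indicator of \<open>(-\<infinity>, y]\<close> gives the distribution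
  function of the push-forward.\<close>

lemma S_eq:
  assumes y: "y \<in> {a..b}"
  shows "S y = primitive m (T y)"
proof -
  define p where "p i z = max 0 (min 1 (1 - real i * (z - y)))" for i :: nat and z
  have p01: "\<bar>p i z\<bar> \<le> 1" for i z by (auto simp: p_def)
  have cp: "continuous_on UNIV (p i)" for i unfolding p_def[abs_def] by (intro continuous_intros)
  have [measurable]: "p i \<in> borel_measurable borel" for i by (rule borel_measurable_continuous_onI[OF cp])
  have lim: "(\<lambda>i. p i z) \<longlonglongrightarrow> indicator {..y} z" for z
  proof (cases "z \<le> y")
    case True
    then have "p i z = 1" for i by (auto simp: p_def mult_nonneg_nonpos)
    then show ?thesis using True by simp
  next
    case False
    obtain N where N: "1 / (z - y) < real N" using reals_Archimedean2 by blast
    have "p i z = 0" if "i \<ge> N" for i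
    proof -
      have "1 / (z - y) < real i" using N that by linarith
      then have "1 < real i * (z - y)" using False by (simp add: field_simps)
      then show ?thesis by (simp add: p_def)
    qed
    then show ?thesis using False
      by (intro tendsto_eventually) (auto simp: eventually_sequentially)
  qed
  obtain B where B: "\<And>x. x \<in> {a..b} \<Longrightarrow> \<bar>R x\<bar> \<le> B" using R_bounded by blast
  have iR: "integrable L R" by (rule integrable_L_bounded[OF _ B]) simp_all
  have 1: "(\<lambda>i. \<integral>z. p i z * R z \<partial>L) \<longlonglongrightarrow> (\<integral>z. indicator {..y} z * R z \<partial>L)"
  proof (rule integral_dominated_convergence[where w = "\<lambda>z. \<bar>R z\<bar>"])
    show "AE z in L. (\<lambda>i. p i z * R z) \<longlonglongrightarrow> indicator {..y} z * R z"
      by (intro AE_I2 tendsto_mult lim tendsto_const)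
    show "AE z in L. norm (p i z * R z) \<le> \<bar>R z\<bar>" for i
      by (intro AE_I2) (simp add: abs_mult mult_left_le_one_le p01)
  qed (use iR in auto)
  have "(\<lambda>i. \<integral>x. p i (\<Phi> x) \<partial>\<mu>) \<longlonglongrightarrow> (\<integral>x. indicator {..y} (\<Phi> x) \<partial>\<mu>)"
  proof (rule integral_dominated_convergence[where w = "\<lambda>_. 1"])
    interpret prob_space \<mu> by (rule prob)
    show "integrable \<mu> (\<lambda>_. 1 :: real)" by simp
    show "AE x in \<mu>. (\<lambda>i. p i (\<Phi> x)) \<longlonglongrightarrow> indicator {..y} (\<Phi> x)" by (intro AE_I2 lim)
    show "AE x in \<mu>. norm (p i (\<Phi> x)) \<le> 1" for i by (intro AE_I2) (simp add: p01)
  qed auto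
  then have 2: "(\<lambda>i. \<integral>z. p i z * R z \<partial>L) \<longlonglongrightarrow> (\<integral>x. indicator {..y} (\<Phi> x) \<partial>\<mu>)"
    by (simp add: R_density[OF cp])
  have "S y = (\<integral>x. indicator {..y} (\<Phi> x) \<partial>\<mu>)"
    unfolding S_def primitive_def by (rule LIMSEQ_unique[OF 1 2])
  also have "\<dots> = (\<integral>x. indicator {..y} (\<Phi> x) * m x \<partial>L)"
    by (subst integral_\<mu>) (auto simp: mult.commute)
  finally show ?thesis unfolding integral_sublevel[OF y measurable_m] .
qed

lemma m_bounds:
  obtains m0 m1 where "0 < m0" "m0 \<le> m1" "\<And>x. x \<in> {a..b} \<Longrightarrow> m0 \<le> m x \<and> m x \<le> m1"
  using continuous_on_Icc_pos_bounds[OF ab m_cont m_pos] by metis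

text \<open>\<open>R\<close> is a Lipschitz function of \<open>T\<close> and \<open>T\<close> one of the distribution function \<open>S\<close>, whose derivative
  is \<open>R\<close>: an autonomous differential equation in disguise.\<close>

lemma R_lipschitz_S:
  obtains c where "\<And>y z. y \<in> {a..b} \<Longrightarrow> z \<in> {a..b} \<Longrightarrow> \<bar>R y - R z\<bar> \<le> c * \<bar>S y - S z\<bar>"
proof -
  obtain B where B: "B > 0" "\<And>x. x \<in> {a..b} \<Longrightarrow> \<bar>h x\<bar> \<le> B" using h_bounded by blast
  obtain m0 m1 where m: "0 < m0" "m0 \<le> m1" "\<And>x. x \<in> {a..b} \<Longrightarrow> m0 \<le> m x \<and> m x \<le> m1" using m_bounds by blast
  have TS: "\<bar>T y - T z\<bar> * m0 \<le> \<bar>S y - S z\<bar>" if y: "y \<in> {a..b}" and z: "z \<in> {a..b}" for y z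
  proof -
    note ty = sublevel(1)[OF y] and tz = sublevel(1)[OF z]
    show ?thesis
    proof (cases "T z \<le> T y")
      case True
      then show ?thesis
        using primitive_bounds(1)[OF measurable_m m(3), of "T z" "T y"] ty tz
        unfolding S_eq[OF y] S_eq[OF z] by auto
    next
      case False
      then show ?thesis
        using primitive_bounds(1)[OF measurable_m m(3), of "T y" "T z"] ty tz
        unfolding S_eq[OF y] S_eq[OF z] by auto
    qed
  qed
  show ?thesis
  proof (rule that[of "B / \<alpha> / m0"])
    fix y z assume y: "y \<in> {a..b}" and z: "z \<in> {a..b}"
    have "\<bar>R y - R z\<bar> = \<bar>K y - K z\<bar> / \<alpha>"
      using \<alpha> by (simp add: R_def diff_divide_distrib[symmetric] abs_divide)
    also have "\<bar>K y - K z\<bar> = \<bar>primitive h (T z) - primitive h (T y)\<bar>" unfolding K_eq[OF y] K_eq[OF z] by simp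
    also have "\<dots> / \<alpha> \<le> B * \<bar>T z - T y\<bar> / \<alpha>"
      using \<alpha> by (intro divide_right_mono primitive_lipschitz B h_measurable sublevel y z) auto
    also have "\<dots> \<le> B * (\<bar>S y - S z\<bar> / m0) / \<alpha>"
      using TS[OF y z] m(1) B(1) \<alpha>
      by (intro divide_right_mono mult_left_mono) (auto simp: pos_le_divide_eq abs_minus_commute)
    finally show "\<bar>R y - R z\<bar> \<le> B / \<alpha> / m0 * \<bar>S y - S z\<bar>" by (simp add: field_simps)
  qed
qed

lemma S_lipschitz:
  obtains c where "c > 0" "\<And>y z. y \<in> {a..b} \<Longrightarrow> z \<in> {a..b} \<Longrightarrow> \<bar>S y - S z\<bar> \<le> c * \<bar>y - z\<bar>"
proof -
  obtain B where B: "\<And>x. x \<in> {a..b} \<Longrightarrow> \<bar>R x\<bar> \<le> B" using R_bounded by blast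
  have B': "\<bar>R x\<bar> \<le> \<bar>B\<bar> + 1" if "x \<in> {a..b}" for x using B[OF that] by linarith
  show ?thesis
    by (rule that[of "\<bar>B\<bar> + 1"]) (use primitive_lipschitz[OF R_measurable B'] in \<open>auto simp: S_def\<close>)
qed

lemma lipschitz_continuous:
  fixes f :: "real \<Rightarrow> real"
  assumes "\<And>y z. y \<in> {a..b} \<Longrightarrow> z \<in> {a..b} \<Longrightarrow> \<bar>f y - f z\<bar> \<le> c * \<bar>g y - g z\<bar>" "continuous_on {a..b} g"
  shows "continuous_on {a..b} f"
  unfolding continuous_on_def
proof
  fix y assume y: "y \<in> {a..b}"
  have "((\<lambda>z. c * \<bar>g z - g y\<bar>) \<longlongrightarrow> c * \<bar>g y - g y\<bar>) (at y within {a..b})"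
    using assms(2) y by (intro tendsto_intros) (simp add: continuous_on_def)
  then have l: "((\<lambda>z. c * \<bar>g z - g y\<bar>) \<longlongrightarrow> 0) (at y within {a..b})" by simp
  have "\<forall>\<^sub>F z in at y within {a..b}. z \<in> {a..b}" by (simp add: eventually_at_filter)
  then have "\<forall>\<^sub>F z in at y within {a..b}. norm (f z - f y) \<le> c * \<bar>g z - g y\<bar>"
    by eventually_elim (use assms(1) y in auto)
  from Lim_null_comparison[OF this l] show "(f \<longlongrightarrow> f y) (at y within {a..b})" by (simp add: LIM_zero_iff)
qed

lemma S_cont: "continuous_on {a..b} S"
proof -
  obtain c where c: "\<And>y z. y \<in> {a..b} \<Longrightarrow> z \<in> {a..b} \<Longrightarrow> \<bar>S y - S z\<bar> \<le> c * \<bar>y - z\<bar>"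
    using S_lipschitz by blast
  show ?thesis by (rule lipschitz_continuous[OF c continuous_on_id])
qed

lemma R_cont: "continuous_on {a..b} R"
proof -
  obtain c where c: "\<And>y z. y \<in> {a..b} \<Longrightarrow> z \<in> {a..b} \<Longrightarrow> \<bar>R y - R z\<bar> \<le> c * \<bar>S y - S z\<bar>"
    using R_lipschitz_S by blast
  show ?thesis by (rule lipschitz_continuous[OF c S_cont])
qed

lemma S_deriv: "y \<in> {a..b} \<Longrightarrow> (S has_real_derivative R y) (at y within {a..b})"
  unfolding S_def[abs_def] by (rule primitive_DERIV[OF R_cont])

lemma S_a: "S a = 0" and S_b: "S b = 1"
proof -
  have a: "a \<in> {a..b}" and b: "b \<in> {a..b}" using ab by auto
  show "S a = 0" unfolding S_def primitive_continuous[OF R_cont a] by simp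
  have "T b = b" using sublevel(1)[OF b] sublevel(2)[OF b, of b] b \<Phi>_ends by auto
  then have "S b = (\<integral>x. indicator {..b} x * m x \<partial>L)" unfolding S_eq[OF b] primitive_def by simp
  also have "\<dots> = (\<integral>x. m x * 1 \<partial>L)"
    by (rule Bochner_Integration.integral_cong) (auto simp: indicator_def)
  also have "\<dots> = (\<integral>x. 1 \<partial>\<mu>)" by (rule integral_\<mu>[symmetric]) simp
  also have "\<dots> = 1"
  proof -
    interpret prob_space \<mu> by (rule prob)
    show ?thesis using prob_space by simp
  qed
  finally show "S b = 1" .
qed

text \<open>If the density vanished at one point, the distribution function would be constant by the
  uniqueness for that differential equation.\<close>

lemma R_pos:
  assumes y: "y \<in> {a..b}" shows "R y > 0"
proof -
  have a: "a \<in> {a..b}" and b: "b \<in> {a..b}" using ab by auto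
  obtain c where c: "\<And>y z. y \<in> {a..b} \<Longrightarrow> z \<in> {a..b} \<Longrightarrow> \<bar>R y - R z\<bar> \<le> c * \<bar>S y - S z\<bar>" using R_lipschitz_S by blast
  have ne: "R z \<noteq> 0" if z: "z \<in> {a..b}" for z
  proof
    assume "R z = 0"
    then have le: "\<bar>R y\<bar> \<le> c * \<bar>S y - S z\<bar>" if "y \<in> {a..b}" for y using c[OF that z] by simp
    have "S y = S z" if "y \<in> {a..b}" for y by (rule gronwall_constant[OF S_deriv z that le])
    from this[OF a] this[OF b] show False using S_a S_b by simp
  qed
  obtain z where z: "z \<in> {a..b}" "S b - S a = R z * (b - a)" by (rule MVT_Icc[OF S_deriv a b])
  then have "R z * (b - a) = 1" using S_a S_b by simp
  then have "R z = 1 / (b - a)" using ab by (simp add: field_simps)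
  then have Rz: "R z > 0" using ab by simp
  show ?thesis
  proof (rule ccontr)
    assume "\<not> R y > 0"
    then have "R y \<le> 0" by simp
    moreover have sub: "closed_segment y z \<subseteq> {a..b}"
      using y z by (auto simp: closed_segment_eq_real_ivl)
    ultimately have "\<exists>x\<in>closed_segment y z. R x = 0"
      using Rz IVT'[of R y 0 z] IVT2'[of R y 0 z] continuous_on_subset[OF R_cont sub]
      by (cases "y \<le> z") (auto simp: closed_segment_eq_real_ivl)
    then show False using ne sub by blast
  qed
qed

text \<open>The inequality \<open>T (\<Phi> x) \<ge> x\<close> gives one direction.  For \<open>y < \<Phi> x\<close> one has \<open>T y \<le> x\<close>, and the
  continuity of \<open>S\<close> gives the other.  In particular \<open>\<Phi>\<close> can have no flat pieces.\<close>

lemma S_\<Phi>: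
  assumes x: "x \<in> {a..b}"
  shows "S (\<Phi> x) = primitive m x"
proof -
  note r = \<Phi>_range[OF x]
  obtain m0 m1 where m: "0 < m0" "m0 \<le> m1" "\<And>x. x \<in> {a..b} \<Longrightarrow> m0 \<le> m x \<and> m x \<le> m1" using m_bounds by blast
  have mono: "primitive m s \<le> primitive m t" if "s \<in> {a..b}" "t \<in> {a..b}" "s \<le> t" for s t
  proof -
    have "0 \<le> (t - s) * m0" using that m by simp
    then show ?thesis using primitive_bounds(1)[OF measurable_m m(3), of s t] that by auto
  qed
  have le: "S y \<le> primitive m x" if y: "y \<in> {a..b}" "y < \<Phi> x" for y
  proof -
    have "T y \<le> x" using sublevel(3)[OF y(1) x] y(2) by force
    then show ?thesis unfolding S_eq[OF y(1)] by (rule mono[OF sublevel(1)[OF y(1)] x])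
  qed
  have "S (\<Phi> x) \<le> primitive m x"
  proof (cases "\<Phi> x = a")
    case True
    have a: "a \<in> {a..b}" using ab by simp
    have "primitive m a = 0" unfolding primitive_continuous[OF m_cont a] by simp
    then show ?thesis using True S_a mono[OF a x] x by simp
  next
    case False
    then have ax: "a < \<Phi> x" using r by simp
    have "(S \<longlongrightarrow> S (\<Phi> x)) (at (\<Phi> x) within {a..b})"
      using S_cont r unfolding continuous_on_def by blast
    then have "(S \<longlongrightarrow> S (\<Phi> x)) (at (\<Phi> x) within {a..\<Phi> x})"
      by (rule tendsto_within_subset) (use r in simp)
    then have "(S \<longlongrightarrow> S (\<Phi> x)) (at_left (\<Phi> x))" using ax by (simp add: at_within_Icc_at_left)
    moreover have "\<forall>\<^sub>F y in at_left (\<Phi> x). S y \<le> primitive m x"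
      unfolding eventually_at_left_field using ax le r by (intro exI[of _ a]) auto
    ultimately show ?thesis by (rule tendsto_upperbound) simp
  qed
  moreover have "primitive m x \<le> S (\<Phi> x)"
    unfolding S_eq[OF r] by (rule mono[OF x sublevel(1)[OF r] sublevel(2)[OF r x]]) simp
  ultimately show ?thesis by simp
qed

lemma T_\<Phi>:
  assumes x: "x \<in> {a..b}"
  shows "T (\<Phi> x) = x"
proof (rule ccontr)
  note r = \<Phi>_range[OF x]
  assume "T (\<Phi> x) \<noteq> x"
  then have less: "x < T (\<Phi> x)" using sublevel(2)[OF r x] by simp
  obtain m0 m1 where m: "0 < m0" "m0 \<le> m1" "\<And>x. x \<in> {a..b} \<Longrightarrow> m0 \<le> m x \<and> m x \<le> m1" using m_bounds by blast
  have "0 < (T (\<Phi> x) - x) * m0" using less m by simp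
  also have "\<dots> \<le> primitive m (T (\<Phi> x)) - primitive m x"
    using primitive_bounds(1)[OF measurable_m m(3), of x "T (\<Phi> x)"] less x sublevel(1)[OF r] by auto
  finally show False using S_eq[OF r] S_\<Phi>[OF x] by simp
qed

text \<open>\<open>R > 0\<close> makes \<open>S\<close> strictly increasing with slopes bounded below, so \<open>\<Phi> = S\<^sup>-\<^sup>1 \<circ> primitive m\<close> has
  no jumps.\<close>

lemma \<Phi>_cont: "continuous_on {a..b} \<Phi>"
proof -
  have a: "a \<in> {a..b}" using ab by auto
  obtain l u where l: "0 < l" "l \<le> u" "\<And>y. y \<in> {a..b} \<Longrightarrow> l \<le> R y \<and> R y \<le> u"
    using continuous_on_Icc_pos_bounds[OF ab R_cont R_pos] by metis
  have "\<bar>\<Phi> x - \<Phi> y\<bar> \<le> 1 / l * \<bar>primitive m x - primitive m y\<bar>" if x: "x \<in> {a..b}" and y: "y \<in> {a..b}" for x y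
  proof -
    obtain z where z: "z \<in> {a..b}" "S (\<Phi> x) - S (\<Phi> y) = R z * (\<Phi> x - \<Phi> y)"
      by (rule MVT_Icc[OF S_deriv \<Phi>_range[OF y] \<Phi>_range[OF x]])
    have "l * \<bar>\<Phi> x - \<Phi> y\<bar> \<le> R z * \<bar>\<Phi> x - \<Phi> y\<bar>" using l(3)[OF z(1)] by (intro mult_right_mono) auto
    also have "\<dots> = \<bar>primitive m x - primitive m y\<bar>"
      using z(2) R_pos[OF z(1)] by (simp add: S_\<Phi>[OF x] S_\<Phi>[OF y] abs_mult)
    finally show ?thesis using l(1) by (simp add: field_simps)
  qed
  moreover have "continuous_on {a..b} (primitive m)"
    by (rule DERIV_continuous_on[OF primitive_DERIV[OF m_cont]])
  ultimately show ?thesis by (rule lipschitz_continuous)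
qed

lemma \<Phi>_deriv:
  assumes x: "x \<in> {a..b}"
  shows "(\<Phi> has_real_derivative m x / R (\<Phi> x)) (at x within {a..b})"
proof (rule implicit_DERIV[where f = "\<lambda>_. S" and f' = "\<lambda>_. R" and g = "primitive m"])
  show "continuous_on ({a..b} \<times> {a..b}) (\<lambda>p. R (snd p))"
    by (rule continuous_on_compose2[OF R_cont, of _ snd]) (auto intro!: continuous_intros)
  show "(\<Phi> \<longlongrightarrow> \<Phi> x) (at x within {a..b})" using \<Phi>_cont x by (auto simp: continuous_on_def)
  show "((\<lambda>s. primitive m s - S (\<Phi> x)) has_real_derivative m x) (at x within {a..b})"
    using DERIV_diff[OF primitive_DERIV[OF m_cont x] DERIV_const] by simp
qed (rule S_deriv R_pos S_\<Phi> \<Phi>_range x | assumption)+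

lemma R_\<Phi>_deriv:
  assumes x: "x \<in> {a..b}"
  shows "((\<lambda>x. R (\<Phi> x)) has_real_derivative - h x / \<alpha>) (at x within {a..b})"
proof -
  have ch: "continuous_on {a..b} h"
    unfolding h_def[abs_def] by (intro continuous_intros m_cont G \<Phi>_cont)
  define e where "e = (\<integral>z. K z \<partial>L) / (b - a)"
  have eq: "R (\<Phi> x) = ((\<integral>x. h x \<partial>L) - primitive h x - e) / \<alpha> + 1 / (b - a)" if "x \<in> {a..b}" for x
    unfolding R_def e_def[symmetric] K_eq[OF \<Phi>_range[OF that]] T_\<Phi>[OF that] ..
  have "((\<lambda>x. ((\<integral>x. h x \<partial>L) - primitive h x - e) / \<alpha> + 1 / (b - a)) has_real_derivative
      (0 - h x - 0) / \<alpha> + 0) (at x within {a..b})"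
    by (intro DERIV_add DERIV_cdivide DERIV_diff DERIV_const primitive_DERIV[OF ch x])
  then have "((\<lambda>x. ((\<integral>x. h x \<partial>L) - primitive h x - e) / \<alpha> + 1 / (b - a)) has_real_derivative
      - h x / \<alpha>) (at x within {a..b})" by simp
  then show ?thesis by (rule DERIV_cong_within_Icc[rotated 2]) (use eq x in simp_all)
qed

end

theorem (in transport_problem) minimizer_euler_lagrange:
  assumes min: "is_minimizer_in (helly_space a b) (F_functional \<alpha> f \<mu>) \<Phi>"
    and f: "\<And>\<Psi>. \<Psi> \<in> helly_space a b \<Longrightarrow> f \<Psi> = (\<integral>x. \<Psi> x * G x \<partial>L) + B"
    and G: "continuous_on {a..b} G"
  shows "\<exists>q. \<forall>x\<in>{a..b}. q x > 0 \<and> (\<Phi> has_real_derivative m x / q x) (at x within {a..b}) \<and>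
     (q has_real_derivative (G x - m x * (\<Phi> x - x)) / \<alpha>) (at x within {a..b})"
proof -
  interpret transport_minimizer a b \<alpha> m \<mu> G \<Phi>
  proof
    show "\<Phi> \<in> helly_space a b" using min by (simp add: is_minimizer_in_def)
  qed (use G first_variation[OF min f G] in auto)
  show ?thesis
  proof (intro exI[of _ "\<lambda>x. R (\<Phi> x)"] ballI conjI)
    fix x assume x: "x \<in> {a..b}"
    show "0 < R (\<Phi> x)" by (rule R_pos[OF \<Phi>_range[OF x]])
    show "(\<Phi> has_real_derivative m x / R (\<Phi> x)) (at x within {a..b})" by (rule \<Phi>_deriv[OF x])
    show "((\<lambda>x. R (\<Phi> x)) has_real_derivative (G x - m x * (\<Phi> x - x)) / \<alpha>) (at x within {a..b})"
      using R_\<Phi>_deriv[OF x] by (simp add: h_def)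
  qed
qed

section \<open>Minimizers solve the information geometric regularization equation\<close>

theorem theorem5p9:
  fixes a b \<alpha> :: real and k :: nat
    and m u0 :: "real \<Rightarrow> real" and \<mu> :: "real measure"
    and \<Phi> u \<rho> :: "real \<Rightarrow> real \<Rightarrow> real"
  assumes "a < b" and "\<alpha> > 0"
    and "prob_space \<mu>"
    and "\<mu> = density (restrict_space lborel {a..b}) (\<lambda>x. ennreal (m x))"
    and "Ck_on {a..b} (k + 1) m" and "\<And>x. x \<in> {a..b} \<Longrightarrow> m x > 0"
    and "Ck_on {a..b} (k + 2) u0" and "u0 a = 0" and "u0 b = 0"
    and "\<And>t. t \<ge> 0 \<Longrightarrow>
           is_minimizer_in (helly_space a b)
             (F_functional \<alpha> (f_functional a b \<alpha> m (\<lambda>x. t * u0 x)) \<mu>) (\<Phi> t)"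
    and "\<And>t x. t \<ge> 0 \<Longrightarrow> x \<in> {a..b} \<Longrightarrow>
           u t x = pd {0..} (\<lambda>s. \<Phi> s (the_inv_into {a..b} (\<Phi> t) x)) t"
    and "\<And>t x. t \<ge> 0 \<Longrightarrow> x \<in> {a..b} \<Longrightarrow>
           \<rho> t x = (let y = the_inv_into {a..b} (\<Phi> t) x in m y / pd {a..b} (\<Phi> t) y)"
  shows
    "(\<forall>t\<ge>0. bij_betw (\<Phi> t) {a..b} {a..b} \<and> \<Phi> t differentiable_on {a..b} \<and>
        (\<forall>y\<in>{a..b}. pd {a..b} (\<Phi> t) y \<noteq> 0 \<and>
                    (\<lambda>s. \<Phi> s y) differentiable (at t within {0..}))) \<and>
     C0_curve {a..b} (k + 2) u \<and> C1_curve {a..b} (k + 1) u \<and>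
     C0_curve {a..b} (k + 1) \<rho> \<and> C1_curve {a..b} k \<rho> \<and>
     (\<exists>\<Sigma>. IGR_solution a b \<alpha> u0 m u \<rho> \<Sigma> \<and>
        (\<forall>t\<ge>0. \<forall>S. IGR_pressure a b \<alpha> (\<rho> t) (u t) S \<longrightarrow> (\<forall>x\<in>{a..b}. S x = \<Sigma> t x)))"
proof -
  note ab = assms(1) and \<alpha> = assms(2) and m_pos = assms(6)
  let ?I = "{a..b}"
  have m: "m differentiable_on ?I" "Ck_on ?I k (pd ?I m)"
    using assms(5) by (simp_all add: Ck_on_Suc_iff)
  have "Ck_on ?I (Suc (Suc k)) u0" using assms(7) by simp
  then have u0: "u0 differentiable_on ?I" "pd ?I u0 differentiable_on ?I"
    "Ck_on ?I (Suc k) (pd ?I u0)" "Ck_on ?I k (pd ?I (pd ?I u0))"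
    using Ck_on_Suc_iff by blast+
  define m' where "m' = pd ?I m"
  define v0 where "v0 = pd ?I u0"
  define c where "c x = m x * pd ?I v0 x + m' x * v0 x" for x
  define n where "n = (\<lambda>x. m x / \<alpha>)"
  define g0 where "g0 x = m' x + n x * x" for x
  define g1 where "g1 x = n x * u0 x - c x" for x
  note dm = has_field_derivative_pd[OF ab m(1), folded m'_def]
  note du = has_field_derivative_pd[OF ab u0(1), folded v0_def]
  note dv = has_field_derivative_pd[OF ab u0(2), folded v0_def]
  have dmv: "((\<lambda>x. m x * v0 x) has_real_derivative c x) (at x within ?I)" if "x \<in> ?I" for x
    by (rule DERIV_cong[OF DERIV_mult[OF dm[OF that] dv[OF that]]]) (simp add: c_def mult.commute)
  have i: "k \<le> k + 1" "k \<le> k + 2" by auto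
  have m_Ck: "Ck_family a b (k + 1) (\<lambda>_. m)" by (rule Ck_on_imp_family[OF ab assms(5)])
  have m'_Ck: "Ck_family a b k (\<lambda>_. m')" unfolding m'_def by (rule Ck_on_imp_family[OF ab m(2)])
  have u0_Ck: "Ck_family a b (k + 2) (\<lambda>_. u0)" by (rule Ck_on_imp_family[OF ab assms(7)])
  have v0_Ck: "Ck_family a b (k + 1) (\<lambda>_. v0)"
    unfolding v0_def using Ck_on_imp_family[OF ab u0(3)] by simp
  have v0'_Ck: "Ck_family a b k (\<lambda>_. pd ?I v0)"
    unfolding v0_def by (rule Ck_on_imp_family[OF ab u0(4)])
  have c_Ck: "Ck_family a b k (\<lambda>_. c)"
    unfolding c_def[abs_def]
    by (intro Ck_family_add Ck_family_mult v0'_Ck m'_Ck Ck_family_mono[OF m_Ck i(1)] Ck_family_mono[OF v0_Ck i(1)])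
  have n_Ck: "Ck_family a b k (\<lambda>_. n)"
    using Ck_family_mult[OF Ck_family_mono[OF m_Ck i(1)] Ck_family_const[of a b k "1 / \<alpha>"]]
    by (simp add: n_def)
  have "Ck_on ?I k (\<lambda>x. x)"
  proof -
    have "Ck_family a b k (\<lambda>_ x. x)"
    proof (cases k)
      case 0
      then show ?thesis using jcont_space[OF continuous_on_id] by simp
    next
      case (Suc l)
      show ?thesis unfolding Suc
        by (rule Ck_family_SucI[OF jcont_space[OF continuous_on_id] DERIV_ident Ck_family_const])
    qed
    then show ?thesis by (rule Ck_family_imp_Ck_on[OF ab _ order_refl])
  qed
  note id_Ck = Ck_on_imp_family[OF ab this]
  have g0_Ck: "Ck_family a b k (\<lambda>_. g0)"
    unfolding g0_def[abs_def] by (intro Ck_family_add Ck_family_mult m'_Ck n_Ck id_Ck)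
  have g1_Ck: "Ck_family a b k (\<lambda>_. g1)"
    unfolding g1_def[abs_def]
    by (intro Ck_family_diff Ck_family_mult n_Ck c_Ck Ck_family_mono[OF u0_Ck i(2)])
  have cont: "continuous_on ?I f" if "Ck_family a b j (\<lambda>_. f)" for f j
    using jcont_slice[OF Ck_family_jcont[OF that], of 0] by simp
  \<comment> \<open>Divided by \<open>\<alpha>\<close>, the Euler--Lagrange equation has the right side \<open>g0 + t g1 - n \<Phi>\<close>.\<close>
  interpret TP: transport_problem a b \<alpha> m \<mu>
    by (rule transport_problem.intro) (fact ab \<alpha> cont[OF m_Ck] m_pos assms(4,3))+
  define Q where "Q t q \<longleftrightarrow> (\<forall>x\<in>?I. q x > 0 \<and> (\<Phi> t has_real_derivative m x / q x) (at x within ?I) \<and>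
       (q has_real_derivative g0 x + t * g1 x - n x * \<Phi> t x) (at x within ?I))" for t q
  have helly: "\<Phi> t \<in> helly_space a b" if "t \<ge> 0" for t
    using assms(10)[OF that] by (simp add: is_minimizer_in_def)
  have "\<exists>q. Q t q" if t: "t \<ge> 0" for t
  proof -
    define w where "w x = t * u0 x" for x
    define G where "G x = w x * m x - \<alpha> * pd ?I (\<lambda>y. m y * pd ?I w y) x + \<alpha> * pd ?I m x" for x
    have dw: "pd ?I w x = t * v0 x" if "x \<in> ?I" for x
      unfolding w_def[abs_def] by (rule pd_eqI[OF ab that DERIV_cmult[OF du[OF that]]])
    have "pd ?I (\<lambda>y. m y * pd ?I w y) x = t * c x" if x: "x \<in> ?I" for x
    proof -
      have "pd ?I (\<lambda>y. m y * pd ?I w y) x = pd ?I (\<lambda>y. t * (m y * v0 y)) x"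
        by (rule pd_cong[OF _ x]) (simp add: dw)
      also have "\<dots> = t * c x" by (rule pd_eqI[OF ab x DERIV_cmult[OF dmv[OF x]]])
      finally show ?thesis .
    qed
    then have G_eq: "t * u0 x * m x - \<alpha> * (t * c x) + \<alpha> * m' x = G x" if "x \<in> ?I" for x
      using that by (simp add: G_def w_def m'_def)
    have "continuous_on ?I (\<lambda>x. t * u0 x * m x - \<alpha> * (t * c x) + \<alpha> * m' x)"
      by (intro continuous_intros cont[OF u0_Ck] cont[OF m_Ck] cont[OF c_Ck] cont[OF m'_Ck])
    then have G_cont: "continuous_on ?I G" by (rule continuous_on_eq) (rule G_eq)
    define B where "B = \<alpha> * (m b * pd ?I w b * b - m a * pd ?I w a * a) - \<alpha> * (m b * b - m a * a)"
    have f: "f_functional a b \<alpha> m w \<Psi> = (\<integral>x. \<Psi> x * G x \<partial>TP.L) + B"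
      if "\<Psi> \<in> helly_space a b" for \<Psi>
      using TP.hellyD(4,5)[OF that]
      by (simp add: f_functional_def Let_def G_def[symmetric] TP.integral_L B_def)
    have "is_minimizer_in (helly_space a b) (F_functional \<alpha> (f_functional a b \<alpha> m w) \<mu>) (\<Phi> t)"
      using assms(10)[OF t] by (simp add: w_def[abs_def])
    from TP.minimizer_euler_lagrange[OF this f G_cont]
    obtain q where q: "\<forall>x\<in>?I. q x > 0 \<and> (\<Phi> t has_real_derivative m x / q x) (at x within ?I) \<and>
       (q has_real_derivative (G x - m x * (\<Phi> t x - x)) / \<alpha>) (at x within ?I)" by blast
    have "(G x - m x * (\<Phi> t x - x)) / \<alpha> = g0 x + t * g1 x - n x * \<Phi> t x" if "x \<in> ?I" for x
      using \<alpha> by (simp add: G_eq[OF that, symmetric] g0_def g1_def n_def field_simps)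
    then have Qq: "Q t q" using q unfolding Q_def by simp
    show "\<exists>q. Q t q" by (rule exI[of _ q], rule Qq)
  qed
  then have "\<forall>t. \<exists>q. t \<ge> 0 \<longrightarrow> Q t q" by blast
  from choice[OF this] obtain q where "\<forall>t. t \<ge> 0 \<longrightarrow> Q t (q t)" ..
  then have q: "q t x > 0" "(\<Phi> t has_real_derivative m x / q t x) (at x within ?I)"
    "(q t has_real_derivative g0 x + t * g1 x - n x * \<Phi> t x) (at x within ?I)"
    if "t \<ge> 0" "x \<in> ?I" for t x
    using that unfolding Q_def by auto
  have n_pos: "n x > 0" if "x \<in> ?I" for x using m_pos[OF that] \<alpha> by (simp add: n_def)
  have m_d: "(m has_real_derivative g0 x - n x * x) (at x within ?I)" if "x \<in> ?I" for x
    using dm[OF that] by (simp add: g0_def)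
  have mv_d: "((\<lambda>x. m x * v0 x) has_real_derivative n x * u0 x - g1 x) (at x within ?I)" if "x \<in> ?I" for x
    using dmv[OF that] by (simp add: g1_def)
  interpret F: igr_flow a b m n g0 g1 \<Phi> q \<alpha> k u0 v0
    by unfold_locales
      (fact ab \<alpha> cont[OF m_Ck] cont[OF n_Ck] cont[OF g0_Ck] cont[OF g1_Ck] m_pos n_pos q
        TP.hellyD(4,5)[OF helly] n_def m_Ck g0_Ck g1_Ck m_d du mv_d assms(8,9))+
  have pd_\<Phi>: "pd ?I (\<Phi> t) x = m x / q t x" if "t \<ge> 0" "x \<in> ?I" for t x
    by (rule pd_eqI[OF ab that(2) q(2)[OF that]])
  have \<rho>: "\<rho> t x = q t (F.T t x)" if tx: "t \<ge> 0" "x \<in> ?I" for t x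
    using m_pos[OF F.T_range[OF tx]] q(1)[OF tx(1) F.T_range[OF tx]]
    by (simp add: assms(12)[OF tx] Let_def F.T_def[symmetric] pd_\<Phi>[OF tx(1) F.T_range[OF tx]])
  have u: "u t x = pd {0..} (\<lambda>s. \<Phi> s (F.T t x)) t" if "t \<ge> 0" "x \<in> ?I" for t x
    using assms(11)[OF that] by (simp add: F.T_def)
  have "bij_betw (\<Phi> t) ?I ?I \<and> \<Phi> t differentiable_on ?I \<and>
        (\<forall>y\<in>?I. pd ?I (\<Phi> t) y \<noteq> 0 \<and> (\<lambda>s. \<Phi> s y) differentiable (at t within {0..}))"
    if t: "t \<ge> 0" for t
  proof (intro conjI ballI)
    show "bij_betw (\<Phi> t) ?I ?I" by (rule F.\<Phi>_bij[OF t])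
    show "\<Phi> t differentiable_on ?I"
      using q(2)[OF t] unfolding differentiable_on_def real_differentiable_def by blast
    fix y assume y: "y \<in> ?I"
    show "pd ?I (\<Phi> t) y \<noteq> 0" using pd_\<Phi>[OF t y] m_pos[OF y] q(1)[OF t y] by simp
    show "(\<lambda>s. \<Phi> s y) differentiable (at t within {0..})"
      by (rule F.eulerian(5)[where u = u and \<rho> = \<rho>, OF u \<rho> t y])
  qed
  then show ?thesis
    by (intro conjI allI impI F.eulerian(1-4,6)[where u = u and \<rho> = \<rho>, OF u \<rho>]) auto
qed

end
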